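(* Let $M$ be a smooth manifold (without boundary), let $k \ge 0$ be an integer, and let $\mathcal{P} \subseteq \mathbb{R}^n$ be an open set. Let $\{\omega_x\}_{x \in \mathcal{P}}$ be a family of exact $(k+1)$-forms on $M$ which depends smoothly on the parameter $x \in \mathcal{P}$. Then there exists a smooth family of $k$-forms $\{\tau_x\}_{x \in \mathcal{P}}$ on $M$ (that is, a family depending smoothly on $x \in \mathcal{P}$) such that $d\tau_x = \omega_x$ for each $x \in \mathcal{P}$.
   Context: Manifolds are smooth, second countable, and without boundary; $\Omega^q(M)$ denotes the real vector space of smooth $q$-forms on $M$, and $d$ is the exterior derivative. A $(k+1)$-form $\omega$ on $M$ is exact if $\omega = d\eta$ for some $\eta \in \Omega^k(M)$; in the hypothesis, exactness is assumed separately for each $x$, with no smoothness in $x$ of the primitives. Smooth dependence on the parameter: a family $\{\tau_x\}_{x\in\mathcal{P}}$ of $q$-forms on $M$ depends smoothly on $x \in \mathcal{P}$ (is a smooth family) if, for $q = 0$, the function $F : M \times \mathcal{P} \to \mathbb{R}$, $F(m,x) = \tau_x(m)$, is $C^\infty$; and, for $q \ge 1$, for every collection of smooth vector fields $X_1, \dots, X_q$ on $M$ the function $F_{X_1,\dots,X_q} : M \times \mathcal{P} \to \mathbb{R}$, $F_{X_1,\dots,X_q}(m,x) = (\tau_x(X_1,\dots,X_q))(m)$, is $C^\infty$. *)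

theory Defs
  imports "HOL-Analysis.Analysis"
begin

(* The spaces R^n are taken to be the finite-dimensional real inner product spaces.  The only
   difference from the class euclidean_space is that dimension 0 is allowed, so that
   0-dimensional manifolds and parameter sets in R^0 are covered; see the instances below. *)

class finite_dim_inner = real_inner +
  assumes finite_dim: "\<exists>B. finite B \<and> (\<forall>x. \<exists>c. x = (\<Sum>b\<in>B. c b *\<^sub>R b))"

instance euclidean_space \<subseteq> finite_dim_inner
proof
  show "\<exists>B. finite B \<and> (\<forall>x::'a. \<exists>c. x = (\<Sum>b\<in>B. c b *\<^sub>R b))"
    by (metis finite_Basis euclidean_representation)
qed

instantiation unit :: real_inner
begin

definition zero_unit :: unit where "zero_unit = ()"
definition plus_unit :: "unit \<Rightarrow> unit \<Rightarrow> unit" where "plus_unit x y = ()"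
definition scaleR_unit :: "real \<Rightarrow> unit \<Rightarrow> unit" where "scaleR_unit c x = ()"
definition inner_unit :: "unit \<Rightarrow> unit \<Rightarrow> real" where "inner_unit x y = 0"
definition norm_unit :: "unit \<Rightarrow> real" where "norm_unit x = 0"
definition sgn_unit :: "unit \<Rightarrow> unit" where "sgn_unit x = ()"
definition dist_unit :: "unit \<Rightarrow> unit \<Rightarrow> real" where "dist_unit x y = 0"
definition uniformity_unit :: "(unit \<times> unit) filter"
  where "uniformity_unit = (INF e\<in>{0<..}. principal {(x, y). dist x y < e})"
definition open_unit :: "unit set \<Rightarrow> bool"
  where "open_unit U \<longleftrightarrow> (\<forall>x\<in>U. \<forall>\<^sub>F (x', y) in uniformity. x' = x \<longrightarrow> y \<in> U)"

instance
  by standard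
    (simp_all add: inner_unit_def norm_unit_def dist_unit_def uniformity_unit_def open_unit_def)

end

instance unit :: finite_dim_inner
proof
  show "\<exists>B. finite B \<and> (\<forall>x::unit. \<exists>c. x = (\<Sum>b\<in>B. c b *\<^sub>R b))"
    by (rule exI[of _ "{}"]) simp
qed


(* Meant for open S.  In finite dimension, existence and continuity of all iterated
   directional derivatives up to order r is the same as being C^r. *)

primrec Ck_on :: "nat \<Rightarrow> 'a set \<Rightarrow> ('a::real_normed_vector \<Rightarrow> 'b::real_normed_vector) \<Rightarrow> bool"
where
  "Ck_on 0 S f \<longleftrightarrow> continuous_on S f"
| "Ck_on (Suc r) S f \<longleftrightarrow> (\<forall>x\<in>S. f differentiable (at x)) \<and>
     (\<forall>v. Ck_on r S (\<lambda>x. frechet_derivative f (at x) v))"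

definition Cinf_on :: "'a set \<Rightarrow> ('a::real_normed_vector \<Rightarrow> 'b::real_normed_vector) \<Rightarrow> bool"
  where "Cinf_on S f \<longleftrightarrow> (\<forall>r. Ck_on r S f)"


type_synonym ('a, 'e) chart = "'a set \<times> ('a \<Rightarrow> 'e)"

definition is_chart :: "'a topology \<Rightarrow> ('a, 'e::finite_dim_inner) chart \<Rightarrow> bool"
  where "is_chart X = (\<lambda>(U, \<phi>). openin X U \<and> open (\<phi> ` U) \<and>
     homeomorphic_map (subtopology X U) (top_of_set (\<phi> ` U)) \<phi>)"

(* The atlas need not be maximal; it determines the smooth structure. *)
definition smooth_manifold :: "'a topology \<Rightarrow> ('a, 'e::finite_dim_inner) chart set \<Rightarrow> bool"
  where "smooth_manifold X A \<longleftrightarrow>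
     Hausdorff_space X \<and> second_countable X \<and>
     (\<forall>c\<in>A. is_chart X c) \<and> (\<Union>(U, \<phi>)\<in>A. U) = topspace X \<and>
     (\<forall>(U, \<phi>)\<in>A. \<forall>(V, \<psi>)\<in>A. Cinf_on (\<phi> ` (U \<inter> V)) (\<psi> \<circ> inv_into U \<phi>))"

definition smooth_fun :: "('a, 'e::real_normed_vector) chart set \<Rightarrow> ('a \<Rightarrow> real) \<Rightarrow> bool"
  where "smooth_fun A f \<longleftrightarrow> (\<forall>(U, \<phi>)\<in>A. Cinf_on (\<phi> ` U) (f \<circ> inv_into U \<phi>))"

(* Functions on the manifold are represented by functions on the whole type vanishing outside
   topspace X, so that distinct elements of this set are distinct functions on the manifold. *)
definition smooth_functions ::
    "'a topology \<Rightarrow> ('a, 'e::finite_dim_inner) chart set \<Rightarrow> ('a \<Rightarrow> real) set"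
  where "smooth_functions X A = {f. smooth_fun A f \<and> (\<forall>p. p \<notin> topspace X \<longrightarrow> f p = 0)}"

type_synonym 'a tvec = "('a \<Rightarrow> real) \<Rightarrow> real"

(* Tangent vectors are the derivations at p of the algebra of smooth functions; the value 0 on
   other functions is only a normalisation. *)
definition tangent_space ::
    "'a topology \<Rightarrow> ('a, 'e::finite_dim_inner) chart set \<Rightarrow> 'a \<Rightarrow> 'a tvec set"
  where "tangent_space X A p = {v.
     (\<forall>f\<in>smooth_functions X A. \<forall>g\<in>smooth_functions X A. \<forall>a b.
        v (\<lambda>q. a * f q + b * g q) = a * v f + b * v g) \<and>
     (\<forall>f\<in>smooth_functions X A. \<forall>g\<in>smooth_functions X A.
        v (\<lambda>q. f q * g q) = f p * v g + g p * v f) \<and>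
     (\<forall>f. f \<notin> smooth_functions X A \<longrightarrow> v f = 0)}"

definition vector_fields ::
    "'a topology \<Rightarrow> ('a, 'e::finite_dim_inner) chart set \<Rightarrow> ('a \<Rightarrow> 'a tvec) set"
  where "vector_fields X A = {Y.
     (\<forall>p\<in>topspace X. Y p \<in> tangent_space X A p) \<and>
     (\<forall>f\<in>smooth_functions X A. smooth_fun A (\<lambda>p. Y p f))}"


(* A q-form assigns to each point a function of lists of tangent vectors, of which only the
   values on lists of length q of vectors tangent at that point matter. *)
type_synonym 'a form = "'a \<Rightarrow> 'a tvec list \<Rightarrow> real"

definition alternating_multilinear :: "nat \<Rightarrow> 'a tvec set \<Rightarrow> ('a tvec list \<Rightarrow> real) \<Rightarrow> bool"
  where "alternating_multilinear q V \<alpha> \<longleftrightarrow>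
     (\<forall>vs. length vs = q \<longrightarrow> set vs \<subseteq> V \<longrightarrow>
        (\<forall>i<q. \<forall>v\<in>V. \<forall>w\<in>V. \<forall>a b.
           \<alpha> (vs[i := (\<lambda>f. a * v f + b * w f)]) = a * \<alpha> (vs[i := v]) + b * \<alpha> (vs[i := w])) \<and>
        (\<forall>i j. i < j \<longrightarrow> j < q \<longrightarrow> vs ! i = vs ! j \<longrightarrow> \<alpha> vs = 0))"

definition form_eval :: "'a form \<Rightarrow> ('a \<Rightarrow> 'a tvec) list \<Rightarrow> 'a \<Rightarrow> real"
  where "form_eval \<alpha> Ys p = \<alpha> p (map (\<lambda>Y. Y p) Ys)"

definition smooth_forms ::
    "'a topology \<Rightarrow> ('a, 'e::finite_dim_inner) chart set \<Rightarrow> nat \<Rightarrow> 'a form set"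
  where "smooth_forms X A q = {\<alpha>.
     (\<forall>p\<in>topspace X. alternating_multilinear q (tangent_space X A p) (\<alpha> p)) \<and>
     (\<forall>Ys. length Ys = q \<longrightarrow> set Ys \<subseteq> vector_fields X A \<longrightarrow> smooth_fun A (form_eval \<alpha> Ys))}"


(* The vector at p with components e in the chart: the directional derivative along e. *)
definition coord_vec ::
    "'a topology \<Rightarrow> ('a, 'e::finite_dim_inner) chart set \<Rightarrow> ('a, 'e) chart \<Rightarrow> 'a \<Rightarrow> 'e \<Rightarrow> 'a tvec"
  where "coord_vec X A = (\<lambda>(U, \<phi>) p e f.
     if f \<in> smooth_functions X A
     then frechet_derivative (f \<circ> inv_into U \<phi>) (at (\<phi> p)) e else 0)"

definition coord_rep ::
    "'a topology \<Rightarrow> ('a, 'e::finite_dim_inner) chart set \<Rightarrow> ('a, 'e) chart \<Rightarrow> 'a form \<Rightarrow>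
       'e \<Rightarrow> 'e list \<Rightarrow> real"
  where "coord_rep X A = (\<lambda>(U, \<phi>) \<alpha> y es.
     \<alpha> (inv_into U \<phi> y) (map (coord_vec X A (U, \<phi>) (inv_into U \<phi> y)) es))"

(* d eta = omega for a k-form eta and a (k+1)-form omega: in every chart the coordinate
   representations satisfy the usual formula
     (d eta)(e_0, ..., e_k) = sum over i of (-1)^i times the derivative along e_i of
                              eta(e_0, ..., e_k with e_i omitted)
   for constant e_0, ..., e_k (equivalently, d (a dx_J) = da wedge dx_J). *)
definition has_ext_deriv ::
    "'a topology \<Rightarrow> ('a, 'e::finite_dim_inner) chart set \<Rightarrow> nat \<Rightarrow> 'a form \<Rightarrow> 'a form \<Rightarrow> bool"
  where "has_ext_deriv X A k \<eta> \<omega> \<longleftrightarrow>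
     (\<forall>(U, \<phi>)\<in>A. \<forall>y\<in>\<phi> ` U. \<forall>es. length es = Suc k \<longrightarrow>
        coord_rep X A (U, \<phi>) \<omega> y es =
          (\<Sum>i\<le>k. (-1) ^ i *
             frechet_derivative (\<lambda>z. coord_rep X A (U, \<phi>) \<eta> z (take i es @ drop (Suc i) es))
               (at y) (es ! i)))"

definition exact_form ::
    "'a topology \<Rightarrow> ('a, 'e::finite_dim_inner) chart set \<Rightarrow> nat \<Rightarrow> 'a form \<Rightarrow> bool"
  where "exact_form X A k \<omega> \<longleftrightarrow>
     \<omega> \<in> smooth_forms X A (Suc k) \<and> (\<exists>\<eta>\<in>smooth_forms X A k. has_ext_deriv X A k \<eta> \<omega>)"


definition prod_atlas ::
    "('a, 'e::finite_dim_inner) chart set \<Rightarrow> 'p::finite_dim_inner set \<Rightarrow> ('a \<times> 'p, 'e \<times> 'p) chart set"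
  where "prod_atlas A P = (\<lambda>(U, \<phi>). (U \<times> P, map_prod \<phi> id)) ` A"

(* For q = 0 the only list of vector fields is the empty one, and the condition says that
   (m, x) |-> \<tau> x m [] is smooth. *)
definition smooth_family ::
    "'a topology \<Rightarrow> ('a, 'e::finite_dim_inner) chart set \<Rightarrow> 'p::finite_dim_inner set \<Rightarrow> nat \<Rightarrow>
       ('p \<Rightarrow> 'a form) \<Rightarrow> bool"
  where "smooth_family X A P q \<tau> \<longleftrightarrow>
     (\<forall>x\<in>P. \<tau> x \<in> smooth_forms X A q) \<and>
     (\<forall>Ys. length Ys = q \<longrightarrow> set Ys \<subseteq> vector_fields X A \<longrightarrow>
        smooth_fun (prod_atlas A P) (\<lambda>(m, x). form_eval (\<tau> x) Ys m))"

end

theory Submission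
  imports Defs "HOL-Library.Function_Algebras"
begin

text \<open>A small ball in one chart is convex in every other chart nearby, so \<open>M\<close> has an open cover all of
  whose finite intersections are convex in some chart. On such an intersection the Poincare homotopy
  operator yields primitives that depend smoothly on the parameter, and a partition of unity contracts
  the Cech complex of such a cover. Descending the Cech--de Rham double complex therefore reduces the
  problem to degree zero: a Cech cocycle of constants that depends smoothly on \<open>x\<close> and is a coboundary
  for each \<open>x\<close> separately has to be a coboundary smoothly in \<open>x\<close>. Here one is solving a linear system
  with finite rows, and such a system has a solution operator, independent of \<open>x\<close>, each component of
  which is a finite linear combination of the right-hand sides.\<close>

section \<open>Finite-dimensional inner product spaces\<close>

text \<open>The primitives given for the individual x may jump with x, so they never enter the
  answer; they only show that certain closedness and solvability conditions hold. Local integration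
  produces primitives that are smooth in x, and what obstructs gluing them is a Cech class. Since M
  need not be compact, the cover and the cohomology may be infinite, so smoothness in x of the final
  correction cannot come from finite-dimensional linear algebra. It comes from each unknown being a
  finite combination, with coefficients free of x, of right-hand sides that are smooth in x. The
  hypothesis carried through the descent is therefore pointwise: for each x there is a primitive
  that is a Cech cocycle. Cochains are indexed by all lists of indices, with neither order nor
  antisymmetry, so that the contraction simply prepends an index. Linear algebra rests on a chosen
  orthonormal basis, which also covers dimension 0.\<close>

lemma orthonormal_spanning:
  fixes S :: "'a::real_inner set"
  assumes "finite S"
  shows "\<exists>B. finite B \<and> (\<forall>b\<in>B. \<forall>c\<in>B. b \<bullet> c = (if b = c then 1 else 0)) \<and> span S \<subseteq> span B"
  using assms
proof (induction S rule: finite_induct)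
  case empty
  show ?case by (rule exI[of _ "{}"]) auto
next
  case (insert a S)
  then obtain B where B: "finite B" "\<forall>b\<in>B. \<forall>c\<in>B. b \<bullet> c = (if b = c then 1 else 0)"
    "span S \<subseteq> span B" by blast
  define r where "r = a - (\<Sum>b\<in>B. (a \<bullet> b) *\<^sub>R b)"
  have orth: "r \<bullet> c = 0" if "c \<in> B" for c
  proof -
    have "(\<Sum>b\<in>B. (a \<bullet> b) * (b \<bullet> c)) = (\<Sum>b\<in>B. if b = c then a \<bullet> b else 0)"
      using B(2) that by (intro sum.cong) auto
    then show ?thesis using B(1) that by (simp add: r_def inner_diff_left inner_sum_left)
  qed
  have aB: "a - r \<in> span B" unfolding r_def by (simp, intro span_sum span_scale span_base)
  show ?case
  proof (cases "r = 0")
    case True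
    then have "a \<in> span B" using aB by simp
    then have "span (insert a S) \<subseteq> span B"
      using B(3) by (intro span_minimal) (auto intro: span_base)
    then show ?thesis using B by blast
  next
    case False
    define u where "u = r /\<^sub>R norm r"
    have u: "u \<bullet> u = 1" "\<And>c. c \<in> B \<Longrightarrow> u \<bullet> c = 0"
      using False orth by (auto simp: u_def dot_square_norm power2_eq_square)
    have ru: "r = norm r *\<^sub>R u" using False by (simp add: u_def)
    have "a = (a - r) + norm r *\<^sub>R u" using ru by simp
    moreover have "(a - r) + norm r *\<^sub>R u \<in> span (insert u B)"
      using aB span_mono[of B "insert u B"] by (intro span_add span_scale) (auto intro: span_base)
    ultimately have "a \<in> span (insert u B)" by simp
    moreover have "S \<subseteq> span (insert u B)"
      using B(3) span_mono[of B "insert u B"] span_base by blast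
    ultimately have "span (insert a S) \<subseteq> span (insert u B)" by (intro span_minimal) auto
    moreover have "\<forall>b\<in>insert u B. \<forall>c\<in>insert u B. b \<bullet> c = (if b = c then 1 else 0)"
      using u B(2) by (auto simp: inner_commute)
    ultimately show ?thesis using B(1) by (intro exI[of _ "insert u B"]) auto
  qed
qed

text \<open>A fixed orthonormal basis, empty in dimension 0. Orthonormality makes
  \<open>x \<bullet> b\<close> the coordinate of \<open>x\<close> along \<open>b\<close>, so
  expansions below are finite sums over \<open>onb\<close>.\<close>

definition onb :: "'a::finite_dim_inner set" where
  "onb = (SOME B. finite B \<and> (\<forall>b\<in>B. \<forall>c\<in>B. b \<bullet> c = (if b = c then 1 else 0)) \<and> span B = UNIV)"

lemma onb_ex:
  "\<exists>B::'a::finite_dim_inner set. finite B \<and> (\<forall>b\<in>B. \<forall>c\<in>B. b \<bullet> c = (if b = c then 1 else 0)) \<and> span B = UNIV"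
proof -
  obtain S :: "'a set" where S: "finite S" "\<forall>x. \<exists>c. x = (\<Sum>b\<in>S. c b *\<^sub>R b)"
    using finite_dim by blast
  have "x \<in> span S" for x
  proof -
    obtain c where "x = (\<Sum>b\<in>S. c b *\<^sub>R b)" using S(2) by blast
    then show ?thesis by (rule ssubst) (intro span_sum span_scale span_base)
  qed
  then have "span S = UNIV" by auto
  then show ?thesis using orthonormal_spanning[OF S(1)] by (metis top.extremum_uniqueI)
qed

lemma finite_onb [simp]: "finite (onb :: 'a::finite_dim_inner set)"
  and onb_inner: "b \<in> onb \<Longrightarrow> c \<in> onb \<Longrightarrow> b \<bullet> c = (if b = (c::'a) then 1 else 0)"
  and span_onb: "span onb = (UNIV :: 'a set)"
  using someI_ex[OF onb_ex] unfolding onb_def[symmetric] by auto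

lemma onb_expand: "(\<Sum>b\<in>onb. (x \<bullet> b) *\<^sub>R b) = (x::'a::finite_dim_inner)"
proof -
  have "x \<in> span onb" using span_onb by auto
  then show ?thesis
  proof (induction rule: span_induct_alt)
    case base
    show ?case by simp
  next
    case (step c y z)
    have "(\<Sum>b\<in>onb. (y \<bullet> b) *\<^sub>R b) = (\<Sum>b\<in>onb. if b = y then y else 0)"
      using step(1) by (intro sum.cong) (auto simp: onb_inner)
    also have "\<dots> = y" using step(1) by simp
    finally have "(\<Sum>b\<in>onb. (y \<bullet> b) *\<^sub>R b) = y" .
    then show ?case using step(2)
      by (simp add: inner_add_left scaleR_add_left sum.distrib scaleR_sum_right [symmetric]
          flip: scaleR_scaleR)
  qed
qed

lemma linear_onb_expand:
  fixes f :: "'a::finite_dim_inner \<Rightarrow> 'b::real_vector"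
  assumes "linear f"
  shows "f x = (\<Sum>b\<in>onb. (x \<bullet> b) *\<^sub>R f b)"
proof -
  have "f x = f (\<Sum>b\<in>onb. (x \<bullet> b) *\<^sub>R b)" by (simp add: onb_expand)
  then show ?thesis by (simp add: linear_sum[OF assms] linear_scale[OF assms])
qed

lemma norm_onb_le:
  assumes "b \<in> onb"
  shows "norm (b::'a::finite_dim_inner) = 1"
  using onb_inner[OF assms assms] by (simp add: norm_eq_sqrt_inner)

text \<open>Combinations of a finite set of vectors with coefficients bounded by \<open>R\<close>
  form a compact set, because each further vector adds a compact segment. The ball is a closed part
  of such a set, its coordinates being bounded by Cauchy-Schwarz.\<close>

lemma compact_cball_finite_dim: "compact (cball (a::'a::finite_dim_inner) r)"
proof -
  have "compact {x. \<exists>c. x = (\<Sum>b\<in>B. c b *\<^sub>R b) \<and> (\<forall>b\<in>B. \<bar>c b\<bar> \<le> R)}" if "finite B" for R and B :: "'a set"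
    using that
  proof (induction B rule: finite_induct)
    case empty
    show ?case by (simp add: Collect_conv_if)
  next
    case (insert u B)
    let ?S = "{x. \<exists>c. x = (\<Sum>b\<in>B. c b *\<^sub>R b) \<and> (\<forall>b\<in>B. \<bar>c b\<bar> \<le> R)}"
    let ?I = "(\<lambda>t. t *\<^sub>R u) ` {-R..R}"
    have "{x. \<exists>c. x = (\<Sum>b\<in>insert u B. c b *\<^sub>R b) \<and> (\<forall>b\<in>insert u B. \<bar>c b\<bar> \<le> R)}
        = {x + y |x y. x \<in> ?I \<and> y \<in> ?S}" (is "?L = ?R")
    proof (intro equalityI subsetI)
      fix x assume "x \<in> ?L"
      then show "x \<in> ?R" using insert(1,2) by (fastforce simp: abs_le_iff)
    next
      fix x assume "x \<in> ?R"
      then obtain t c where "t \<in> {-R..R}" and tc: "x = t *\<^sub>R u + (\<Sum>b\<in>B. c b *\<^sub>R b)" "\<forall>b\<in>B. \<bar>c b\<bar> \<le> R"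
        by blast
      then have "\<bar>t\<bar> \<le> R" by auto
      have "(\<Sum>b\<in>B. (c(u := t)) b *\<^sub>R b) = (\<Sum>b\<in>B. c b *\<^sub>R b)"
        using insert(2) by (intro sum.cong) auto
      then show "x \<in> ?L" using tc \<open>\<bar>t\<bar> \<le> R\<close> insert(1,2) by (intro CollectI exI[of _ "c(u := t)"]) auto
    qed
    moreover have "compact {x + y |x y. x \<in> ?I \<and> y \<in> ?S}"
      by (intro compact_sums compact_continuous_image insert.IH) (auto intro!: continuous_intros)
    ultimately show ?case by simp
  qed
  from this[OF finite_onb, of "norm a + \<bar>r\<bar>"]
  have "compact (cball a r \<inter> {x. \<exists>c. x = (\<Sum>b\<in>onb. c b *\<^sub>R b) \<and> (\<forall>b\<in>onb. \<bar>c b\<bar> \<le> norm a + \<bar>r\<bar>)})"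
    by (intro closed_Int_compact) auto
  moreover have "cball a r \<subseteq> {x. \<exists>c. x = (\<Sum>b\<in>onb. c b *\<^sub>R b) \<and> (\<forall>b\<in>onb. \<bar>c b\<bar> \<le> norm a + \<bar>r\<bar>)}"
  proof
    fix x assume "x \<in> cball a r"
    then have "norm x \<le> norm a + \<bar>r\<bar>"
      using norm_triangle_sub[of x a] by (auto simp: dist_norm norm_minus_commute)
    then have "\<bar>x \<bullet> b\<bar> \<le> norm a + \<bar>r\<bar>" if "b \<in> onb" for b
      using Cauchy_Schwarz_ineq2[of x b] norm_onb_le[OF that] by simp
    then show "x \<in> {x. \<exists>c. x = (\<Sum>b\<in>onb. c b *\<^sub>R b) \<and> (\<forall>b\<in>onb. \<bar>c b\<bar> \<le> norm a + \<bar>r\<bar>)}"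
      by (auto intro!: exI[of _ "\<lambda>b. x \<bullet> b"] simp: onb_expand)
  qed
  ultimately show ?thesis by (simp add: Int_absorb2)
qed

text \<open>Cauchy sequences converge because their finitely many coordinates do. The parameter
  space in \<open>leibniz_rule\<close> has to be a Banach space.\<close>

instance finite_dim_inner \<subseteq> banach
proof
  fix f :: "nat \<Rightarrow> 'a" assume f: "Cauchy f"
  have "convergent (\<lambda>n. f n \<bullet> b)" for b
    using bounded_linear.Cauchy[OF bounded_linear_inner_left f] by (simp add: Cauchy_convergent_iff)
  then have "\<forall>b. \<exists>l. (\<lambda>n. f n \<bullet> b) \<longlonglongrightarrow> l" by (auto simp: convergent_def)
  then obtain l where l: "\<And>b. (\<lambda>n. f n \<bullet> b) \<longlonglongrightarrow> l b" by metis
  have "(\<lambda>n. \<Sum>b\<in>onb. (f n \<bullet> b) *\<^sub>R b) \<longlonglongrightarrow> (\<Sum>b\<in>onb. l b *\<^sub>R b)"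
    by (intro tendsto_intros l)
  then show "convergent f" by (auto simp: onb_expand convergent_def)
qed

instance prod :: (finite_dim_inner, finite_dim_inner) finite_dim_inner
proof
  let ?B = "(\<lambda>b. (b, 0)) ` (onb::'a set) \<union> (\<lambda>b. (0, b)) ` (onb::'b set)"
  have *: "\<exists>c. x = (\<Sum>b\<in>?B. c b *\<^sub>R b)" for x :: "'a \<times> 'b"
  proof -
    \<comment> \<open>Basis vectors are nonzero, so the two embedded bases are disjoint and the sum
      over their union splits.\<close>
    have 0: "(0::'a) \<notin> onb" "(0::'b) \<notin> onb" using norm_onb_le[of "0::'a"] norm_onb_le[of "0::'b"] by auto
    have "(\<Sum>b\<in>?B. (x \<bullet> b) *\<^sub>R b) = (\<Sum>b\<in>(\<lambda>b. (b, 0)) ` (onb::'a set). (x \<bullet> b) *\<^sub>R b)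
        + (\<Sum>b\<in>(\<lambda>b. (0, b)) ` (onb::'b set). (x \<bullet> b) *\<^sub>R b)"
      using 0 by (intro sum.union_disjoint) auto
    also have "\<dots> = (\<Sum>b\<in>onb. (fst x \<bullet> b) *\<^sub>R (b, 0)) + (\<Sum>b\<in>onb. (snd x \<bullet> b) *\<^sub>R (0, b))"
      by (subst (1 2) sum.reindex) (auto simp: inj_on_def inner_Pair_0 o_def)
    also have "\<dots> = (\<Sum>b\<in>onb. (fst x \<bullet> b) *\<^sub>R b, \<Sum>b\<in>onb. (snd x \<bullet> b) *\<^sub>R b)"
      by (intro prod_eqI) (simp_all add: fst_sum snd_sum)
    also have "\<dots> = x" by (simp only: onb_expand prod.collapse)
    finally have "x = (\<Sum>b\<in>?B. (x \<bullet> b) *\<^sub>R b)" by (rule sym)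
    then show ?thesis by (rule exI[where P="\<lambda>c. x = (\<Sum>b\<in>?B. c b *\<^sub>R b)"])
  qed
  have "finite ?B" by simp
  with * show "\<exists>B. finite B \<and> (\<forall>x::'a \<times> 'b. \<exists>c. x = (\<Sum>b\<in>B. c b *\<^sub>R b))"
    by blast
qed

section \<open>Calculus of functions of class Ck\<close>

abbreviation FD :: "('a::real_normed_vector \<Rightarrow> 'b::real_normed_vector) \<Rightarrow> 'a \<Rightarrow> 'a \<Rightarrow> 'b" where
  "FD f x \<equiv> frechet_derivative f (at x)"

lemma FD_eq: "(f has_derivative f') (at x) \<Longrightarrow> FD f x = f'"
  by (metis frechet_derivative_at)

lemma has_derivative_cong_open:
  assumes "open S" "x \<in> S" "\<And>y. y \<in> S \<Longrightarrow> f y = g y"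
  shows "(f has_derivative f') (at x) \<longleftrightarrow> (g has_derivative f') (at x)"
  using has_derivative_transform_within_open[of _ f' x UNIV S] assms by (metis (full_types))

lemma FD_cong_open:
  assumes "open S" "x \<in> S" "\<And>y. y \<in> S \<Longrightarrow> f y = g y"
  shows "FD f x = FD g x"
  unfolding frechet_derivative_def using has_derivative_cong_open[OF assms] by presburger

lemma differentiable_cong_open:
  assumes "open S" "x \<in> S" "\<And>y. y \<in> S \<Longrightarrow> f y = g y"
  shows "f differentiable (at x) \<longleftrightarrow> g differentiable (at x)"
  unfolding differentiable_def using has_derivative_cong_open[OF assms] by presburger

text \<open>\<open>FD\<close> looks at a full neighbourhood of the point, so agreement on
  \<open>S\<close> controls derivatives only for open \<open>S\<close>. The induction lets
  \<open>f\<close> and \<open>g\<close> vary because the next order compares their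
  derivatives.\<close>

lemma Ck_on_cong:
  assumes "open S" "\<And>y. y \<in> S \<Longrightarrow> f y = g y"
  shows "Ck_on r S f \<longleftrightarrow> Ck_on r S g"
  using assms(2)
proof (induction r arbitrary: f g)
  case 0
  then show ?case by (simp cong: continuous_on_cong)
next
  case (Suc r)
  have "(f differentiable (at x)) = (g differentiable (at x))" if "x \<in> S" for x
    using differentiable_cong_open[OF assms(1) that] Suc.prems by blast
  moreover have "Ck_on r S (\<lambda>x. FD f x v) \<longleftrightarrow> Ck_on r S (\<lambda>x. FD g x v)" for v
  proof (rule Suc.IH)
    fix y assume "y \<in> S"
    show "FD f y v = FD g y v" using FD_cong_open[OF assms(1) \<open>y \<in> S\<close>, of f g] Suc.prems by simp
  qed
  ultimately show ?case by auto
qed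

lemma Cinf_on_cong:
  assumes "open S" "\<And>y. y \<in> S \<Longrightarrow> f y = g y"
  shows "Cinf_on S f \<longleftrightarrow> Cinf_on S g"
  unfolding Cinf_on_def using Ck_on_cong[where f=f and g=g, OF assms] by simp

lemma Ck_on_subset: "Ck_on r S f \<Longrightarrow> T \<subseteq> S \<Longrightarrow> Ck_on r T f"
  by (induction r arbitrary: f) (auto intro: continuous_on_subset)

lemma Cinf_on_congI:
  assumes "Cinf_on S g" "open S" "\<And>y. y \<in> S \<Longrightarrow> f y = g y"
  shows "Cinf_on S f"
  using assms Cinf_on_cong[where f=f and g=g] by blast

lemma Cinf_on_empty: "Cinf_on {} f"
proof -
  have "Ck_on r {} f" for r by (induction r arbitrary: f) auto
  then show ?thesis by (simp add: Cinf_on_def)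
qed

lemma Cinf_on_subset: "Cinf_on S f \<Longrightarrow> T \<subseteq> S \<Longrightarrow> Cinf_on T f"
  unfolding Cinf_on_def using Ck_on_subset by blast

lemma Ck_on_Suc_imp: "Ck_on (Suc r) S f \<Longrightarrow> Ck_on r S f"
proof (induction r arbitrary: f)
  case 0
  then show ?case
    by (auto intro!: continuous_at_imp_continuous_on simp: differentiable_imp_continuous_within)
next
  case (Suc r)
  then show ?case by (metis Ck_on.simps(2))
qed

lemma Ck_on_le: "Ck_on s S f \<Longrightarrow> r \<le> s \<Longrightarrow> Ck_on r S f"
proof (induction s)
  case (Suc s)
  then show ?case using Ck_on_Suc_imp by (metis le_SucE)
qed simp

lemma Ck_on_continuous: "Ck_on r S f \<Longrightarrow> continuous_on S f"
  using Ck_on_le[of r S f 0] by simp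

lemma Ck_on_FD: "Ck_on (Suc r) S f \<Longrightarrow> Ck_on r S (\<lambda>x. FD f x v)"
  by simp

lemma Ck_on_has_derivative: "Ck_on (Suc r) S f \<Longrightarrow> x \<in> S \<Longrightarrow> (f has_derivative FD f x) (at x)"
  by (simp add: frechet_derivative_works)

lemma Cinf_on_FD: "Cinf_on S f \<Longrightarrow> Cinf_on S (\<lambda>x. FD f x v)"
  unfolding Cinf_on_def using Ck_on_FD by blast

lemma Cinf_on_has_derivative: "Cinf_on S f \<Longrightarrow> x \<in> S \<Longrightarrow> (f has_derivative FD f x) (at x)"
  unfolding Cinf_on_def using Ck_on_has_derivative by blast

lemma Cinf_on_continuous: "Cinf_on S f \<Longrightarrow> continuous_on S f"
  unfolding Cinf_on_def using Ck_on_continuous by blast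

text \<open>Replaces the choice made by \<open>frechet_derivative\<close> by an explicit derivative
  \<open>D\<close>. Closure rules run through this: name the derivative, then apply the induction
  hypothesis to its directional values.\<close>

lemma Ck_on_SucI:
  assumes "open S" "\<And>x. x \<in> S \<Longrightarrow> (f has_derivative D x) (at x)" "\<And>v. Ck_on r S (\<lambda>x. D x v)"
  shows "Ck_on (Suc r) S f"
proof -
  have "Ck_on r S (\<lambda>x. FD f x v) \<longleftrightarrow> Ck_on r S (\<lambda>x. D x v)" for v
    by (rule Ck_on_cong[OF assms(1)]) (simp add: FD_eq[OF assms(2)])
  then show ?thesis using assms by (auto simp: differentiable_def)
qed

lemma Ck_on_local:
  assumes "\<And>x. x \<in> S \<Longrightarrow> \<exists>T. open T \<and> x \<in> T \<and> Ck_on r (T \<inter> S) f" "open S"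
  shows "Ck_on r S f"
  using assms(1)
proof (induction r arbitrary: f)
  case 0
  have "continuous (at x) f" if xS: "x \<in> S" for x
  proof -
    obtain T where "open T" "x \<in> T" "continuous_on (T \<inter> S) f" using "0.prems"[OF xS] by (metis Ck_on.simps(1))
    then show ?thesis using assms(2) xS by (meson IntI continuous_on_eq_continuous_at open_Int)
  qed
  then show ?case by (simp add: continuous_at_imp_continuous_on)
next
  case (Suc r)
  have "f differentiable (at x)" if "x \<in> S" for x using Suc.prems[OF that] that by auto
  moreover have "Ck_on r S (\<lambda>x. FD f x v)" for v
    by (rule Suc.IH) (use Suc.prems in fastforce)
  ultimately show ?case by simp
qed

lemma Cinf_on_local:
  assumes "\<And>x. x \<in> S \<Longrightarrow> \<exists>T. open T \<and> x \<in> T \<and> Cinf_on (T \<inter> S) f" "open S"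
  shows "Cinf_on S f"
  unfolding Cinf_on_def
proof
  fix r show "Ck_on r S f"
  proof (rule Ck_on_local[OF _ assms(2)])
    fix x assume "x \<in> S"
    then show "\<exists>T. open T \<and> x \<in> T \<and> Ck_on r (T \<inter> S) f"
      using assms(1)[of x] by (auto simp: Cinf_on_def)
  qed
qed

lemma Ck_on_const: "Ck_on r S (\<lambda>x. c)"
  by (induction r arbitrary: c) auto

lemma Ck_on_bounded_linear_comp:
  assumes "bounded_linear L" "Ck_on r S f" "open S"
  shows "Ck_on r S (\<lambda>x. L (f x))"
  using assms(2)
proof (induction r arbitrary: f)
  case 0
  then show ?case using bounded_linear.continuous_on[OF assms(1)] by simp
next
  case (Suc r)
  show ?case
  proof (rule Ck_on_SucI[OF assms(3)])
    fix x assume "x \<in> S"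
    show "((\<lambda>x. L (f x)) has_derivative (\<lambda>v. L (FD f x v))) (at x)"
      by (rule bounded_linear.has_derivative[OF assms(1) Ck_on_has_derivative[OF Suc.prems \<open>x \<in> S\<close>]])
  qed (rule Suc.IH[OF Ck_on_FD[OF Suc.prems]])
qed

lemma Ck_on_bounded_linear:
  assumes "bounded_linear L"
  shows "Ck_on r S L"
proof -
  have "Ck_on r UNIV L"
  proof (cases r)
    case 0
    then show ?thesis using assms by (simp add: linear_continuous_on)
  next
    case (Suc m)
    have "Ck_on (Suc m) UNIV L"
      by (rule Ck_on_SucI[where D="\<lambda>x. L"])
        (use bounded_linear.has_derivative[OF assms has_derivative_ident] in \<open>auto intro: Ck_on_const\<close>)
    then show ?thesis using Suc by simp
  qed
  then show ?thesis using Ck_on_subset by blast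
qed

lemma Ck_on_add:
  assumes "Ck_on r S f" "Ck_on r S g" "open S"
  shows "Ck_on r S (\<lambda>x. f x + g x)"
  using assms(1,2)
proof (induction r arbitrary: f g)
  case 0
  then show ?case by (auto intro: continuous_on_add)
next
  case (Suc r)
  show ?case
  proof (rule Ck_on_SucI[OF assms(3)])
    fix x assume "x \<in> S"
    show "((\<lambda>x. f x + g x) has_derivative (\<lambda>v. FD f x v + FD g x v)) (at x)"
      by (intro has_derivative_add Ck_on_has_derivative[OF Suc.prems(1) \<open>x\<in>S\<close>] Ck_on_has_derivative[OF Suc.prems(2) \<open>x\<in>S\<close>])
  qed (rule Suc.IH[OF Ck_on_FD[OF Suc.prems(1)] Ck_on_FD[OF Suc.prems(2)]])
qed

lemma Ck_on_scaleR:
  assumes "Ck_on r S f" "Ck_on r S g" "open S"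
  shows "Ck_on r S (\<lambda>x. f x *\<^sub>R g x)"
  using assms(1,2)
proof (induction r arbitrary: f g)
  case 0
  then show ?case by (auto intro: continuous_on_scaleR)
next
  case (Suc r)
  show ?case
  proof (rule Ck_on_SucI[OF assms(3)])
    fix x assume "x \<in> S"
    show "((\<lambda>x. f x *\<^sub>R g x) has_derivative (\<lambda>v. f x *\<^sub>R FD g x v + FD f x v *\<^sub>R g x)) (at x)"
      by (intro has_derivative_scaleR Ck_on_has_derivative[OF Suc.prems(1) \<open>x\<in>S\<close>] Ck_on_has_derivative[OF Suc.prems(2) \<open>x\<in>S\<close>])
  next
    fix v show "Ck_on r S (\<lambda>x. f x *\<^sub>R FD g x v + FD f x v *\<^sub>R g x)"
      by (intro Ck_on_add Suc.IH Ck_on_FD[OF Suc.prems(1)] Ck_on_FD[OF Suc.prems(2)]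
          Ck_on_Suc_imp[OF Suc.prems(1)] Ck_on_Suc_imp[OF Suc.prems(2)] assms(3))
  qed
qed

lemma Ck_on_mult:
  fixes f g :: "'a::real_normed_vector \<Rightarrow> real"
  assumes "Ck_on r S f" "Ck_on r S g" "open S"
  shows "Ck_on r S (\<lambda>x. f x * g x)"
  using Ck_on_scaleR[OF assms] by simp

lemma Ck_on_sum:
  assumes "\<And>i. i \<in> I \<Longrightarrow> Ck_on r S (f i)" "open S"
  shows "Ck_on r S (\<lambda>x. \<Sum>i\<in>I. f i x)"
  using assms
proof (induction I rule: infinite_finite_induct)
  case (insert i I)
  then show ?case by (simp add: Ck_on_add)
qed (auto simp: Ck_on_const)

text \<open>The derivative of the reciprocal contains the reciprocal again, one order lower, so
  \<open>f\<close> stays fixed in this induction.\<close>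

lemma Ck_on_inverse:
  fixes f :: "'a::real_normed_vector \<Rightarrow> real"
  assumes "Ck_on r S f" "open S" "\<And>x. x \<in> S \<Longrightarrow> f x \<noteq> 0"
  shows "Ck_on r S (\<lambda>x. inverse (f x))"
  using assms(1)
proof (induction r)
  case 0
  then show ?case using assms(3) by (auto intro: continuous_on_inverse)
next
  case (Suc r)
  show ?case
  proof (rule Ck_on_SucI[OF assms(2)])
    fix x assume "x \<in> S"
    show "((\<lambda>x. inverse (f x)) has_derivative (\<lambda>v. - (inverse (f x) * FD f x v * inverse (f x)))) (at x)"
      by (rule Deriv.has_derivative_inverse[OF assms(3)[OF \<open>x\<in>S\<close>] Ck_on_has_derivative[OF Suc.prems \<open>x\<in>S\<close>]])
  next
    fix v
    have "Ck_on r S (\<lambda>x. inverse (f x))" using Suc Ck_on_Suc_imp by blast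
    then show "Ck_on r S (\<lambda>x. - (inverse (f x) * FD f x v * inverse (f x)))"
      by (intro Ck_on_bounded_linear_comp[OF bounded_linear_minus[OF bounded_linear_ident]] Ck_on_mult Ck_on_FD[OF Suc.prems] assms(2))
  qed
qed

text \<open>In the chain rule \<open>FD f (g x) (FD g x v)\<close> the point enters twice. Expanding
  \<open>FD g x v\<close> in \<open>onb\<close> separates the two occurrences into products of a
  coordinate of \<open>FD g x v\<close> with \<open>FD f (g x) b\<close>, to which the induction
  hypothesis for the derivatives of \<open>f\<close> applies; hence the finite-dimensional middle
  space.\<close>

lemma Ck_on_compose:
  fixes g :: "'a::real_normed_vector \<Rightarrow> 'b::finite_dim_inner" and f :: "'b \<Rightarrow> 'c::real_normed_vector"
  assumes "Ck_on r T f" "Ck_on r S g" "open S" "g ` S \<subseteq> T"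
  shows "Ck_on r S (\<lambda>x. f (g x))"
  using assms(1,2)
proof (induction r arbitrary: f)
  case 0
  then show ?case using continuous_on_compose2 assms(4) by auto
next
  case (Suc r)
  show ?case
  proof (rule Ck_on_SucI[OF assms(3)])
    fix x assume "x \<in> S"
    then have f: "(f has_derivative FD f (g x)) (at (g x))"
      using assms(4) by (intro Ck_on_has_derivative[OF Suc.prems(1)]) auto
    have lin: "linear (FD f (g x))" using f has_derivative_linear by blast
    have "((\<lambda>x. f (g x)) has_derivative (\<lambda>v. FD f (g x) (FD g x v))) (at x)"
      by (rule has_derivative_compose[OF Ck_on_has_derivative[OF Suc.prems(2) \<open>x\<in>S\<close>] f])
    moreover have "(\<lambda>v. FD f (g x) (FD g x v)) = (\<lambda>v. \<Sum>b\<in>onb. (FD g x v \<bullet> b) *\<^sub>R FD f (g x) b)"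
      by (intro ext linear_onb_expand lin)
    ultimately show "((\<lambda>x. f (g x)) has_derivative (\<lambda>v. \<Sum>b\<in>onb. (FD g x v \<bullet> b) *\<^sub>R FD f (g x) b)) (at x)"
      by simp
  next
    fix v
    show "Ck_on r S (\<lambda>x. \<Sum>b\<in>onb. (FD g x v \<bullet> b) *\<^sub>R FD f (g x) b)"
      by (intro Ck_on_sum Ck_on_scaleR assms(3) Ck_on_bounded_linear_comp[OF bounded_linear_inner_left]
          Ck_on_FD[OF Suc.prems(2)] Suc.IH[OF Ck_on_FD[OF Suc.prems(1)]] Ck_on_Suc_imp[OF Suc.prems(2)])
  qed
qed

lemma Ck_on_Pair:
  assumes "Ck_on r S f" "Ck_on r S g" "open S"
  shows "Ck_on r S (\<lambda>x. (f x, g x))"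
proof -
  have "Ck_on r S (\<lambda>x. (f x, 0) + (0, g x))"
    by (intro Ck_on_add Ck_on_bounded_linear_comp[OF _ assms(1)] Ck_on_bounded_linear_comp[OF _ assms(2)] assms(3))
      (auto intro!: bounded_linear_Pair bounded_linear_ident bounded_linear_zero)
  then show ?thesis by simp
qed

section \<open>Closure rules for smooth functions\<close>

named_theorems Cinf_intros

lemma Cinf_on_const [Cinf_intros]: "Cinf_on S (\<lambda>x. c)"
  by (simp add: Cinf_on_def Ck_on_const)

lemma Cinf_on_bounded_linear: "bounded_linear L \<Longrightarrow> Cinf_on S L"
  by (simp add: Cinf_on_def Ck_on_bounded_linear)

lemma Cinf_on_bounded_linear_comp:
  "bounded_linear L \<Longrightarrow> Cinf_on S f \<Longrightarrow> open S \<Longrightarrow> Cinf_on S (\<lambda>x. L (f x))"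
  by (simp add: Cinf_on_def Ck_on_bounded_linear_comp)

lemma Cinf_on_id [Cinf_intros]: "Cinf_on S (\<lambda>x. x)"
  by (rule Cinf_on_bounded_linear[OF bounded_linear_ident])

lemma Cinf_on_fst [Cinf_intros]: "Cinf_on S fst"
  by (rule Cinf_on_bounded_linear[OF bounded_linear_fst])

lemma Cinf_on_snd [Cinf_intros]: "Cinf_on S snd"
  by (rule Cinf_on_bounded_linear[OF bounded_linear_snd])

lemma Cinf_on_fst_comp [Cinf_intros]: "Cinf_on S f \<Longrightarrow> open S \<Longrightarrow> Cinf_on S (\<lambda>x. fst (f x))"
  by (rule Cinf_on_bounded_linear_comp[OF bounded_linear_fst])

lemma Cinf_on_snd_comp [Cinf_intros]: "Cinf_on S f \<Longrightarrow> open S \<Longrightarrow> Cinf_on S (\<lambda>x. snd (f x))"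
  by (rule Cinf_on_bounded_linear_comp[OF bounded_linear_snd])

lemma Cinf_on_add [Cinf_intros]: "Cinf_on S f \<Longrightarrow> Cinf_on S g \<Longrightarrow> open S \<Longrightarrow> Cinf_on S (\<lambda>x. f x + g x)"
  by (simp add: Cinf_on_def Ck_on_add)

lemma Cinf_on_minus [Cinf_intros]: "Cinf_on S f \<Longrightarrow> open S \<Longrightarrow> Cinf_on S (\<lambda>x. - f x)"
  by (rule Cinf_on_bounded_linear_comp[OF bounded_linear_minus[OF bounded_linear_ident]])

lemma Cinf_on_diff [Cinf_intros]: "Cinf_on S f \<Longrightarrow> Cinf_on S g \<Longrightarrow> open S \<Longrightarrow> Cinf_on S (\<lambda>x. f x - g x)"
  using Cinf_on_add[of S f "\<lambda>x. - g x"] Cinf_on_minus[of S g] by simp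

lemma Cinf_on_scaleR [Cinf_intros]: "Cinf_on S f \<Longrightarrow> Cinf_on S g \<Longrightarrow> open S \<Longrightarrow> Cinf_on S (\<lambda>x. f x *\<^sub>R g x)"
  by (simp add: Cinf_on_def Ck_on_scaleR)

lemma Cinf_on_mult [Cinf_intros]:
  fixes f g :: "'a::real_normed_vector \<Rightarrow> real"
  shows "Cinf_on S f \<Longrightarrow> Cinf_on S g \<Longrightarrow> open S \<Longrightarrow> Cinf_on S (\<lambda>x. f x * g x)"
  by (simp add: Cinf_on_def Ck_on_mult)

lemma Cinf_on_inner_left [Cinf_intros]: "Cinf_on S f \<Longrightarrow> open S \<Longrightarrow> Cinf_on S (\<lambda>x. f x \<bullet> b)"
  by (rule Cinf_on_bounded_linear_comp[OF bounded_linear_inner_left])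

lemma Cinf_on_sum [Cinf_intros]:
  "(\<And>i. i \<in> I \<Longrightarrow> Cinf_on S (f i)) \<Longrightarrow> open S \<Longrightarrow> Cinf_on S (\<lambda>x. \<Sum>i\<in>I. f i x)"
  by (simp add: Cinf_on_def Ck_on_sum)

lemma Cinf_on_prod [Cinf_intros]:
  fixes f :: "'i \<Rightarrow> 'a::real_normed_vector \<Rightarrow> real"
  assumes "\<And>i. i \<in> I \<Longrightarrow> Cinf_on S (f i)" "open S"
  shows "Cinf_on S (\<lambda>x. \<Prod>i\<in>I. f i x)"
  using assms
proof (induction I rule: infinite_finite_induct)
  case (insert i I)
  then show ?case by (simp add: Cinf_on_mult)
qed (auto simp: Cinf_on_const)

lemma Cinf_on_power [Cinf_intros]:
  fixes f :: "'a::real_normed_vector \<Rightarrow> real"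
  assumes "Cinf_on S f" "open S"
  shows "Cinf_on S (\<lambda>x. f x ^ n)"
  by (induction n) (auto intro!: Cinf_intros assms)

lemma Cinf_on_inverse:
  fixes f :: "'a::real_normed_vector \<Rightarrow> real"
  shows "Cinf_on S f \<Longrightarrow> open S \<Longrightarrow> (\<And>x. x \<in> S \<Longrightarrow> f x \<noteq> 0) \<Longrightarrow> Cinf_on S (\<lambda>x. inverse (f x))"
  by (simp add: Cinf_on_def Ck_on_inverse)

lemma Cinf_on_divide:
  fixes f :: "'a::real_normed_vector \<Rightarrow> real"
  shows "Cinf_on S f \<Longrightarrow> Cinf_on S g \<Longrightarrow> open S \<Longrightarrow> (\<And>x. x \<in> S \<Longrightarrow> g x \<noteq> 0) \<Longrightarrow> Cinf_on S (\<lambda>x. f x / g x)"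
  unfolding divide_inverse by (intro Cinf_on_mult Cinf_on_inverse)

lemma Cinf_on_compose:
  fixes g :: "'a::real_normed_vector \<Rightarrow> 'b::finite_dim_inner"
  shows "Cinf_on T f \<Longrightarrow> Cinf_on S g \<Longrightarrow> open S \<Longrightarrow> g ` S \<subseteq> T \<Longrightarrow> Cinf_on S (\<lambda>x. f (g x))"
  using Ck_on_compose unfolding Cinf_on_def by blast

lemma Cinf_on_Pair [Cinf_intros]: "Cinf_on S f \<Longrightarrow> Cinf_on S g \<Longrightarrow> open S \<Longrightarrow> Cinf_on S (\<lambda>x. (f x, g x))"
  by (simp add: Cinf_on_def Ck_on_Pair)

lemma Cinf_on_inner [Cinf_intros]:
  fixes f :: "'a::real_normed_vector \<Rightarrow> 'b::finite_dim_inner"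
  assumes "Cinf_on S f" "Cinf_on S g" "open S"
  shows "Cinf_on S (\<lambda>x. f x \<bullet> g x)"
proof -
  have "f x \<bullet> g x = (\<Sum>b\<in>onb. (f x \<bullet> b) * (g x \<bullet> b))" for x
  proof -
    have "f x \<bullet> g x = (\<Sum>b\<in>onb. (f x \<bullet> b) *\<^sub>R b) \<bullet> g x" by (simp only: onb_expand)
    also have "\<dots> = (\<Sum>b\<in>onb. (f x \<bullet> b) * (g x \<bullet> b))"
      by (simp add: inner_sum_left inner_commute[of "g x"])
    finally show ?thesis .
  qed
  then show ?thesis by (auto intro!: Cinf_intros assms)
qed

lemma Cinf_on_fst_lift: "Cinf_on S f \<Longrightarrow> open S \<Longrightarrow> open P \<Longrightarrow> Cinf_on (S \<times> P) (\<lambda>z. f (fst z :: 'z::finite_dim_inner))"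
  by (rule Cinf_on_compose[of S]) (auto intro!: Cinf_intros open_Times)

section \<open>A flat smooth function\<close>

text \<open>The classical exp(-1/s), extended by 0. Powers of 1/s are included because the family is
  then closed under differentiation up to linear combinations.\<close>

definition flat :: "nat \<Rightarrow> real \<Rightarrow> real" where
  "flat n s = (if 0 < s then exp (- inverse s) * inverse s ^ n else 0)"

abbreviation psi :: "real \<Rightarrow> real" where "psi \<equiv> flat 0"

lemma psi_pos_iff [simp]: "0 < psi s \<longleftrightarrow> 0 < s"
  by (simp add: flat_def)

lemma psi_nonneg [simp]: "0 \<le> psi s"
  by (simp add: flat_def)

lemma psi_eq_0_iff [simp]: "psi s = 0 \<longleftrightarrow> s \<le> 0"
  by (simp add: flat_def)

lemma flat_tendsto_0: "(flat n \<longlongrightarrow> 0) (at 0)"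
proof -
  \<comment> \<open>With t = 1/s the limit from the right is the decay of t^n against exp t.\<close>
  have "((\<lambda>t::real. t ^ n / exp t) \<longlongrightarrow> 0) at_top" by (rule tendsto_power_div_exp_0)
  then have "((\<lambda>s::real. inverse s ^ n / exp (inverse s)) \<longlongrightarrow> 0) (at_right 0)"
    by (rule filterlim_compose[OF _ filterlim_inverse_at_top_right])
  then have "(flat n \<longlongrightarrow> 0) (at_right 0)"
  proof (rule Lim_transform_eventually)
    show "\<forall>\<^sub>F s in at_right 0. inverse s ^ n / exp (inverse s) = flat n s"
      using eventually_at_right_less[of "0::real"]
      by eventually_elim (simp add: flat_def exp_minus field_simps)
  qed
  moreover have "(flat n \<longlongrightarrow> 0) (at_left 0)"
  proof (rule Lim_transform_eventually[OF tendsto_const])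
    show "\<forall>\<^sub>F s in at_left 0. 0 = flat n s"
      using eventually_at_left_real[of "-1" 0] by (auto elim!: eventually_mono simp: flat_def)
  qed
  ultimately show ?thesis by (simp add: filterlim_at_split)
qed

lemma flat_has_derivative:
  "(flat n has_real_derivative (flat (n + 2) s - real n * flat (n + 1) s)) (at s)"
proof -
  consider "0 < s" | "s < 0" | "s = 0" by linarith
  then show ?thesis
  proof cases
    case 1
    have du: "(inverse has_real_derivative - (inverse s * inverse s)) (at s)"
      using 1 DERIV_inverse[of s UNIV] by (simp add: power2_eq_square)
    have de: "((\<lambda>s. exp (- inverse s)) has_real_derivative exp (- inverse s) * (inverse s * inverse s)) (at s)"
      using DERIV_fun_exp[OF DERIV_minus[OF du]] by simp
    have "((\<lambda>s. exp (- inverse s) * inverse s ^ n) has_real_derivative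
        exp (- inverse s) * (inverse s * inverse s) * inverse s ^ n
        + real n * inverse s ^ (n - 1) * (- (inverse s * inverse s)) * exp (- inverse s)) (at s)"
      using DERIV_mult[OF de DERIV_power[OF du, of n]] by (simp add: mult_ac)
    also have "exp (- inverse s) * (inverse s * inverse s) * inverse s ^ n
        + real n * inverse s ^ (n - 1) * (- (inverse s * inverse s)) * exp (- inverse s)
      = flat (n + 2) s - real n * flat (n + 1) s"
      using 1 by (cases n) (simp_all add: flat_def algebra_simps)
    finally have "((\<lambda>s. exp (- inverse s) * inverse s ^ n) has_real_derivative
        (flat (n + 2) s - real n * flat (n + 1) s)) (at s)" .
    then show ?thesis
      by (rule has_field_derivative_transform_within_open[of _ _ _ "{0<..}"])
        (use 1 in \<open>auto simp: flat_def\<close>)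
  next
    case 2
    have "((\<lambda>s. 0) has_real_derivative (flat (n + 2) s - real n * flat (n + 1) s)) (at s)"
      using 2 by (simp add: flat_def)
    then show ?thesis
      by (rule has_field_derivative_transform_within_open[of _ _ _ "{..<0}"])
        (use 2 in \<open>auto simp: flat_def\<close>)
  next
    case 3
    \<comment> \<open>At 0 the difference quotient of \<open>flat n\<close> is
      \<open>flat (n + 1)\<close>, whose limit is already known.\<close>
    have "((\<lambda>h. (flat n (0 + h) - flat n 0) / h) \<longlongrightarrow> 0) (at 0)"
    proof (rule Lim_transform_eventually[OF flat_tendsto_0[of "n + 1"]])
      show "\<forall>\<^sub>F h in at 0. flat (n + 1) h = (flat n (0 + h) - flat n 0) / h"
        by (rule always_eventually) (simp add: flat_def field_simps)
    qed
    then show ?thesis using 3 by (simp add: DERIV_def flat_def)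
  qed
qed

lemma Cinf_on_flat: "Cinf_on S (flat n)"
proof -
  have "Ck_on r UNIV (flat n)" for r
  proof (induction r arbitrary: n)
    case 0
    show ?case using flat_has_derivative
      by (auto intro!: continuous_at_imp_continuous_on DERIV_isCont)
  next
    case (Suc r)
    show ?case
    proof (rule Ck_on_SucI[OF open_UNIV])
      fix s :: real
      show "(flat n has_derivative (\<lambda>v. (flat (n + 2) s + (- real n) * flat (n + 1) s) * v)) (at s)"
        using flat_has_derivative[of n s] by (simp add: has_field_derivative_def)
    next
      fix v :: real
      show "Ck_on r UNIV (\<lambda>s. (flat (n + 2) s + (- real n) * flat (n + 1) s) * v)"
        by (intro Ck_on_mult Ck_on_add Suc.IH Ck_on_const open_UNIV)
    qed
  qed
  then show ?thesis unfolding Cinf_on_def using Ck_on_subset by blast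
qed

lemma Cinf_on_flat_comp [Cinf_intros]:
  fixes f :: "'a::real_normed_vector \<Rightarrow> real"
  shows "Cinf_on S f \<Longrightarrow> open S \<Longrightarrow> Cinf_on S (\<lambda>x. flat n (f x))"
  by (rule Cinf_on_compose[OF Cinf_on_flat[of UNIV]]) auto

section \<open>Symmetry of second derivatives\<close>

text \<open>The second difference over a parallelogram is evaluated by two mean value theorems: one
  in \<open>s\<close> for the difference in direction \<open>w\<close>, the other in
  \<open>t\<close>. The left-hand side is symmetric in \<open>v\<close> and \<open>w\<close>, which
  is the point.\<close>

lemma second_difference_mvt:
  fixes f :: "'a::real_normed_vector \<Rightarrow> real"
  assumes f: "Ck_on 2 S f" and h: "0 < h"
    and S: "\<And>s t. 0 \<le> s \<Longrightarrow> s \<le> h \<Longrightarrow> 0 \<le> t \<Longrightarrow> t \<le> h \<Longrightarrow> x + s *\<^sub>R v + t *\<^sub>R w \<in> S"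
  shows "\<exists>\<xi> \<eta>. 0 < \<xi> \<and> \<xi> < h \<and> 0 < \<eta> \<and> \<eta> < h \<and>
    f (x + h *\<^sub>R v + h *\<^sub>R w) - f (x + h *\<^sub>R v) - f (x + h *\<^sub>R w) + f x
      = h * (h * FD (\<lambda>y. FD f y v) (x + \<xi> *\<^sub>R v + \<eta> *\<^sub>R w) w)"
proof -
  have f2: "Ck_on (Suc (Suc 0)) S f" using f by (simp add: numeral_2_eq_2)
  have lin: "FD f y (r *\<^sub>R u) = r * FD f y u" if "y \<in> S" for y r u
    using Ck_on_has_derivative[OF f2 that] by (simp add: has_derivative_linear linear_scale)
  have lin2: "FD (\<lambda>y. FD f y v) y (r *\<^sub>R u) = r * FD (\<lambda>y. FD f y v) y u" if "y \<in> S" for y r u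
    using linear_scale[OF has_derivative_linear[OF Ck_on_has_derivative[OF Ck_on_FD[OF f2] that]], of v r u] by simp
  have d1: "((\<lambda>s. f (x + s *\<^sub>R v + t *\<^sub>R w)) has_real_derivative FD f (x + s *\<^sub>R v + t *\<^sub>R w) v) (at s)"
    if "0 \<le> s" "s \<le> h" "0 \<le> t" "t \<le> h" for s t
  proof -
    have "((\<lambda>s. f (x + s *\<^sub>R v + t *\<^sub>R w)) has_derivative (\<lambda>r. FD f (x + s *\<^sub>R v + t *\<^sub>R w) (r *\<^sub>R v))) (at s)"
      by (rule has_derivative_compose[where f="\<lambda>s. x + s *\<^sub>R v + t *\<^sub>R w" and x=s and g=f, OF _ Ck_on_has_derivative[OF f2 S[OF that]]])
        (auto intro!: derivative_eq_intros)
    then show ?thesis using lin[OF S[OF that]]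
      by (simp add: has_field_derivative_def mult_commute_abs)
  qed
  have d2: "((\<lambda>t. FD f (x + s *\<^sub>R v + t *\<^sub>R w) v) has_real_derivative
      FD (\<lambda>y. FD f y v) (x + s *\<^sub>R v + t *\<^sub>R w) w) (at t)"
    if "0 \<le> s" "s \<le> h" "0 \<le> t" "t \<le> h" for s t
  proof -
    have "((\<lambda>t. FD f (x + s *\<^sub>R v + t *\<^sub>R w) v) has_derivative
        (\<lambda>r. FD (\<lambda>y. FD f y v) (x + s *\<^sub>R v + t *\<^sub>R w) (r *\<^sub>R w))) (at t)"
      by (rule has_derivative_compose[where f="\<lambda>t. x + s *\<^sub>R v + t *\<^sub>R w" and x=t and g="\<lambda>y. FD f y v", OF _ Ck_on_has_derivative[OF Ck_on_FD[OF f2] S[OF that]]])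
        (auto intro!: derivative_eq_intros)
    then show ?thesis using lin2[OF S[OF that]]
      by (simp add: has_field_derivative_def mult_commute_abs)
  qed
  define \<phi> where "\<phi> s = f (x + s *\<^sub>R v + h *\<^sub>R w) - f (x + s *\<^sub>R v + 0 *\<^sub>R w)" for s
  define \<phi>' where "\<phi>' s = FD f (x + s *\<^sub>R v + h *\<^sub>R w) v - FD f (x + s *\<^sub>R v + 0 *\<^sub>R w) v" for s
  have "(\<phi> has_real_derivative \<phi>' s) (at s)" if "0 \<le> s" "s \<le> h" for s
    unfolding \<phi>_def \<phi>'_def using that h by (intro DERIV_diff d1) auto
  from MVT2[OF h this] obtain \<xi> where \<xi>: "0 < \<xi>" "\<xi> < h" "\<phi> h - \<phi> 0 = (h - 0) * \<phi>' \<xi>" by blast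
  obtain \<eta> where \<eta>: "0 < \<eta>" "\<eta> < h"
    "\<phi>' \<xi> = (h - 0) * FD (\<lambda>y. FD f y v) (x + \<xi> *\<^sub>R v + \<eta> *\<^sub>R w) w"
    unfolding \<phi>'_def using MVT2[OF h d2[of \<xi>]] \<xi> by auto
  show ?thesis
    using \<xi> \<eta> by (intro exI[of _ \<xi>] exI[of _ \<eta>]) (auto simp: \<phi>_def)
qed

text \<open>Both mixed derivatives, taken at points near \<open>x\<close>, equal the same second
  difference divided by h^2; continuity at \<open>x\<close> then forces equality there.\<close>

lemma Ck_on_second_derivative_symmetric:
  fixes f :: "'a::real_normed_vector \<Rightarrow> real"
  assumes f: "Ck_on 2 S f" and S: "open S" "x \<in> S"
  shows "FD (\<lambda>y. FD f y v) x w = FD (\<lambda>y. FD f y w) x v"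
proof (rule ccontr)
  let ?A = "\<lambda>y. FD (\<lambda>y. FD f y v) y w" and ?B = "\<lambda>y. FD (\<lambda>y. FD f y w) y v"
  assume "?A x \<noteq> ?B x"
  \<comment> \<open>Half the gap: two values, each within \<open>e\<close> of its limit, cannot
    coincide.\<close>
  define e where "e = \<bar>?A x - ?B x\<bar> / 2"
  have e: "e > 0" using \<open>?A x \<noteq> ?B x\<close> by (simp add: e_def)
  have f2: "Ck_on (Suc (Suc 0)) S f" using f by (simp add: numeral_2_eq_2)
  have "continuous_on S ?A" "continuous_on S ?B"
    using Ck_on_continuous[OF Ck_on_FD[OF Ck_on_FD[OF f2]]] by blast+
  then have "isCont ?A x" "isCont ?B x" using S continuous_on_eq_continuous_at by blast+
  then have "\<forall>\<^sub>F y in nhds x. dist (?A y) (?A x) < e" "\<forall>\<^sub>F y in nhds x. dist (?B y) (?B x) < e"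
    using e by (auto simp: isCont_def tendsto_iff eventually_nhds_conv_at)
  then have "\<forall>\<^sub>F y in nhds x. y \<in> S \<and> dist (?A y) (?A x) < e \<and> dist (?B y) (?B x) < e"
    using eventually_nhds_in_open[OF S] by eventually_elim auto
  then obtain d where d: "d > 0"
    "\<And>y. dist y x < d \<Longrightarrow> y \<in> S \<and> dist (?A y) (?A x) < e \<and> dist (?B y) (?B x) < e"
    unfolding eventually_nhds_metric by blast
  \<comment> \<open>Keeps the whole parallelogram within d/2 of \<open>x\<close>; the summand 1
    covers the case that \<open>v\<close> and \<open>w\<close> are both 0.\<close>
  define h where "h = d / (2 * (norm v + norm w + 1))"
  have np: "norm v + norm w + 1 > 0" using norm_ge_zero[of v] norm_ge_zero[of w] by linarith
  have h: "0 < h" using d(1) np by (simp add: h_def)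
  have near: "dist (x + s *\<^sub>R v + t *\<^sub>R w) x < d" if "0 \<le> s" "s \<le> h" "0 \<le> t" "t \<le> h" for s t
  proof -
    have "dist (x + s *\<^sub>R v + t *\<^sub>R w) x = norm (s *\<^sub>R v + t *\<^sub>R w)" by (simp add: dist_norm algebra_simps)
    also have "\<dots> \<le> s * norm v + t * norm w" using that norm_triangle_ineq[of "s *\<^sub>R v" "t *\<^sub>R w"] by simp
    also have "\<dots> \<le> h * norm v + h * norm w" using that by (intro add_mono mult_right_mono) auto
    also have "\<dots> \<le> h * (norm v + norm w + 1)" using h by (simp add: algebra_simps)
    also have "\<dots> = d / 2" using np by (simp add: h_def field_simps)
    also have "\<dots> < d" using d(1) by simp
    finally show ?thesis .
  qed
  have near': "dist (x + s *\<^sub>R w + t *\<^sub>R v) x < d" if "0 \<le> s" "s \<le> h" "0 \<le> t" "t \<le> h" for s t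
    using near[OF that(3,4,1,2)] by (simp add: algebra_simps)
  obtain \<xi> \<eta> where A: "0 < \<xi>" "\<xi> < h" "0 < \<eta>" "\<eta> < h"
    "f (x + h *\<^sub>R v + h *\<^sub>R w) - f (x + h *\<^sub>R v) - f (x + h *\<^sub>R w) + f x
      = h * (h * ?A (x + \<xi> *\<^sub>R v + \<eta> *\<^sub>R w))"
    using second_difference_mvt[OF f h, of x v w] near d(2) by blast
  obtain \<xi>' \<eta>' where B: "0 < \<xi>'" "\<xi>' < h" "0 < \<eta>'" "\<eta>' < h"
    "f (x + h *\<^sub>R w + h *\<^sub>R v) - f (x + h *\<^sub>R w) - f (x + h *\<^sub>R v) + f x
      = h * (h * ?B (x + \<xi>' *\<^sub>R w + \<eta>' *\<^sub>R v))"
    using second_difference_mvt[OF f h, of x w v] near' d(2) by blast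
  have "x + h *\<^sub>R w + h *\<^sub>R v = x + h *\<^sub>R v + h *\<^sub>R w" by (simp add: algebra_simps)
  then have "h * (h * ?A (x + \<xi> *\<^sub>R v + \<eta> *\<^sub>R w)) = h * (h * ?B (x + \<xi>' *\<^sub>R w + \<eta>' *\<^sub>R v))"
    using A(5) B(5) by (simp only:)
  then have "?A (x + \<xi> *\<^sub>R v + \<eta> *\<^sub>R w) = ?B (x + \<xi>' *\<^sub>R w + \<eta>' *\<^sub>R v)" using h by simp
  moreover have "dist (?A (x + \<xi> *\<^sub>R v + \<eta> *\<^sub>R w)) (?A x) < e"
    using d(2)[OF near[of \<xi> \<eta>]] A by simp
  moreover have "dist (?B (x + \<xi>' *\<^sub>R w + \<eta>' *\<^sub>R v)) (?B x) < e"
    using d(2)[OF near'[of \<xi>' \<eta>']] B by simp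
  ultimately show False by (auto simp: e_def dist_real_def abs_if split: if_splits)
qed

lemma FD_inner_left:
  assumes "g differentiable (at x)"
  shows "FD (\<lambda>x. g x \<bullet> b) x v = FD g x v \<bullet> b"
proof -
  have "((\<lambda>x. g x \<bullet> b) has_derivative (\<lambda>v. FD g x v \<bullet> b)) (at x)"
    using assms frechet_derivative_works has_derivative_inner_left by blast
  then show ?thesis by (simp add: FD_eq)
qed

lemma onb_eqI: "(\<And>b. b \<in> onb \<Longrightarrow> x \<bullet> b = y \<bullet> b) \<Longrightarrow> x = (y::'a::finite_dim_inner)"
  using onb_expand[of x] onb_expand[of y] by (metis (no_types, lifting) sum.cong)

lemma Cinf_on_second_derivative_symmetric:
  fixes f :: "'a::real_normed_vector \<Rightarrow> 'b::finite_dim_inner"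
  assumes f: "Cinf_on S f" and S: "open S" "x \<in> S"
  shows "FD (\<lambda>y. FD f y v) x w = FD (\<lambda>y. FD f y w) x v"
proof (rule onb_eqI)
  fix b :: 'b
  have f1: "f differentiable (at y)" if "y \<in> S" for y
    using Cinf_on_has_derivative[OF f that] by (auto simp: differentiable_def)
  have f2: "(\<lambda>y. FD f y v) differentiable (at x)" for v
    using Cinf_on_has_derivative[OF Cinf_on_FD[OF f] S(2)] by (auto simp: differentiable_def)
  have *: "FD (\<lambda>y. FD f y v) x w \<bullet> b = FD (\<lambda>y. FD (\<lambda>y. f y \<bullet> b) y v) x w" for v w
  proof -
    have "FD (\<lambda>y. FD (\<lambda>y. f y \<bullet> b) y v) x = FD (\<lambda>y. FD f y v \<bullet> b) x"
      by (rule FD_cong_open[OF S]) (simp add: FD_inner_left f1)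
    then show ?thesis by (simp add: FD_inner_left f2)
  qed
  have "Ck_on 2 S (\<lambda>y. f y \<bullet> b)"
    using Cinf_on_inner_left[OF f S(1)] by (simp add: Cinf_on_def)
  from Ck_on_second_derivative_symmetric[OF this S, of v w]
  show "FD (\<lambda>y. FD f y v) x w \<bullet> b = FD (\<lambda>y. FD f y w) x v \<bullet> b" by (simp add: *)
qed

section \<open>Integrals depending on a parameter\<close>

lemma has_derivative_slice:
  assumes "(f has_derivative f') (at (t, z))"
  shows "((\<lambda>z. f (t, z)) has_derivative (\<lambda>v. f' (0, v))) (at z)"
proof -
  have "((\<lambda>z. (t, z)) has_derivative (\<lambda>v. (0, v))) (at z)"
    by (auto intro!: derivative_eq_intros)
  from has_derivative_compose[OF this assms] show ?thesis .
qed

lemma Ck_on_integral_aux: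
  fixes F :: "real \<times> 'z::finite_dim_inner \<Rightarrow> real"
  assumes F: "Ck_on (Suc r) T F" and T: "{0..1} \<times> S \<subseteq> T" and S: "open S" "z \<in> S"
  shows "((\<lambda>z. integral {0..1} (\<lambda>t. F (t, z))) has_derivative
    (\<lambda>v. integral {0..1} (\<lambda>t. FD F (t, z) (0, v)))) (at z)"
proof -
  obtain e where e: "e > 0" "ball z e \<subseteq> S" using S open_contains_ball by blast
  \<comment> \<open>\<open>leibniz_rule\<close> wants the derivative as a bounded linear function
    that depends continuously on \<open>y\<close> and \<open>t\<close>. Built from the functionals
    given by the basis vectors, it is continuous as soon as finitely many real functions
    are.\<close>
  define fx where "fx y t = (\<Sum>b\<in>onb. FD F (t, y) (0, b) *\<^sub>R blinfun_inner_left b)" for y t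
  have fx: "blinfun_apply (fx y t) = (\<lambda>v. FD F (t, y) (0, v))" if "y \<in> S" "t \<in> {0..1}" for y t
  proof
    fix v
    have "((\<lambda>z. F (t, z)) has_derivative (\<lambda>v. FD F (t, y) (0, v))) (at y)"
      using T that by (intro has_derivative_slice Ck_on_has_derivative[OF F]) auto
    from linear_onb_expand[OF has_derivative_linear[OF this], of v]
    show "blinfun_apply (fx y t) v = FD F (t, y) (0, v)"
      by (simp add: fx_def blinfun.sum_left blinfun.scaleR_left blinfun_inner_left.rep_eq mult.commute)
  qed
  have cont: "continuous_on ({0..1} \<times> S) F" "\<And>v. continuous_on ({0..1} \<times> S) (\<lambda>p. FD F p v)"
    using Ck_on_continuous[OF F] Ck_on_continuous[OF Ck_on_FD[OF F]] T continuous_on_subset by blast+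
  have cont1: "continuous_on {0..1} (\<lambda>t. F (t, y))" if "y \<in> S" for y
    by (rule continuous_on_compose2[OF cont(1)]) (use that in \<open>auto intro!: continuous_intros\<close>)
  have cont2: "continuous_on {0..1} (fx z)"
    unfolding fx_def by (intro continuous_intros continuous_on_compose2[OF cont(2)]) (use S in auto)
  have "((\<lambda>y. integral (cbox 0 1) (\<lambda>t. F (t, y))) has_derivative integral (cbox 0 1) (fx z)) (at z within ball z e)"
  proof (rule leibniz_rule)
    fix y t assume y: "y \<in> ball z e" and t: "t \<in> cbox (0::real) 1"
    have "(t, y) \<in> T" using y t e(2) by (intro subsetD[OF T]) auto
    then have "((\<lambda>z. F (t, z)) has_derivative (\<lambda>v. FD F (t, y) (0, v))) (at y)"
      by (intro has_derivative_slice Ck_on_has_derivative[OF F])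
    then show "((\<lambda>y. F (t, y)) has_derivative blinfun_apply (fx y t)) (at y within ball z e)"
      using fx[of y t] y t e has_derivative_at_withinI by (auto simp: subset_iff)
  next
    fix y assume "y \<in> ball z e"
    then show "(\<lambda>t. F (t, y)) integrable_on cbox 0 1"
      using cont1[of y] e by (intro integrable_continuous) (auto simp: subset_iff)
  next
    show "continuous_on (ball z e \<times> cbox 0 1) (\<lambda>(y, t). fx y t)"
      unfolding fx_def split_def
      by (intro continuous_intros continuous_on_compose2[OF cont(2)]) (use e in auto)
  qed (use e in auto)
  then have 1: "((\<lambda>y. integral {0..1} (\<lambda>t. F (t, y))) has_derivative integral {0..1} (fx z)) (at z)"
    using e(1) at_within_open[of z "ball z e"] by simp
  have "blinfun_apply (integral {0..1} (fx z)) v = integral {0..1} (\<lambda>t. FD F (t, z) (0, v))" for v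
  proof -
    have "fx z integrable_on {0..1}" using integrable_continuous_real[OF cont2] .
    then have "integral {0..1} ((\<lambda>B. blinfun_apply B v) \<circ> fx z) = blinfun_apply (integral {0..1} (fx z)) v"
      by (intro integral_linear blinfun.bounded_linear_left)
    moreover have "integral {0..1} ((\<lambda>B. blinfun_apply B v) \<circ> fx z) = integral {0..1} (\<lambda>t. FD F (t, z) (0, v))"
      by (rule integral_cong) (simp add: fx[OF S(2)])
    ultimately show ?thesis by simp
  qed
  then have "blinfun_apply (integral {0..1} (fx z)) = (\<lambda>v. integral {0..1} (\<lambda>t. FD F (t, z) (0, v)))" by auto
  then show ?thesis using 1 by simp
qed

text \<open>One order of differentiability is spent, since even continuity of the integral is
  deduced from its differentiability. For smooth integrands nothing is lost.\<close>

lemma Ck_on_integral: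
  fixes F :: "real \<times> 'z::finite_dim_inner \<Rightarrow> real"
  assumes F: "Ck_on (Suc r) T F" and T: "{0..1} \<times> S \<subseteq> T" and S: "open S"
  shows "Ck_on r S (\<lambda>z. integral {0..1} (\<lambda>t. F (t, z)))"
  using F
proof (induction r arbitrary: F)
  case 0
  have "continuous (at z) (\<lambda>z. integral {0..1} (\<lambda>t. F (t, z)))" if "z \<in> S" for z
    using Ck_on_integral_aux[OF 0 T S that] has_derivative_continuous by blast
  then show ?case by (simp add: continuous_at_imp_continuous_on)
next
  case (Suc r)
  show ?case
  proof (rule Ck_on_SucI[OF S])
    fix z assume "z \<in> S"
    show "((\<lambda>z. integral {0..1} (\<lambda>t. F (t, z))) has_derivative
      (\<lambda>v. integral {0..1} (\<lambda>t. FD F (t, z) (0, v)))) (at z)"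
      by (rule Ck_on_integral_aux[OF Suc.prems T S \<open>z \<in> S\<close>])
  next
    fix v show "Ck_on r S (\<lambda>z. integral {0..1} (\<lambda>t. FD F (t, z) (0, v)))"
      by (rule Suc.IH[OF Ck_on_FD[OF Suc.prems]])
  qed
qed

lemma Cinf_on_integral:
  fixes F :: "real \<times> 'z::finite_dim_inner \<Rightarrow> real"
  assumes "Cinf_on T F" "{0..1} \<times> S \<subseteq> T" "open S"
  shows "Cinf_on S (\<lambda>z. integral {0..1} (\<lambda>t. F (t, z)))"
  using assms Ck_on_integral unfolding Cinf_on_def by blast

lemma FD_integral:
  fixes F :: "real \<times> 'z::finite_dim_inner \<Rightarrow> real"
  assumes "Cinf_on T F" "{0..1} \<times> S \<subseteq> T" "open S" "z \<in> S"
  shows "FD (\<lambda>z. integral {0..1} (\<lambda>t. F (t, z))) z v = integral {0..1} (\<lambda>t. FD (\<lambda>z. F (t, z)) z v)"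
proof -
  have F: "Ck_on (Suc 0) T F" using assms(1) by (simp add: Cinf_on_def del: Ck_on.simps)
  have "FD (\<lambda>z. F (t, z)) z v = FD F (t, z) (0, v)" if "t \<in> {0..1}" for t
  proof -
    have "((\<lambda>z. F (t, z)) has_derivative (\<lambda>v. FD F (t, z) (0, v))) (at z)"
      using assms that by (intro has_derivative_slice Ck_on_has_derivative[OF F]) auto
    then show ?thesis by (simp add: FD_eq)
  qed
  then have "integral {0..1} (\<lambda>t. FD (\<lambda>z. F (t, z)) z v) = integral {0..1} (\<lambda>t. FD F (t, z) (0, v))"
    by (intro integral_cong) auto
  then show ?thesis using FD_eq[OF Ck_on_integral_aux[OF F assms(2-4)]] by simp
qed

section \<open>Alternating multilinear functions of lists\<close>

text \<open>The face operation of both complexes: it drops an argument in the exterior derivative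
  and an index in the Cech differential.\<close>

definition omit :: "nat \<Rightarrow> 'a list \<Rightarrow> 'a list" where
  "omit i xs = take i xs @ drop (Suc i) xs"

lemma length_omit [simp]: "i < length xs \<Longrightarrow> length (omit i xs) = length xs - 1"
  by (simp add: omit_def)

lemma omit_0_Cons [simp]: "omit 0 (x # xs) = xs"
  by (simp add: omit_def)

lemma omit_Suc_Cons [simp]: "omit (Suc i) (x # xs) = x # omit i xs"
  by (simp add: omit_def)

lemma omit_append1: "i < length xs \<Longrightarrow> omit i (xs @ ys) = omit i xs @ ys"
  by (simp add: omit_def)

lemma omit_append2: "omit (length xs + i) (xs @ ys) = xs @ omit i ys"
  by (simp add: omit_def)

lemma map_omit: "map f (omit i xs) = omit i (map f xs)"
  by (simp add: omit_def take_map drop_map)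

lemma nth_omit: "i < length xs \<Longrightarrow> j < length xs - 1 \<Longrightarrow> omit i xs ! j = xs ! (if j < i then j else Suc j)"
  by (auto simp: omit_def nth_append min_def)

text \<open>The simplicial identity behind the vanishing of the double differentials below.\<close>

lemma omit_omit: "i \<le> j \<Longrightarrow> Suc j < length xs \<Longrightarrow> omit j (omit i xs) = omit i (omit (Suc j) xs)"
proof (induction i arbitrary: j xs)
  case 0
  then show ?case by (cases xs) auto
next
  case (Suc i)
  then obtain j' where "j = Suc j'" by (cases j) auto
  then show ?case using Suc by (cases xs) auto
qed

text \<open>The term at \<open>(i, j)\<close> with \<open>i \<le> j\<close> cancels the one at
  \<open>(Suc j, i)\<close>, whose sign is opposite. This serves d d = 0, the square of the Cech
  differential, and the second-derivative terms of a pullback alike.\<close>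

lemma alternating_double_sum_zero:
  fixes G :: "nat \<Rightarrow> nat \<Rightarrow> real"
  assumes "\<And>i j. i \<le> j \<Longrightarrow> j < n \<Longrightarrow> G i j = G (Suc j) i"
  shows "(\<Sum>i<Suc n. \<Sum>j<n. (-1) ^ (i + j) * G i j) = 0"
proof -
  let ?f = "\<lambda>(i, j). (-1) ^ (i + j) * G i j"
  let ?A = "{(i, j). i \<le> j \<and> j < n}" and ?B = "{(i, j). j < i \<and> i < Suc n}"
  have "?A \<subseteq> {..<Suc n} \<times> {..<n}" "?B \<subseteq> {..<Suc n} \<times> {..<n}" by auto
  then have fin: "finite ?A" "finite ?B" by (meson finite_SigmaI finite_lessThan finite_subset)+
  have "(\<Sum>i<Suc n. \<Sum>j<n. (-1) ^ (i + j) * G i j) = sum ?f ({..<Suc n} \<times> {..<n})"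
    by (simp add: sum.cartesian_product)
  also have "{..<Suc n} \<times> {..<n} = ?A \<union> ?B" by auto
  also have "sum ?f (?A \<union> ?B) = sum ?f ?A + sum ?f ?B"
    by (rule sum.union_disjoint) (use fin in auto)
  finally have *: "(\<Sum>i<Suc n. \<Sum>j<n. (-1) ^ (i + j) * G i j) = sum ?f ?A + sum ?f ?B" .
  have aux: "(-1::real) ^ (a + b) = - ((-1) ^ (a + b - Suc 0))" if "b < a" for a b :: nat
    using that by (cases a) auto
  have "sum ?f ?B = sum (\<lambda>(i, j). - ?f (i, j)) ?A"
    by (rule sum.reindex_bij_witness[of _ "\<lambda>(i, j). (Suc j, i)" "\<lambda>(i, j). (j, i - 1)"])
      (use assms in \<open>auto simp: add.commute aux\<close>)
  then show ?thesis using * by (simp add: split_def sum_negf)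
qed

text \<open>Slots are exhibited by splitting the list, which suits \<open>omit\<close> and induction
  better than updating at a position. Lists of a length other than \<open>q\<close> are
  unconstrained.\<close>

definition altm :: "nat \<Rightarrow> ('e::real_vector list \<Rightarrow> real) \<Rightarrow> bool" where
  "altm q \<alpha> \<longleftrightarrow>
    (\<forall>xs ys. Suc (length xs + length ys) = q \<longrightarrow> linear (\<lambda>v. \<alpha> (xs @ v # ys))) \<and>
    (\<forall>xs ys zs v. Suc (Suc (length xs + length ys + length zs)) = q \<longrightarrow> \<alpha> (xs @ v # ys @ v # zs) = 0)"

lemma altmI:
  assumes "\<And>xs ys. Suc (length xs + length ys) = q \<Longrightarrow> linear (\<lambda>v. \<alpha> (xs @ v # ys))"
    "\<And>xs ys zs v. Suc (Suc (length xs + length ys + length zs)) = q \<Longrightarrow> \<alpha> (xs @ v # ys @ v # zs) = 0"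
  shows "altm q \<alpha>"
  using assms by (auto simp: altm_def)

lemma altm_linear: "altm q \<alpha> \<Longrightarrow> Suc (length xs + length ys) = q \<Longrightarrow> linear (\<lambda>v. \<alpha> (xs @ v # ys))"
  by (simp add: altm_def)

lemma altm_zero:
  "altm q \<alpha> \<Longrightarrow> Suc (Suc (length xs + length ys + length zs)) = q \<Longrightarrow> \<alpha> (xs @ v # ys @ v # zs) = 0"
  by (simp add: altm_def)

text \<open>Polarisation: expand the vanishing value with \<open>x + y\<close> in both
  slots.\<close>

lemma altm_swap:
  assumes "altm q \<alpha>" "Suc (Suc (length xs + length zs)) = q"
  shows "\<alpha> (xs @ x # y # zs) = - \<alpha> (xs @ y # x # zs)"
proof -
  have 1: "linear (\<lambda>v. \<alpha> (xs @ v # w # zs))" for w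
    using altm_linear[OF assms(1), of xs "w # zs"] assms(2) by simp
  have 2: "linear (\<lambda>v. \<alpha> (xs @ w # v # zs))" for w
    using altm_linear[OF assms(1), of "xs @ [w]" zs] assms(2) by simp
  have 0: "\<alpha> (xs @ v # v # zs) = 0" for v
    using altm_zero[OF assms(1), of xs "[]" zs] assms(2) by simp
  show ?thesis
    using 0[of "x + y"] 0[of x] 0[of y]
    by (simp add: linear_add[OF 1] linear_add[OF 2])
qed

text \<open>One adjacent swap, hence one sign, for each entry of \<open>ys\<close>.\<close>

lemma altm_move:
  assumes "altm q \<alpha>" "Suc (length xs + length ys + length zs) = q"
  shows "\<alpha> (xs @ x # ys @ zs) = (-1) ^ length ys * \<alpha> (xs @ ys @ x # zs)"
  using assms(2)
proof (induction ys arbitrary: xs)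
  case (Cons y ys)
  have "\<alpha> (xs @ x # y # ys @ zs) = - \<alpha> (xs @ y # x # ys @ zs)"
    by (rule altm_swap[OF assms(1)]) (use Cons.prems in simp)
  also have "\<alpha> (xs @ y # x # ys @ zs) = (-1) ^ length ys * \<alpha> (xs @ y # ys @ x # zs)"
    using Cons.IH[of "xs @ [y]"] Cons.prems by simp
  finally show ?case by simp
qed simp

lemma altm_onb_expand:
  fixes v :: "'e::finite_dim_inner"
  assumes "altm q \<alpha>" "Suc (length xs + length ys) = q"
  shows "\<alpha> (xs @ v # ys) = (\<Sum>b\<in>onb. (v \<bullet> b) * \<alpha> (xs @ b # ys))"
  using linear_onb_expand[OF altm_linear[OF assms], of v] by simp

lemma linear_cmult: "linear f \<Longrightarrow> linear (\<lambda>v. c * f v)" for f :: "'e::real_vector \<Rightarrow> real"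
  by (intro linearI) (simp_all add: linear_add linear_scale algebra_simps)

lemma altm_add:
  assumes "altm q \<alpha>" "altm q \<beta>"
  shows "altm q (\<lambda>es. a * \<alpha> es + b * \<beta> es)"
proof (rule altmI)
  fix xs ys :: "'a list" assume q: "Suc (length xs + length ys) = q"
  show "linear (\<lambda>v. a * \<alpha> (xs @ v # ys) + b * \<beta> (xs @ v # ys))"
    using altm_linear[OF assms(1) q] altm_linear[OF assms(2) q]
    by (intro linear_compose_add linear_cmult)
qed (use assms in \<open>simp add: altm_zero\<close>)

lemma altm_map_linear:
  assumes "altm q \<alpha>" "linear L"
  shows "altm q (\<lambda>es. \<alpha> (map L es))"
proof (rule altmI)
  fix xs ys :: "'b list" assume "Suc (length xs + length ys) = q"
  then have "linear (\<lambda>v. \<alpha> (map L xs @ v # map L ys))" by (intro altm_linear[OF assms(1)]) simp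
  from linear_compose[OF assms(2) this]
  show "linear (\<lambda>v. \<alpha> (map L (xs @ v # ys)))" by (simp add: o_def)
qed (use assms(1) in \<open>simp add: altm_zero\<close>)

section \<open>Differential forms in coordinates\<close>

text \<open>The base point ranges over a space that may be larger than the one containing the list arguments: a
  family of forms on \<open>S\<close> with parameters in \<open>P\<close> is a form over \<open>S \<times> P\<close>.\<close>

definition sform :: "'z::real_normed_vector set \<Rightarrow> nat \<Rightarrow> ('z \<Rightarrow> 'e::real_vector list \<Rightarrow> real) \<Rightarrow> bool" where
  "sform S q R \<longleftrightarrow> (\<forall>z\<in>S. altm q (R z)) \<and> (\<forall>es. length es = q \<longrightarrow> Cinf_on S (\<lambda>z. R z es))"

lemma sform_altm: "sform S q R \<Longrightarrow> z \<in> S \<Longrightarrow> altm q (R z)"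
  by (simp add: sform_def)

lemma sform_Cinf: "sform S q R \<Longrightarrow> length es = q \<Longrightarrow> Cinf_on S (\<lambda>z. R z es)"
  by (simp add: sform_def)

lemma sform_has_derivative:
  "sform S q R \<Longrightarrow> length es = q \<Longrightarrow> z \<in> S \<Longrightarrow> ((\<lambda>z. R z es) has_derivative FD (\<lambda>z. R z es) z) (at z)"
  using Cinf_on_has_derivative[OF sform_Cinf] .

lemma sform_subset: "sform S q R \<Longrightarrow> T \<subseteq> S \<Longrightarrow> sform T q R"
  unfolding sform_def using Cinf_on_subset by blast

lemma sform_cong:
  assumes "open S" "\<And>z es. z \<in> S \<Longrightarrow> length es = q \<Longrightarrow> R z es = R' z es"
  shows "sform S q R \<longleftrightarrow> sform S q R'"
proof -
  have "altm q (R z) \<longleftrightarrow> altm q (R' z)" if "z \<in> S" for z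
  proof -
    have "(\<lambda>v. R z (xs @ v # ys)) = (\<lambda>v. R' z (xs @ v # ys))" if "Suc (length xs + length ys) = q" for xs ys
      using assms(2)[OF \<open>z \<in> S\<close>] that by auto
    moreover have "R z (xs @ v # ys @ v # zs) = R' z (xs @ v # ys @ v # zs)"
      if "Suc (Suc (length xs + length ys + length zs)) = q" for xs ys zs v
      using assms(2)[OF \<open>z \<in> S\<close>] that by auto
    ultimately show ?thesis unfolding altm_def by (simp cong: conj_cong imp_cong)
  qed
  moreover have "Cinf_on S (\<lambda>z. R z es) \<longleftrightarrow> Cinf_on S (\<lambda>z. R' z es)" if "length es = q" for es
    by (rule Cinf_on_cong[OF assms(1)]) (simp add: assms(2) that)
  ultimately show ?thesis by (auto simp: sform_def)
qed

lemma sform_compose: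
  assumes "sform T q R" "Cinf_on S g" "open S" "g ` S \<subseteq> T"
  shows "sform S q (\<lambda>z. R (g z :: 'b::finite_dim_inner))"
  using assms Cinf_on_compose[OF sform_Cinf[OF assms(1)] assms(2,3,4)]
  by (auto simp: sform_def)

text \<open>For arguments that move with the point: expand the first of them in \<open>onb\<close>,
  which turns it into smooth coefficients times a constant vector appended to \<open>cs\<close>.
  Hence the constant prefix that grows in the induction.\<close>

lemma Cinf_on_sform_args:
  fixes R :: "'z::real_normed_vector \<Rightarrow> 'e::finite_dim_inner list \<Rightarrow> real"
  assumes R: "sform S q R" and S: "open S" and W: "\<And>w. w \<in> set Ws \<Longrightarrow> Cinf_on S w"
    and len: "length cs + length Ws = q"
  shows "Cinf_on S (\<lambda>z. R z (cs @ map (\<lambda>w. w z) Ws))"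
  using W len
proof (induction Ws arbitrary: cs)
  case Nil
  then show ?case using sform_Cinf[OF R] by simp
next
  case (Cons W Ws)
  have "R z (cs @ map (\<lambda>w. w z) (W # Ws)) = (\<Sum>b\<in>onb. (W z \<bullet> b) * R z ((cs @ [b]) @ map (\<lambda>w. w z) Ws))"
    if "z \<in> S" for z
    using altm_onb_expand[OF sform_altm[OF R that], of cs "map (\<lambda>w. w z) Ws" "W z"] Cons.prems by simp
  moreover have "Cinf_on S (\<lambda>z. \<Sum>b\<in>onb. (W z \<bullet> b) * R z ((cs @ [b]) @ map (\<lambda>w. w z) Ws))"
    using Cons.prems by (intro Cinf_intros Cons.IH S) auto
  ultimately show ?case by (subst Cinf_on_cong[OF S])
qed

text \<open>Product rule for a multilinear expression: one term from the coefficients of the form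
  with the arguments frozen, and one for each argument replaced by its derivative. The proof uses
  the same expansion into the prefix \<open>cs\<close>.\<close>

lemma sform_args_has_derivative:
  fixes R :: "'z::real_normed_vector \<Rightarrow> 'e::finite_dim_inner list \<Rightarrow> real"
  assumes R: "sform S q R" and S: "open S" "y \<in> S"
    and W: "\<And>w. w \<in> set Ws \<Longrightarrow> w differentiable (at y)"
    and len: "length cs + length Ws = q"
  shows "((\<lambda>z. R z (cs @ map (\<lambda>w. w z) Ws)) has_derivative
    (\<lambda>e. FD (\<lambda>z. R z (cs @ map (\<lambda>w. w y) Ws)) y e
       + (\<Sum>j<length Ws. R y (cs @ (map (\<lambda>w. w y) Ws)[j := FD (Ws ! j) y e])))) (at y)"
  using W len
proof (induction Ws arbitrary: cs)
  case Nil
  then show ?case using sform_has_derivative[OF R _ S(2)] by simp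
next
  case (Cons W Ws)
  let ?r = "map (\<lambda>w. w y) Ws"
  have Wd: "(W has_derivative FD W y) (at y)" using Cons.prems by (simp add: frechet_derivative_works)
  have IH: "((\<lambda>z. R z ((cs @ [b]) @ map (\<lambda>w. w z) Ws)) has_derivative
    (\<lambda>e. FD (\<lambda>z. R z ((cs @ [b]) @ ?r)) y e
       + (\<Sum>j<length Ws. R y ((cs @ [b]) @ ?r[j := FD (Ws ! j) y e])))) (at y)" for b
    using Cons.prems by (intro Cons.IH) auto
  have "((\<lambda>z. \<Sum>b\<in>onb. (W z \<bullet> b) * R z ((cs @ [b]) @ map (\<lambda>w. w z) Ws)) has_derivative
    (\<lambda>e. \<Sum>b\<in>onb. (W y \<bullet> b) * (FD (\<lambda>z. R z ((cs @ [b]) @ ?r)) y e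
       + (\<Sum>j<length Ws. R y ((cs @ [b]) @ ?r[j := FD (Ws ! j) y e])))
       + (FD W y e \<bullet> b) * R y ((cs @ [b]) @ ?r))) (at y)"
    by (intro has_derivative_sum has_derivative_mult IH has_derivative_inner_left Wd)
  moreover have "R z (cs @ map (\<lambda>w. w z) (W # Ws)) = (\<Sum>b\<in>onb. (W z \<bullet> b) * R z ((cs @ [b]) @ map (\<lambda>w. w z) Ws))"
    if "z \<in> S" for z
    using altm_onb_expand[OF sform_altm[OF R that], of cs "map (\<lambda>w. w z) Ws" "W z"] Cons.prems by simp
  ultimately have D: "((\<lambda>z. R z (cs @ map (\<lambda>w. w z) (W # Ws))) has_derivative
    (\<lambda>e. \<Sum>b\<in>onb. (W y \<bullet> b) * (FD (\<lambda>z. R z ((cs @ [b]) @ ?r)) y e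
       + (\<Sum>j<length Ws. R y ((cs @ [b]) @ ?r[j := FD (Ws ! j) y e])))
       + (FD W y e \<bullet> b) * R y ((cs @ [b]) @ ?r))) (at y)"
    by (subst has_derivative_cong_open[OF S])
  have "FD (\<lambda>z. R z (cs @ map (\<lambda>w. w y) (W # Ws))) y e = (\<Sum>b\<in>onb. (W y \<bullet> b) * FD (\<lambda>z. R z ((cs @ [b]) @ ?r)) y e)" for e
  proof -
    have "((\<lambda>z. \<Sum>b\<in>onb. (W y \<bullet> b) * R z ((cs @ [b]) @ ?r)) has_derivative
      (\<lambda>e. \<Sum>b\<in>onb. (W y \<bullet> b) * FD (\<lambda>z. R z ((cs @ [b]) @ ?r)) y e)) (at y)"
      using Cons.prems by (intro has_derivative_sum has_derivative_mult_right sform_has_derivative[OF R _ S(2)]) auto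
    moreover have "R z (cs @ map (\<lambda>w. w y) (W # Ws)) = (\<Sum>b\<in>onb. (W y \<bullet> b) * R z ((cs @ [b]) @ ?r))"
      if "z \<in> S" for z
      using altm_onb_expand[OF sform_altm[OF R that], of cs ?r "W y"] Cons.prems by simp
    ultimately have "((\<lambda>z. R z (cs @ map (\<lambda>w. w y) (W # Ws))) has_derivative
      (\<lambda>e. \<Sum>b\<in>onb. (W y \<bullet> b) * FD (\<lambda>z. R z ((cs @ [b]) @ ?r)) y e)) (at y)"
      by (subst has_derivative_cong_open[OF S])
    then show ?thesis by (simp only: FD_eq)
  qed
  moreover have "R y (cs @ (map (\<lambda>w. w y) (W # Ws))[0 := FD ((W # Ws) ! 0) y e])
    = (\<Sum>b\<in>onb. (FD W y e \<bullet> b) * R y ((cs @ [b]) @ ?r))" for e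
    using altm_onb_expand[OF sform_altm[OF R S(2)], of cs ?r "FD W y e"] Cons.prems by simp
  moreover have "(\<Sum>j<length Ws. R y (cs @ (map (\<lambda>w. w y) (W # Ws))[Suc j := FD ((W # Ws) ! Suc j) y e]))
    = (\<Sum>b\<in>onb. (W y \<bullet> b) * (\<Sum>j<length Ws. R y ((cs @ [b]) @ ?r[j := FD (Ws ! j) y e])))" for e
  proof -
    have "R y (cs @ (map (\<lambda>w. w y) (W # Ws))[Suc j := FD ((W # Ws) ! Suc j) y e])
      = (\<Sum>b\<in>onb. (W y \<bullet> b) * R y ((cs @ [b]) @ ?r[j := FD (Ws ! j) y e]))" for j
      using altm_onb_expand[OF sform_altm[OF R S(2)], of cs "?r[j := FD (Ws ! j) y e]" "W y"] Cons.prems by simp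
    then show ?thesis by (simp only: sum_distrib_left) (rule sum.swap)
  qed
  ultimately have "(\<lambda>e. FD (\<lambda>z. R z (cs @ map (\<lambda>w. w y) (W # Ws))) y e
       + (\<Sum>j<length (W # Ws). R y (cs @ (map (\<lambda>w. w y) (W # Ws))[j := FD ((W # Ws) ! j) y e])))
     = (\<lambda>e. \<Sum>b\<in>onb. (W y \<bullet> b) * (FD (\<lambda>z. R z ((cs @ [b]) @ ?r)) y e
       + (\<Sum>j<length Ws. R y ((cs @ [b]) @ ?r[j := FD (Ws ! j) y e])))
       + (FD W y e \<bullet> b) * R y ((cs @ [b]) @ ?r))"
    by (simp only: length_Cons sum.lessThan_Suc_shift) (simp only: sum.distrib distrib_left add_ac)
  then show ?case using D by (simp only:)
qed

subsection \<open>The exterior derivative\<close>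

text \<open>The invariant formula for the exterior derivative on constant fields, where the bracket
  terms vanish. The degree is read off \<open>length es\<close>.\<close>

definition dloc :: "('e::real_normed_vector \<Rightarrow> 'e list \<Rightarrow> real) \<Rightarrow> 'e \<Rightarrow> 'e list \<Rightarrow> real" where
  "dloc R y es = (\<Sum>i<length es. (-1) ^ i * FD (\<lambda>z. R z (omit i es)) y (es ! i))"

text \<open>Splits off the derivative along the first argument. In this shape closedness is applied
  with the radial vector in front.\<close>

lemma dloc_Cons:
  "dloc R y (v # es) = FD (\<lambda>z. R z es) y v - (\<Sum>i<length es. (-1) ^ i * FD (\<lambda>z. R z (v # omit i es)) y (es ! i))"
  by (simp add: dloc_def sum.lessThan_Suc_shift sum_negf del: sum.lessThan_Suc)

lemma sum_append_Cons:
  fixes f :: "nat \<Rightarrow> real"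
  shows "(\<Sum>i<length (xs @ v # ys). f i)
    = (\<Sum>i<length xs. f i) + f (length xs) + (\<Sum>j<length ys. f (length xs + Suc j))"
proof (induction xs arbitrary: f)
  case Nil
  show ?case by (simp add: sum.lessThan_Suc_shift del: sum.lessThan_Suc)
next
  case (Cons x xs)
  show ?case using Cons.IH[of "\<lambda>i. f (Suc i)"]
    by (simp add: sum.lessThan_Suc_shift del: sum.lessThan_Suc)
qed

text \<open>Displays the dependence on one slot: all summands but one keep \<open>v\<close> as an
  argument of the form, and the remaining one differentiates along \<open>v\<close>.\<close>

lemma dloc_append_Cons:
  "dloc R y (xs @ v # ys) =
     (\<Sum>i<length xs. (-1) ^ i * FD (\<lambda>z. R z (omit i xs @ v # ys)) y (xs ! i))
   + (-1) ^ length xs * FD (\<lambda>z. R z (xs @ ys)) y v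
   + (\<Sum>j<length ys. (-1) ^ (length xs + Suc j) * FD (\<lambda>z. R z (xs @ v # omit j ys)) y (ys ! j))"
proof -
  have "omit (length xs) (xs @ v # ys) = xs @ ys" "omit (length xs + Suc j) (xs @ v # ys) = xs @ v # omit j ys" for j
    using omit_append2[of xs 0 "v # ys"] omit_append2[of xs "Suc j" "v # ys"] by simp_all
  moreover have "(xs @ v # ys) ! (length xs + Suc j) = ys ! j" for j
    using nth_append[of xs "v # ys" "length xs + Suc j"] by simp
  ultimately show ?thesis
    unfolding dloc_def by (simp only: sum_append_Cons) (auto intro!: sum.cong simp: omit_append1 nth_append)
qed

lemma dloc_cong:
  assumes S: "open S" "y \<in> S" and eq: "\<And>z fs. z \<in> S \<Longrightarrow> Suc (length fs) = length es \<Longrightarrow> R z fs = R' z fs"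
  shows "dloc R y es = dloc R' y es"
  unfolding dloc_def
proof (rule sum.cong[OF refl])
  fix i assume "i \<in> {..<length es}"
  then have "FD (\<lambda>z. R z (omit i es)) y = FD (\<lambda>z. R' z (omit i es)) y"
    by (intro FD_cong_open[OF S]) (auto intro!: eq)
  then show "(-1) ^ i * FD (\<lambda>z. R z (omit i es)) y (es ! i) = (-1) ^ i * FD (\<lambda>z. R' z (omit i es)) y (es ! i)"
    by simp
qed

lemma dloc_diff:
  assumes R: "sform S q R" and R': "sform S q R'" and S: "y \<in> S" and len: "length es = Suc q"
  shows "dloc (\<lambda>z fs. R z fs - R' z fs) y es = dloc R y es - dloc R' y es"
proof -
  have "FD (\<lambda>z. R z (omit i es) - R' z (omit i es)) y (es ! i)
    = FD (\<lambda>z. R z (omit i es)) y (es ! i) - FD (\<lambda>z. R' z (omit i es)) y (es ! i)" if "i < length es" for i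
  proof -
    have "length (omit i es) = q" using that len by simp
    from FD_eq[OF has_derivative_diff[OF sform_has_derivative[OF R this S] sform_has_derivative[OF R' this S]]]
    show ?thesis by simp
  qed
  then show ?thesis by (simp add: dloc_def sum_subtractf[symmetric] right_diff_distrib)
qed

lemma FD_sform_linear:
  assumes R: "sform S q R" and S: "open S" "y \<in> S" and len: "Suc (length xs + length ys) = q"
  shows "linear (\<lambda>v. FD (\<lambda>z. R z (xs @ v # ys)) y e)"
proof -
  have lin: "linear (\<lambda>v. R z (xs @ v # ys))" if "z \<in> S" for z
    using altm_linear[OF sform_altm[OF R that] len] .
  have d: "((\<lambda>z. R z (xs @ v # ys)) has_derivative FD (\<lambda>z. R z (xs @ v # ys)) y) (at y)" for v
    using len by (intro sform_has_derivative[OF R _ S(2)]) simp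
  show ?thesis
  proof (rule linearI)
    fix v w
    have "((\<lambda>z. R z (xs @ (v + w) # ys)) has_derivative
        (\<lambda>e. FD (\<lambda>z. R z (xs @ v # ys)) y e + FD (\<lambda>z. R z (xs @ w # ys)) y e)) (at y)"
      by (subst has_derivative_cong_open[OF S]) (rule linear_add[OF lin], assumption, intro has_derivative_add d)
    then show "FD (\<lambda>z. R z (xs @ (v + w) # ys)) y e
      = FD (\<lambda>z. R z (xs @ v # ys)) y e + FD (\<lambda>z. R z (xs @ w # ys)) y e"
      by (simp add: FD_eq)
  next
    fix c v
    have "((\<lambda>z. R z (xs @ (c *\<^sub>R v) # ys)) has_derivative
        (\<lambda>e. c *\<^sub>R FD (\<lambda>z. R z (xs @ v # ys)) y e)) (at y)"
      by (subst has_derivative_cong_open[OF S]) (rule linear_scale[OF lin], assumption, intro has_derivative_scaleR_right d)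
    then show "FD (\<lambda>z. R z (xs @ (c *\<^sub>R v) # ys)) y e = c *\<^sub>R FD (\<lambda>z. R z (xs @ v # ys)) y e"
      by (simp add: FD_eq)
  qed
qed

text \<open>With a repeated argument, only the two summands that drop one of its copies survive.
  Moving the other copy across \<open>ys\<close> shows that these two differ by a sign.\<close>

lemma altm_dloc:
  fixes R :: "'e::real_normed_vector \<Rightarrow> 'e list \<Rightarrow> real"
  assumes R: "sform S q R" and S: "open S" "y \<in> S"
  shows "altm (Suc q) (dloc R y)"
proof (rule altmI)
  fix xs ys :: "'e list" assume len: "Suc (length xs + length ys) = Suc q"
  have 1: "linear (\<lambda>v. FD (\<lambda>z. R z (omit i xs @ v # ys)) y (xs ! i))" if "i < length xs" for i
    using FD_sform_linear[OF R S, of "omit i xs" ys] that len by simp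
  have 2: "linear (\<lambda>v. FD (\<lambda>z. R z (xs @ v # omit j ys)) y (ys ! j))" if "j < length ys" for j
    using FD_sform_linear[OF R S, of xs "omit j ys"] that len by simp
  have 3: "linear (\<lambda>v. FD (\<lambda>z. R z (xs @ ys)) y v)"
    using len by (intro has_derivative_linear[OF sform_has_derivative[OF R _ S(2)]]) simp
  show "linear (\<lambda>v. dloc R y (xs @ v # ys))"
    unfolding dloc_append_Cons
    by (intro linear_compose_add linear_compose_sum ballI linear_cmult 1 2 3) auto
next
  fix xs ys zs :: "'e list" and v assume len: "Suc (Suc (length xs + length ys + length zs)) = Suc q"
  have z: "FD (\<lambda>z. R z (as @ v # bs @ v # cs)) y e = 0" if "Suc (Suc (length as + length bs + length cs)) = q" for as bs cs e
  proof -
    have "FD (\<lambda>z. R z (as @ v # bs @ v # cs)) y = FD (\<lambda>z. 0) y"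
      by (rule FD_cong_open[OF S]) (rule altm_zero[OF sform_altm[OF R] that])
    then show ?thesis by simp
  qed
  have 1: "(\<Sum>i<length xs. (-1) ^ i * FD (\<lambda>z. R z (omit i xs @ v # ys @ v # zs)) y (xs ! i)) = 0"
    using len by (intro sum.neutral) (auto intro!: z)
  have 2: "FD (\<lambda>z. R z (xs @ v # omit j (ys @ v # zs))) y ((ys @ v # zs) ! j) = 0" if jj: "j \<noteq> length ys" "j < length (ys @ v # zs)" for j
  proof (cases "j < length ys")
    case True
    then show ?thesis using len by (auto simp: omit_append1 intro!: z)
  next
    case False
    then obtain m where m: "j = length ys + Suc m" using False jj(1) less_imp_Suc_add[of "length ys" j] by auto
    then have "omit j (ys @ v # zs) = ys @ v # omit m zs" by (simp only: omit_append2 omit_Suc_Cons)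
    then show ?thesis using len jj m by (auto intro!: z)
  qed
  have "(\<Sum>j<length (ys @ v # zs). (-1) ^ (length xs + Suc j) * FD (\<lambda>z. R z (xs @ v # omit j (ys @ v # zs))) y ((ys @ v # zs) ! j))
    = (\<Sum>j<length (ys @ v # zs). if j = length ys then (-1) ^ (length xs + Suc (length ys)) * FD (\<lambda>z. R z (xs @ v # ys @ zs)) y v else 0)"
    using omit_append2[of ys 0 "v # zs"] by (intro sum.cong) (auto simp: 2)
  also have "\<dots> = (-1) ^ (length xs + Suc (length ys)) * FD (\<lambda>z. R z (xs @ v # ys @ zs)) y v" by simp
  also have "FD (\<lambda>z. R z (xs @ v # ys @ zs)) y v = FD (\<lambda>z. (-1) ^ length ys * R z (xs @ ys @ v # zs)) y v"
  proof -
    have "FD (\<lambda>z. R z (xs @ v # ys @ zs)) y = FD (\<lambda>z. (-1) ^ length ys * R z (xs @ ys @ v # zs)) y"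
      using len by (intro FD_cong_open[OF S] altm_move[OF sform_altm[OF R]]) auto
    then show ?thesis by simp
  qed
  also have "\<dots> = (-1) ^ length ys * FD (\<lambda>z. R z (xs @ ys @ v # zs)) y v"
  proof -
    have "((\<lambda>z. R z (xs @ ys @ v # zs)) has_derivative FD (\<lambda>z. R z (xs @ ys @ v # zs)) y) (at y)"
      using len by (intro sform_has_derivative[OF R _ S(2)]) simp
    from FD_eq[OF has_derivative_mult_right[OF this, of "(-1) ^ length ys"]] show ?thesis by simp
  qed
  finally have 3: "(\<Sum>j<length (ys @ v # zs). (-1) ^ (length xs + Suc j) * FD (\<lambda>z. R z (xs @ v # omit j (ys @ v # zs))) y ((ys @ v # zs) ! j))
    = (-1) ^ (length xs + Suc (length ys)) * ((-1) ^ length ys * FD (\<lambda>z. R z (xs @ ys @ v # zs)) y v)" .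
  have sgn: "(-1::real) ^ (length xs + Suc (length ys)) * ((-1) ^ length ys * r) = - ((-1) ^ length xs * r)" for r
    by (simp add: power_add minus_one_power_iff)
  show "dloc R y (xs @ v # ys @ v # zs) = 0"
    unfolding dloc_append_Cons[of R y xs v "ys @ v # zs"] 1 3 sgn by simp
qed

lemma sform_dloc:
  fixes R :: "'x::finite_dim_inner \<Rightarrow> 'z::finite_dim_inner \<Rightarrow> 'z list \<Rightarrow> real"
  assumes R: "sform (S \<times> P) q (\<lambda>(y, x). R x y)" and S: "open S" and P: "open P"
  shows "sform (S \<times> P) (Suc q) (\<lambda>(y, x). dloc (R x) y)"
  unfolding sform_def
proof (intro conjI ballI allI impI)
  fix z assume "z \<in> S \<times> P"
  then obtain y x where z: "y \<in> S" "x \<in> P" "z = (y, x)" by auto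
  have "sform S q (\<lambda>y. (\<lambda>(y, x). R x y) (y, x))"
    by (rule sform_compose[OF R _ S]) (use z S in \<open>auto intro!: Cinf_intros\<close>)
  then have "sform S q (R x)" by simp
  from altm_dloc[OF this S z(1)] show "altm (Suc q) (case z of (y, x) \<Rightarrow> dloc (R x) y)" using z by simp
next
  fix es :: "'z list" assume len: "length es = Suc q"
  let ?F = "\<lambda>i z. (case z of (y, x) \<Rightarrow> R x y) (omit i es)"
  have o: "open (S \<times> P)" by (intro open_Times S P)
  have C: "Cinf_on (S \<times> P) (?F i)" if "i < Suc q" for i
    using that len by (intro sform_Cinf[OF R]) simp
  \<comment> \<open>Differentiating in \<open>y\<close> alone is differentiating on the product
    along a vector \<open>(e, 0)\<close>, so joint smoothness in \<open>(y, x)\<close> is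
    inherited.\<close>
  have "Cinf_on (S \<times> P) (\<lambda>z. \<Sum>i<Suc q. (-1) ^ i * FD (?F i) z (es ! i, 0))"
    by (intro Cinf_on_sum Cinf_on_mult Cinf_on_const Cinf_on_FD[OF C] o) auto
  then show "Cinf_on (S \<times> P) (\<lambda>z. (case z of (y, x) \<Rightarrow> dloc (R x) y) es)"
  proof (rule Cinf_on_congI[OF _ o])
    fix z assume z: "z \<in> S \<times> P"
    then obtain y x where yx: "z = (y, x)" by (cases z)
    have "FD (\<lambda>w. R x w (omit i es)) y e = FD (?F i) z (e, 0)" if "i < Suc q" for i e
    proof -
      have "((\<lambda>w. (w, x)) has_derivative (\<lambda>e. (e, 0))) (at y)" by (auto intro!: derivative_eq_intros)
      moreover have "(?F i has_derivative FD (?F i) z) (at (y, x))"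
        using Cinf_on_has_derivative[OF C[OF that] z] yx by simp
      ultimately have "((\<lambda>w. ?F i (w, x)) has_derivative (\<lambda>e. FD (?F i) z (e, 0))) (at y)"
        by (rule has_derivative_compose)
      then show ?thesis by (simp add: FD_eq)
    qed
    then show "(case z of (y, x) \<Rightarrow> dloc (R x) y) es = (\<Sum>i<Suc q. (-1) ^ i * FD (?F i) z (es ! i, 0))"
      unfolding yx by (simp add: dloc_def len del: sum.lessThan_Suc)
  qed
qed

lemma FD_dloc:
  fixes R :: "'e::real_normed_vector \<Rightarrow> 'e list \<Rightarrow> real"
  assumes R: "sform S q R" and S: "open S" "y \<in> S" and len: "length es = Suc q"
  shows "((\<lambda>z. dloc R z es) has_derivative
     (\<lambda>e. \<Sum>i<length es. (-1) ^ i * FD (\<lambda>z. FD (\<lambda>z. R z (omit i es)) z (es ! i)) y e)) (at y)"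
  unfolding dloc_def
proof (intro has_derivative_sum has_derivative_mult_right)
  fix i assume "i \<in> {..<length es}"
  then have "Cinf_on S (\<lambda>z. R z (omit i es))" using len by (intro sform_Cinf[OF R]) simp
  from Cinf_on_has_derivative[OF Cinf_on_FD[OF this] S(2)]
  show "((\<lambda>z. FD (\<lambda>z. R z (omit i es)) z (es ! i)) has_derivative FD (\<lambda>z. FD (\<lambda>z. R z (omit i es)) z (es ! i)) y) (at y)" .
qed

text \<open>The double sum runs over ordered pairs of dropped arguments, and symmetry of second
  derivatives makes its two halves cancel.\<close>

lemma dloc_dloc:
  fixes R :: "'e::real_normed_vector \<Rightarrow> 'e list \<Rightarrow> real"
  assumes R: "sform S q R" and S: "open S" "y \<in> S" and len: "length es = Suc (Suc q)"
  shows "dloc (dloc R) y es = 0"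
proof -
  define G where "G i j = FD (\<lambda>z. FD (\<lambda>z. R z (omit j (omit i es))) z (omit i es ! j)) y (es ! i)" for i j
  have "dloc (dloc R) y es = (\<Sum>i<Suc (Suc q). \<Sum>j<Suc q. (-1) ^ (i + j) * G i j)"
    unfolding dloc_def[of "dloc R"] len
  proof (rule sum.cong[OF refl])
    fix i assume "i \<in> {..<Suc (Suc q)}"
    then have "length (omit i es) = Suc q" using len by simp
    from FD_eq[OF FD_dloc[OF R S this]] this
    show "(-1) ^ i * FD (\<lambda>z. dloc R z (omit i es)) y (es ! i) = (\<Sum>j<Suc q. (-1) ^ (i + j) * G i j)"
      by (simp add: G_def sum_distrib_left power_add mult.assoc del: sum.lessThan_Suc)
  qed
  also have "\<dots> = 0"
  proof (rule alternating_double_sum_zero)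
    fix i j :: nat assume ij: "i \<le> j" "j < Suc q"
    then have "Ck_on 2 S (\<lambda>z. R z (omit i (omit (Suc j) es)))"
      using sform_Cinf[OF R, of "omit i (omit (Suc j) es)"] len by (simp add: Cinf_on_def)
    from Ck_on_second_derivative_symmetric[OF this S]
    show "G i j = G (Suc j) i"
      using ij len by (simp add: G_def omit_omit nth_omit)
  qed
  finally show ?thesis .
qed

text \<open>Differentiating the pulled-back arguments produces, beside the expected terms, values of
  \<open>R\<close> with a second derivative of \<open>g\<close> in one slot. By symmetry of that
  second derivative they cancel in pairs.\<close>

lemma dloc_pullback:
  fixes R :: "'e::finite_dim_inner \<Rightarrow> 'e list \<Rightarrow> real"
  assumes R: "sform T q R" and T: "open T" and g: "Cinf_on S g" "g ` S \<subseteq> T"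
    and S: "open S" "y \<in> S" and len: "length es = Suc q"
  shows "dloc (\<lambda>z fs. R (g z) (map (FD g z) fs)) y es = dloc R (g y) (map (FD g y) es)"
proof -
  let ?R = "\<lambda>z. R (g z)" and ?Es = "map (FD g y) es"
  have R': "sform S q ?R" by (rule sform_compose[OF R g(1) S(1) g(2)])
  have gy: "g y \<in> T" using g(2) S(2) by auto
  \<comment> \<open>The unwanted terms: argument \<open>i\<close> is the direction of
    differentiation, and slot \<open>j\<close> among the others holds the second derivative of
    \<open>g\<close>.\<close>
  define A where "A i j = R (g y) ((omit i ?Es)[j := FD (\<lambda>z. FD g z (omit i es ! j)) y (es ! i)])" for i j
  have step: "FD (\<lambda>z. R (g z) (map (FD g z) (omit i es))) y (es ! i)
     = FD (\<lambda>w. R w (omit i ?Es)) (g y) (?Es ! i) + (\<Sum>j<q. A i j)" if i: "i < Suc q" for i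
  proof -
    let ?Ws = "map (\<lambda>f z. FD g z f) (omit i es)"
    have l: "length (omit i es) = q" using i len by simp
    have "((\<lambda>z. ?R z ([] @ map (\<lambda>w. w z) ?Ws)) has_derivative
      (\<lambda>e. FD (\<lambda>z. ?R z ([] @ map (\<lambda>w. w y) ?Ws)) y e
       + (\<Sum>j<length ?Ws. ?R y ([] @ (map (\<lambda>w. w y) ?Ws)[j := FD (?Ws ! j) y e])))) (at y)"
    proof (rule sform_args_has_derivative[OF R' S])
      fix w assume "w \<in> set ?Ws"
      then show "w differentiable (at y)"
        using Cinf_on_has_derivative[OF Cinf_on_FD[OF g(1)] S(2)] by (auto simp: differentiable_def)
    qed (use l in simp)
    moreover have "map (\<lambda>w. w z) ?Ws = map (FD g z) (omit i es)" for z by simp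
    ultimately have "FD (\<lambda>z. R (g z) (map (FD g z) (omit i es))) y (es ! i)
      = FD (\<lambda>z. R (g z) (map (FD g y) (omit i es))) y (es ! i)
       + (\<Sum>j<length ?Ws. R (g y) ((map (FD g y) (omit i es))[j := FD (?Ws ! j) y (es ! i)]))"
      by (simp only: FD_eq append_Nil)
    moreover have "FD (\<lambda>z. R (g z) (map (FD g y) (omit i es))) y (es ! i)
      = FD (\<lambda>w. R w (omit i ?Es)) (g y) (?Es ! i)"
    proof -
      have "((\<lambda>w. R w (omit i ?Es)) has_derivative FD (\<lambda>w. R w (omit i ?Es)) (g y)) (at (g y))"
        using i len by (intro sform_has_derivative[OF R _ gy]) simp
      from has_derivative_compose[OF Cinf_on_has_derivative[OF g(1) S(2)] this]
      show ?thesis using i len by (simp add: FD_eq map_omit)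
    qed
    moreover have "(\<Sum>j<length ?Ws. R (g y) ((map (FD g y) (omit i es))[j := FD (?Ws ! j) y (es ! i)])) = (\<Sum>j<q. A i j)"
      using l by (intro sum.cong) (auto simp: A_def map_omit[of "FD g y"])
    ultimately show ?thesis by simp
  qed
  have "dloc (\<lambda>z fs. R (g z) (map (FD g z) fs)) y es
    = (\<Sum>i<Suc q. (-1) ^ i * (FD (\<lambda>w. R w (omit i ?Es)) (g y) (?Es ! i) + (\<Sum>j<q. A i j)))"
    unfolding dloc_def len by (intro sum.cong refl) (simp only: step lessThan_iff)
  also have "\<dots> = dloc R (g y) ?Es + (\<Sum>i<Suc q. \<Sum>j<q. (-1) ^ i * A i j)"
    using len by (simp add: dloc_def sum.distrib sum_distrib_left distrib_left del: sum.lessThan_Suc)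
  \<comment> \<open>The sign (-1)^j is inserted twice to reach the shape of
    \<open>alternating_double_sum_zero\<close>.\<close>
  also have "(\<Sum>i<Suc q. \<Sum>j<q. (-1) ^ i * A i j) = (\<Sum>i<Suc q. \<Sum>j<q. (-1) ^ (i + j) * ((-1) ^ j * A i j))"
    by (intro sum.cong refl) (simp add: power_add minus_one_power_iff)
  also have "\<dots> = 0"
  proof (rule alternating_double_sum_zero)
    fix i j :: nat assume ij: "i \<le> j" "j < q"
    define X where "X = FD (\<lambda>z. FD g z (es ! Suc j)) y (es ! i)"
    have X2: "X = FD (\<lambda>z. FD g z (es ! i)) y (es ! Suc j)"
      unfolding X_def by (rule Cinf_on_second_derivative_symmetric[OF g(1) S])
    \<comment> \<open>\<open>A i j\<close> and \<open>A (Suc j) i\<close> have the same entries;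
      only the vector \<open>X\<close> stands on different sides of the block \<open>?b\<close>, so
      they differ by the sign of moving it across \<open>j - i\<close> entries.\<close>
    let ?a = "take i ?Es" and ?b = "take (j - i) (drop (Suc i) ?Es)" and ?c = "drop (Suc (Suc j)) ?Es"
    have la: "length ?a = i" and lb: "length ?b = j - i" and lc: "length ?c = q - Suc j"
      using ij len by auto
    have A1: "(omit i ?Es)[j := X] = ?a @ ?b @ X # ?c"
    proof -
      have "drop (Suc i) ?Es = ?b @ drop (j - i) (drop (Suc i) ?Es)" by (rule append_take_drop_id[symmetric])
      also have "drop (j - i) (drop (Suc i) ?Es) = drop (Suc j) ?Es" using ij by (simp add: drop_drop)
      also have "drop (Suc j) ?Es = ?Es ! Suc j # ?c" using ij len by (intro Cons_nth_drop_Suc[symmetric]) simp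
      finally have "omit i ?Es = ?a @ ?b @ ?Es ! Suc j # ?c" by (simp only: omit_def)
      moreover have "(?a @ ?b @ Y # ?c)[j := X] = ?a @ ?b @ X # ?c" for Y
        using la lb ij by (simp add: list_update_append)
      ultimately show ?thesis by simp
    qed
    have A2: "(omit (Suc j) ?Es)[i := X] = ?a @ X # ?b @ ?c"
    proof -
      have "take (Suc j) ?Es = take (i + Suc (j - i)) ?Es" using ij by simp
      also have "\<dots> = ?a @ take (Suc (j - i)) (drop i ?Es)" by (rule take_add)
      also have "drop i ?Es = ?Es ! i # drop (Suc i) ?Es" using ij len by (intro Cons_nth_drop_Suc[symmetric]) simp
      finally have "omit (Suc j) ?Es = ?a @ ?Es ! i # ?b @ ?c" by (simp add: omit_def)
      then show ?thesis using la by (simp add: list_update_append)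
    qed
    have "A i j = R (g y) (?a @ ?b @ X # ?c)"
      unfolding A_def using A1 ij len by (simp add: nth_omit X_def)
    moreover have "A (Suc j) i = R (g y) (?a @ X # ?b @ ?c)"
      unfolding A_def using A2 ij len by (simp add: nth_omit X2)
    moreover have "R (g y) (?a @ X # ?b @ ?c) = (-1) ^ (j - i) * R (g y) (?a @ ?b @ X # ?c)"
      using altm_move[OF sform_altm[OF R gy], of ?a ?b ?c X] la lb lc ij by simp
    moreover have "(-1::real) ^ j = (-1) ^ i * (-1) ^ (j - i)"
      using ij by (simp flip: power_add)
    ultimately show "(-1) ^ j * A i j = (-1) ^ i * A (Suc j) i" by simp
  qed
  finally show ?thesis by simp
qed

section \<open>The Poincare lemma\<close>

lemma closed_0form_constant:
  fixes R :: "'e::real_normed_vector \<Rightarrow> 'e list \<Rightarrow> real"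
  assumes R: "sform S 0 R" and S: "convex S" "y \<in> S" "c \<in> S"
    and closed: "\<And>z e. z \<in> S \<Longrightarrow> dloc R z [e] = 0"
  shows "R y [] = R c []"
proof -
  have "\<exists>a. \<forall>z\<in>S. R z [] = a"
  proof (rule has_derivative_zero_constant[OF S(1)])
    fix z assume "z \<in> S"
    have "FD (\<lambda>z. R z []) z = (\<lambda>h. 0)"
      using closed[OF \<open>z \<in> S\<close>] by (simp add: dloc_Cons fun_eq_iff)
    then show "((\<lambda>z. R z []) has_derivative (\<lambda>h. 0)) (at z within S)"
      using sform_has_derivative[OF R _ \<open>z \<in> S\<close>, of "[]"] by (simp add: has_derivative_at_withinI)
  qed
  then show ?thesis using S by auto
qed

text \<open>The homotopy operator of the radial contraction to \<open>c\<close>: the radial vector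
  goes into the first slot and the result is integrated along the segment. The power of t arises
  because the contraction scales each remaining argument by t.\<close>

definition hloc :: "'e::real_normed_vector \<Rightarrow> ('e \<Rightarrow> 'e list \<Rightarrow> real) \<Rightarrow> 'e \<Rightarrow> 'e list \<Rightarrow> real" where
  "hloc c R y es = integral {0..1} (\<lambda>t. t ^ length es * R (c + t *\<^sub>R (y - c)) ((y - c) # es))"

lemma integral_slice:
  fixes F :: "real \<times> 'z::finite_dim_inner \<Rightarrow> real"
  assumes F: "Cinf_on T F" and T: "{0..1} \<times> {z} \<subseteq> T"
  shows "(\<lambda>t. F (t, z)) integrable_on {0..1}"
    and "(\<lambda>t. FD (\<lambda>z. F (t, z)) z v) integrable_on {0..1}"
proof -
  have c: "continuous_on {0..1} (\<lambda>t. G (t, z))" if "Cinf_on T G" for G :: "real \<times> 'z \<Rightarrow> real"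
    by (rule continuous_on_compose2[OF Cinf_on_continuous[OF that]])
      (use T in \<open>auto intro!: continuous_intros\<close>)
  show "(\<lambda>t. F (t, z)) integrable_on {0..1}" by (intro integrable_continuous_real c F)
  have "FD (\<lambda>z. F (t, z)) z v = FD F (t, z) (0, v)" if "t \<in> {0..1}" for t
  proof -
    have "((\<lambda>z. F (t, z)) has_derivative (\<lambda>v. FD F (t, z) (0, v))) (at z)"
      using T that by (intro has_derivative_slice Cinf_on_has_derivative[OF F]) auto
    then show ?thesis by (simp add: FD_eq)
  qed
  then have "(\<lambda>t. FD (\<lambda>z. F (t, z)) z v) integrable_on {0..1} \<longleftrightarrow> (\<lambda>t. FD F (t, z) (0, v)) integrable_on {0..1}"
    by (intro integrable_cong) auto
  then show "(\<lambda>t. FD (\<lambda>z. F (t, z)) z v) integrable_on {0..1}"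
    using integrable_continuous_real[OF c[OF Cinf_on_FD[OF F]]] by simp
qed

lemma altm_Cons:
  assumes "altm (Suc q) \<alpha>"
  shows "altm q (\<lambda>es. \<alpha> (w # es))"
proof (rule altmI)
  fix xs ys :: "'a list" assume "Suc (length xs + length ys) = q"
  then show "linear (\<lambda>v. \<alpha> (w # xs @ v # ys))"
    using altm_linear[OF assms, of "w # xs" ys] by simp
next
  fix xs ys zs :: "'a list" and v assume "Suc (Suc (length xs + length ys + length zs)) = q"
  then show "\<alpha> (w # xs @ v # ys @ v # zs) = 0"
    using altm_zero[OF assms, of "w # xs" ys zs] by simp
qed

lemma segment_in_convex:
  assumes "convex S" "c \<in> S" "y \<in> S" "0 \<le> t" "t \<le> 1"
  shows "c + t *\<^sub>R (y - c) \<in> S"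
proof -
  have "(1 - t) *\<^sub>R c + t *\<^sub>R y \<in> S" using assms by (intro convexD) auto
  then show ?thesis by (simp add: algebra_simps)
qed

text \<open>The domain is an open set of triples \<open>(t, y, x)\<close> which, for convex
  \<open>S\<close> containing \<open>c\<close>, includes the closed unit interval times
  \<open>S \<times> P\<close>. Derivatives at \<open>t = 0\<close> and \<open>t = 1\<close> are thus
  two-sided.\<close>

lemma hloc_integrand_Cinf:
  fixes R :: "'x::finite_dim_inner \<Rightarrow> 'e::finite_dim_inner \<Rightarrow> 'e list \<Rightarrow> real"
  assumes R: "sform (S \<times> P) (Suc q) (\<lambda>(y, x). R x y)" and S: "open S" and P: "open P"
    and len: "length es = q"
  shows "Cinf_on {(t, y, x). c + t *\<^sub>R (y - c) \<in> S \<and> x \<in> P}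
    (\<lambda>(t, y, x). t ^ length es * R x (c + t *\<^sub>R (y - c)) ((y - c) # es))"
    and "open {(t, y, x). c + t *\<^sub>R (y - c) \<in> S \<and> x \<in> P}"
proof -
  let ?g = "\<lambda>p::real \<times> 'e \<times> 'x. (c + fst p *\<^sub>R (fst (snd p) - c), snd (snd p))"
  have eq: "{(t, y, x). c + t *\<^sub>R (y - c) \<in> S \<and> x \<in> P} = ?g -` (S \<times> P)" by auto
  show op: "open {(t, y, x). c + t *\<^sub>R (y - c) \<in> S \<and> x \<in> P}"
    unfolding eq by (intro open_vimage open_Times S P continuous_intros)
  let ?T = "{(t, y, x). c + t *\<^sub>R (y - c) \<in> S \<and> x \<in> P}"
  have "sform ?T (Suc q) (\<lambda>p. (\<lambda>(y, x). R x y) (?g p))"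
    by (rule sform_compose[OF R _ op]) (auto intro!: Cinf_intros op)
  then have R': "sform ?T (Suc q) (\<lambda>p. R (snd (snd p)) (c + fst p *\<^sub>R (fst (snd p) - c)))" by simp
  let ?Ws = "(\<lambda>p::real \<times> 'e \<times> 'x. fst (snd p) - c) # map (\<lambda>e _. e) es"
  have "Cinf_on ?T (\<lambda>p. R (snd (snd p)) (c + fst p *\<^sub>R (fst (snd p) - c)) ([] @ map (\<lambda>w. w p) ?Ws))"
    by (rule Cinf_on_sform_args[OF R' op]) (use len in \<open>auto intro!: Cinf_intros op\<close>)
  then have "Cinf_on ?T (\<lambda>p. fst p ^ length es * R (snd (snd p)) (c + fst p *\<^sub>R (fst (snd p) - c)) ((fst (snd p) - c) # es))"
    by (intro Cinf_intros op) (simp add: o_def)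
  then show "Cinf_on ?T (\<lambda>(t, y, x). t ^ length es * R x (c + t *\<^sub>R (y - c)) ((y - c) # es))"
    by (simp add: split_def)
qed

lemma sform_hloc:
  fixes R :: "'x::finite_dim_inner \<Rightarrow> 'e::finite_dim_inner \<Rightarrow> 'e list \<Rightarrow> real"
  assumes R: "sform (S \<times> P) (Suc q) (\<lambda>(y, x). R x y)" and S: "open S" "convex S" "c \<in> S"
    and P: "open P"
  shows "sform (S \<times> P) q (\<lambda>(y, x). hloc c (R x) y)"
  unfolding sform_def
proof (intro conjI ballI allI impI)
  fix es :: "'e list" assume len: "length es = q"
  let ?T = "{(t, y, x). c + t *\<^sub>R (y - c) \<in> S \<and> x \<in> P}"
  have "Cinf_on (S \<times> P) (\<lambda>z. integral {0..1} (\<lambda>t. (\<lambda>(t, y, x). t ^ length es * R x (c + t *\<^sub>R (y - c)) ((y - c) # es)) (t, z)))"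
    by (rule Cinf_on_integral[OF hloc_integrand_Cinf(1)[OF R S(1) P len]])
      (use S P in \<open>auto intro!: segment_in_convex open_Times\<close>)
  then show "Cinf_on (S \<times> P) (\<lambda>z. (case z of (y, x) \<Rightarrow> hloc c (R x) y) es)"
    by (simp add: hloc_def split_def)
next
  fix z assume "z \<in> S \<times> P"
  then obtain y x where z: "z = (y, x)" "y \<in> S" "x \<in> P" by auto
  have int: "(\<lambda>t. t ^ length es * R x (c + t *\<^sub>R (y - c)) ((y - c) # es)) integrable_on {0..1}" if "length es = q" for es
  proof -
    have "(\<lambda>t. (\<lambda>(t, y, x). t ^ length es * R x (c + t *\<^sub>R (y - c)) ((y - c) # es)) (t, (y, x))) integrable_on {0..1}"
      by (rule integral_slice(1)[OF hloc_integrand_Cinf(1)[OF R S(1) P that]])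
        (use S z in \<open>auto intro!: segment_in_convex\<close>)
    then show ?thesis by simp
  qed
  have alt: "altm q (\<lambda>es. R x (c + t *\<^sub>R (y - c)) ((y - c) # es))" if "t \<in> {0..1}" for t
  proof -
    have "(c + t *\<^sub>R (y - c), x) \<in> S \<times> P" using S z that by (auto intro!: segment_in_convex)
    from altm_Cons[OF sform_altm[OF R this]] show ?thesis by simp
  qed
  have "altm q (hloc c (R x) y)"
  proof (rule altmI)
    fix xs ys :: "'e list" assume len: "Suc (length xs + length ys) = q"
    note lin = altm_linear[OF alt len]
    show "linear (\<lambda>v. hloc c (R x) y (xs @ v # ys))"
    proof (rule linearI)
      fix v w
      have "hloc c (R x) y (xs @ (v + w) # ys) = integral {0..1} (\<lambda>t.
          t ^ length (xs @ v # ys) * R x (c + t *\<^sub>R (y - c)) ((y - c) # (xs @ v # ys)) +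
          t ^ length (xs @ w # ys) * R x (c + t *\<^sub>R (y - c)) ((y - c) # (xs @ w # ys)))"
        unfolding hloc_def
      proof (rule integral_cong)
        fix t :: real assume t: "t \<in> {0..1}"
        show "t ^ length (xs @ (v + w) # ys) * R x (c + t *\<^sub>R (y - c)) ((y - c) # xs @ (v + w) # ys) =
          t ^ length (xs @ v # ys) * R x (c + t *\<^sub>R (y - c)) ((y - c) # (xs @ v # ys)) +
          t ^ length (xs @ w # ys) * R x (c + t *\<^sub>R (y - c)) ((y - c) # (xs @ w # ys))"
          unfolding linear_add[OF lin[OF t]] by (simp only: distrib_left length_append list.size)
      qed
      also have "\<dots> = hloc c (R x) y (xs @ v # ys) + hloc c (R x) y (xs @ w # ys)"
        unfolding hloc_def by (rule Henstock_Kurzweil_Integration.integral_add) (rule int, use len in simp)+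
      finally show "hloc c (R x) y (xs @ (v + w) # ys) = hloc c (R x) y (xs @ v # ys) + hloc c (R x) y (xs @ w # ys)" .
    next
      fix a v
      have "hloc c (R x) y (xs @ (a *\<^sub>R v) # ys) = integral {0..1} (\<lambda>t.
          a * (t ^ length (xs @ v # ys) * R x (c + t *\<^sub>R (y - c)) ((y - c) # (xs @ v # ys))))"
        unfolding hloc_def
      proof (rule integral_cong)
        fix t :: real assume t: "t \<in> {0..1}"
        show "t ^ length (xs @ (a *\<^sub>R v) # ys) * R x (c + t *\<^sub>R (y - c)) ((y - c) # xs @ (a *\<^sub>R v) # ys) =
          a * (t ^ length (xs @ v # ys) * R x (c + t *\<^sub>R (y - c)) ((y - c) # (xs @ v # ys)))"
          unfolding linear_scale[OF lin[OF t]] real_scaleR_def by (simp only: mult.left_commute length_append list.size)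
      qed
      then show "hloc c (R x) y (xs @ (a *\<^sub>R v) # ys) = a *\<^sub>R hloc c (R x) y (xs @ v # ys)"
        by (simp add: hloc_def)
    qed
  next
    fix xs ys zs :: "'e list" and v assume len: "Suc (Suc (length xs + length ys + length zs)) = q"
    have "hloc c (R x) y (xs @ v # ys @ v # zs) = integral {0..1} (\<lambda>t::real. 0)"
      unfolding hloc_def by (intro integral_cong) (simp add: altm_zero[OF alt len])
    then show "hloc c (R x) y (xs @ v # ys @ v # zs) = 0" by simp
  qed
  then show "altm q (case z of (y, x) \<Rightarrow> hloc c (R x) y)" using z by simp
qed

lemma altm_update_zero:
  assumes "altm q \<alpha>" "length es = q" "j < q"
  shows "\<alpha> (es[j := 0]) = 0"
proof -
  have "linear (\<lambda>v. \<alpha> (take j es @ v # drop (Suc j) es))"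
    using assms by (intro altm_linear[OF assms(1)]) auto
  from linear_0[OF this] show ?thesis using assms by (simp add: upd_conv_take_nth_drop)
qed

lemma altm_Cons_nth_omit:
  assumes "altm q \<alpha>" "length es = q" "i < q"
  shows "\<alpha> (es ! i # omit i es) = (-1) ^ i * \<alpha> es"
proof -
  have "\<alpha> ([] @ es ! i # take i es @ drop (Suc i) es) = (-1) ^ length (take i es) * \<alpha> ([] @ take i es @ es ! i # drop (Suc i) es)"
    by (rule altm_move[OF assms(1)]) (use assms in auto)
  then show ?thesis using assms by (simp add: omit_def id_take_nth_drop[symmetric])
qed

text \<open>The variable enters through the base point, which brings a factor t, and through the
  inserted radial vector, whose derivative is \<open>e\<close>. The other arguments are constant, so
  their terms vanish by \<open>altm_update_zero\<close>.\<close>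

lemma hloc_integrand_FD:
  fixes R :: "'e::finite_dim_inner \<Rightarrow> 'e list \<Rightarrow> real"
  assumes R: "sform S (Suc q) R" and S: "open S" and y: "c + t *\<^sub>R (y - c) \<in> S" and len: "length es = q"
  shows "FD (\<lambda>z. t ^ length es * R (c + t *\<^sub>R (z - c)) ((z - c) # es)) y e
    = t ^ q * (t * FD (\<lambda>w. R w ((y - c) # es)) (c + t *\<^sub>R (y - c)) e + R (c + t *\<^sub>R (y - c)) (e # es))"
proof -
  let ?g = "\<lambda>z. c + t *\<^sub>R (z - c)"
  let ?T = "?g -` S"
  have T: "open ?T" by (intro open_vimage S continuous_intros)
  have R': "sform ?T (Suc q) (\<lambda>z. R (?g z))"
    by (rule sform_compose[OF R _ T]) (auto intro!: Cinf_intros T)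
  let ?Ws = "(\<lambda>z. z - c) # map (\<lambda>e _. e) es"
  have m: "map (\<lambda>w. w z) ?Ws = (z - c) # es" for z by (simp add: o_def)
  have W0: "FD (?Ws ! 0) y e = e"
    by (simp add: FD_eq[OF has_derivative_diff[OF has_derivative_ident has_derivative_const]])
  have "((\<lambda>z. R (?g z) ([] @ map (\<lambda>w. w z) ?Ws)) has_derivative
    (\<lambda>e. FD (\<lambda>z. R (?g z) ([] @ map (\<lambda>w. w y) ?Ws)) y e
       + (\<Sum>j<length ?Ws. R (?g y) ([] @ (map (\<lambda>w. w y) ?Ws)[j := FD (?Ws ! j) y e])))) (at y)"
    by (rule sform_args_has_derivative[OF R' T]) (use y len in auto)
  then have D: "((\<lambda>z. t ^ length es * R (?g z) ((z - c) # es)) has_derivative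
    (\<lambda>e. t ^ length es * (FD (\<lambda>z. R (?g z) ((y - c) # es)) y e
       + (\<Sum>j<length ?Ws. R (?g y) (((y - c) # es)[j := FD (?Ws ! j) y e])))) ) (at y)"
    unfolding m append_Nil by (rule has_derivative_mult_right)
  have "(\<Sum>j<length ?Ws. R (?g y) (((y - c) # es)[j := FD (?Ws ! j) y e]))
      = R (?g y) (e # es) + (\<Sum>j<q. R (?g y) (((y - c) # es)[Suc j := 0]))"
  proof -
    have "(\<Sum>j<length ?Ws. R (?g y) (((y - c) # es)[j := FD (?Ws ! j) y e]))
       = R (?g y) (((y - c) # es)[0 := FD (?Ws ! 0) y e])
       + (\<Sum>j<q. R (?g y) (((y - c) # es)[Suc j := FD (?Ws ! Suc j) y e]))"
      using len by (simp only: length_Cons length_map sum.lessThan_Suc_shift)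
    moreover have "FD (?Ws ! Suc j) y e = 0" if "j < q" for j using that len by simp
    ultimately show ?thesis unfolding W0 by simp
  qed
  also have "(\<Sum>j<q. R (?g y) (((y - c) # es)[Suc j := 0])) = 0"
    using len by (intro sum.neutral ballI altm_update_zero[OF sform_altm[OF R y]]) auto
  finally have s: "(\<Sum>j<length ?Ws. R (?g y) (((y - c) # es)[j := FD (?Ws ! j) y e])) = R (?g y) (e # es)" by simp
  have "FD (\<lambda>z. R (?g z) ((y - c) # es)) y e = t * FD (\<lambda>w. R w ((y - c) # es)) (?g y) e"
  proof -
    have d: "((\<lambda>w. R w ((y - c) # es)) has_derivative FD (\<lambda>w. R w ((y - c) # es)) (?g y)) (at (?g y))"
      using len y by (intro sform_has_derivative[OF R]) auto
    have "(?g has_derivative (\<lambda>e. t *\<^sub>R e)) (at y)" by (auto intro!: derivative_eq_intros)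
    from FD_eq[OF has_derivative_compose[OF this d]] linear_scale[OF has_derivative_linear[OF d]]
    show ?thesis by simp
  qed
  then show ?thesis unfolding FD_eq[OF D] s using len by simp
qed

text \<open>After differentiation under the integral, closedness turns the alternating sum into a
  radial derivative, and the integrand becomes the t-derivative of t^(q+1) times \<open>R\<close> at
  the moving point. That factor kills the contribution of \<open>t = 0\<close>.\<close>

theorem poincare_hloc:
  fixes R :: "'e::finite_dim_inner \<Rightarrow> 'e list \<Rightarrow> real"
  assumes R: "sform S (Suc q) R" and S: "open S" "convex S" "c \<in> S"
    and closed: "\<And>z es. z \<in> S \<Longrightarrow> length es = Suc (Suc q) \<Longrightarrow> dloc R z es = 0"
    and y: "y \<in> S" and len: "length es = Suc q"
  shows "dloc (hloc c R) y es = R y es"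
proof -
  let ?g = "\<lambda>t. c + t *\<^sub>R (y - c)"
  define F where "F fs = (\<lambda>(t, z). t ^ length fs * R (c + t *\<^sub>R (z - c)) ((z - c) # fs))" for fs
  define T where "T = {(t, z). c + t *\<^sub>R (z - c) \<in> S}"
  have FC: "Cinf_on T (F fs)" if "length fs = q" for fs
  proof -
    \<comment> \<open>\<open>hloc_integrand_Cinf\<close> speaks of families, so a dummy real
      parameter is added here and set to 0 afterwards.\<close>
    have "Cinf_on (S \<times> UNIV) (\<lambda>p. R (fst p) es)" if "length es = Suc q" for es
      by (rule Cinf_on_compose[OF sform_Cinf[OF R that]]) (auto intro!: Cinf_intros open_Times S)
    then have "sform (S \<times> (UNIV::real set)) (Suc q) (\<lambda>(y, x). R y)"
      using sform_altm[OF R] by (auto simp: sform_def split_def)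
    then have "Cinf_on {(t, y, x). c + t *\<^sub>R (y - c) \<in> S \<and> x \<in> (UNIV::real set)}
      (\<lambda>(t, y, x). t ^ length fs * R (c + t *\<^sub>R (y - c)) ((y - c) # fs))"
      by (rule hloc_integrand_Cinf(1)[of _ _ _ "\<lambda>_. R"]) (use S that in auto)
    then have "Cinf_on T (\<lambda>p. (\<lambda>(t, y, x). t ^ length fs * R (c + t *\<^sub>R (y - c)) ((y - c) # fs)) (fst p, snd p, 0::real))"
    proof (rule Cinf_on_compose)
      have "T = (\<lambda>p. c + fst p *\<^sub>R (snd p - c)) -` S" by (auto simp: T_def)
      then show "open T" by (auto intro!: open_vimage S continuous_intros)
      then show "Cinf_on T (\<lambda>p. (fst p, snd p, 0::real))" by (intro Cinf_intros)
    qed (auto simp: T_def)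
    then show ?thesis by (simp add: F_def split_def)
  qed
  have T: "{0..1} \<times> S \<subseteq> T" using S by (auto simp: T_def intro!: segment_in_convex)
  have gS: "?g t \<in> S" if "t \<in> {0..1}" for t using S y that by (auto intro!: segment_in_convex)
  have h: "hloc c R z fs = integral {0..1} (\<lambda>t. F fs (t, z))" for z fs by (simp add: hloc_def F_def)
  have lo: "length (omit i es) = q" if "i < Suc q" for i using that len by simp
  have int: "(\<lambda>t. FD (\<lambda>z. F (omit i es) (t, z)) y (es ! i)) integrable_on {0..1}" if "i < Suc q" for i
    by (rule integral_slice(2)[OF FC[OF lo[OF that]]]) (use T y in auto)
  have "dloc (hloc c R) y es = (\<Sum>i<Suc q. (-1) ^ i * integral {0..1} (\<lambda>t. FD (\<lambda>z. F (omit i es) (t, z)) y (es ! i)))"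
    unfolding dloc_def h len
    by (intro sum.cong refl arg_cong2[where f="(*)"] FD_integral[OF FC[OF lo] T S(1) y]) simp
  also have "\<dots> = integral {0..1} (\<lambda>t. \<Sum>i<Suc q. (-1) ^ i * FD (\<lambda>z. F (omit i es) (t, z)) y (es ! i))"
    using int by (subst integral_sum) (auto intro!: integrable_on_mult_right)
  also have "\<dots> = integral {0..1} (\<lambda>t. t ^ Suc q * FD (\<lambda>z. R z es) (?g t) (y - c) + real (Suc q) * t ^ q * R (?g t) es)"
  proof (rule integral_cong)
    fix t :: real assume t: "t \<in> {0..1}"
    have "(\<Sum>i<Suc q. (-1) ^ i * FD (\<lambda>z. F (omit i es) (t, z)) y (es ! i))
      = (\<Sum>i<Suc q. t ^ Suc q * ((-1) ^ i * FD (\<lambda>w. R w ((y - c) # omit i es)) (?g t) (es ! i)) + t ^ q * R (?g t) es)"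
    proof (rule sum.cong[OF refl])
      fix i assume "i \<in> {..<Suc q}"
      then have i: "i < Suc q" by simp
      have "FD (\<lambda>z. F (omit i es) (t, z)) y (es ! i)
        = t ^ q * (t * FD (\<lambda>w. R w ((y - c) # omit i es)) (?g t) (es ! i) + R (?g t) (es ! i # omit i es))"
        unfolding F_def prod.case by (rule hloc_integrand_FD[OF R S(1) gS[OF t] lo[OF i]])
      also have "R (?g t) (es ! i # omit i es) = (-1) ^ i * R (?g t) es"
        by (rule altm_Cons_nth_omit[OF sform_altm[OF R gS[OF t]] len i])
      finally show "(-1) ^ i * FD (\<lambda>z. F (omit i es) (t, z)) y (es ! i)
        = t ^ Suc q * ((-1) ^ i * FD (\<lambda>w. R w ((y - c) # omit i es)) (?g t) (es ! i)) + t ^ q * R (?g t) es"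
        by (simp add: algebra_simps minus_one_power_iff)
    qed
    also have "\<dots> = t ^ Suc q * (\<Sum>i<Suc q. (-1) ^ i * FD (\<lambda>w. R w ((y - c) # omit i es)) (?g t) (es ! i))
        + real (Suc q) * t ^ q * R (?g t) es"
      by (simp only: sum.distrib sum_distrib_left[symmetric] sum_constant card_lessThan mult.assoc mult.left_commute)
    \<comment> \<open>Closedness on the list with the radial vector in front: the first summand of
      \<open>dloc\<close> is the radial derivative, the others form this sum.\<close>
    also have "(\<Sum>i<Suc q. (-1) ^ i * FD (\<lambda>w. R w ((y - c) # omit i es)) (?g t) (es ! i)) = FD (\<lambda>z. R z es) (?g t) (y - c)"
      using closed[OF gS[OF t], of "(y - c) # es"] len by (simp add: dloc_Cons del: sum.lessThan_Suc)
    finally show "(\<Sum>i<Suc q. (-1) ^ i * FD (\<lambda>z. F (omit i es) (t, z)) y (es ! i))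
      = t ^ Suc q * FD (\<lambda>z. R z es) (?g t) (y - c) + real (Suc q) * t ^ q * R (?g t) es" .
  qed
  also have "\<dots> = 1 ^ Suc q * R (?g 1) es - 0 ^ Suc q * R (?g 0) es"
  proof (rule integral_unique, rule fundamental_theorem_of_calculus)
    fix t :: real assume t: "t \<in> {0..1}"
    have d: "((\<lambda>w. R w es) has_derivative FD (\<lambda>w. R w es) (?g t)) (at (?g t))"
      by (rule sform_has_derivative[OF R len gS[OF t]])
    have "(?g has_derivative (\<lambda>s. s *\<^sub>R (y - c))) (at t)" by (auto intro!: derivative_eq_intros)
    from has_derivative_compose[OF this d]
    have "((\<lambda>t. R (?g t) es) has_real_derivative FD (\<lambda>w. R w es) (?g t) (y - c)) (at t)"
      by (simp add: has_field_derivative_def linear_scale[OF has_derivative_linear[OF d]] mult_commute_abs)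
    from DERIV_mult[OF DERIV_pow[of "Suc q" t] this]
    have "((\<lambda>t. t ^ Suc q * R (?g t) es) has_real_derivative
      t ^ Suc q * FD (\<lambda>z. R z es) (?g t) (y - c) + real (Suc q) * t ^ q * R (?g t) es) (at t)"
      by (simp add: algebra_simps)
    then show "((\<lambda>t. t ^ Suc q * R (?g t) es) has_vector_derivative
      t ^ Suc q * FD (\<lambda>z. R z es) (?g t) (y - c) + real (Suc q) * t ^ q * R (?g t) es) (at t within {0..1})"
      by (simp only: has_real_derivative_iff_has_vector_derivative has_vector_derivative_at_within)
  qed simp
  finally show ?thesis by simp
qed

text \<open>Hadamard's lemma: integrate the derivative along the segment from \<open>a\<close> and
  pull the linear dependence on \<open>y - a\<close> out of the integral. The expansion stands under
  the quantifier over \<open>onb\<close>, so it says nothing in dimension 0.\<close>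

lemma hadamard:
  fixes h :: "'z::finite_dim_inner \<Rightarrow> real"
  assumes h: "Cinf_on (ball a r) h" and r: "r > 0"
  shows "\<exists>g. \<forall>b\<in>onb. Cinf_on (ball a r) (g b) \<and> g b a = FD h a b \<and>
    (\<forall>y\<in>ball a r. h y = h a + (\<Sum>b\<in>onb. ((y - a) \<bullet> b) * g b y))"
proof -
  define g where "g b y = integral {0..1} (\<lambda>t. FD h (a + t *\<^sub>R (y - a)) b)" for b y
  let ?T = "(\<lambda>p. a + fst p *\<^sub>R (snd p - a)) -` ball a r"
  have T: "open ?T" by (intro open_vimage open_ball continuous_intros)
  have seg: "a + t *\<^sub>R (y - a) \<in> ball a r" if "y \<in> ball a r" "t \<in> {0..1}" for y t
    using that r by (intro segment_in_convex) auto
  have C: "Cinf_on ?T (\<lambda>p. FD h (a + fst p *\<^sub>R (snd p - a)) b)" for b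
    by (rule Cinf_on_compose[OF Cinf_on_FD[OF h]]) (auto intro!: Cinf_intros T)
  have gC: "Cinf_on (ball a r) (g b)" for b
  proof -
    have "Cinf_on (ball a r) (\<lambda>y. integral {0..1} (\<lambda>t. (\<lambda>p. FD h (a + fst p *\<^sub>R (snd p - a)) b) (t, y)))"
      by (rule Cinf_on_integral[OF C]) (use seg in auto)
    then show ?thesis by (simp add: g_def[abs_def])
  qed
  have ga: "g b a = FD h a b" for b by (simp add: g_def)
  have "h y = h a + (\<Sum>b\<in>onb. ((y - a) \<bullet> b) * g b y)" if y: "y \<in> ball a r" for y
  proof -
    have d: "(h has_derivative FD h (a + t *\<^sub>R (y - a))) (at (a + t *\<^sub>R (y - a)))" if "t \<in> {0..1}" for t
      by (rule Cinf_on_has_derivative[OF h seg[OF y that]])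
    have "((\<lambda>t. FD h (a + t *\<^sub>R (y - a)) (y - a)) has_integral (h (a + 1 *\<^sub>R (y - a)) - h (a + 0 *\<^sub>R (y - a)))) {0..1}"
    proof (rule fundamental_theorem_of_calculus)
      fix t :: real assume t: "t \<in> {0..1}"
      have "((\<lambda>t. a + t *\<^sub>R (y - a)) has_derivative (\<lambda>s. s *\<^sub>R (y - a))) (at t)"
        by (auto intro!: derivative_eq_intros)
      from has_derivative_compose[OF this d[OF t]]
      have "((\<lambda>t. h (a + t *\<^sub>R (y - a))) has_vector_derivative FD h (a + t *\<^sub>R (y - a)) (y - a)) (at t)"
        by (simp add: has_vector_derivative_def linear_scale[OF has_derivative_linear[OF d[OF t]]])
      then show "((\<lambda>t. h (a + t *\<^sub>R (y - a))) has_vector_derivative FD h (a + t *\<^sub>R (y - a)) (y - a)) (at t within {0..1})"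
        by (rule has_vector_derivative_at_within)
    qed simp
    then have "h y - h a = integral {0..1} (\<lambda>t. FD h (a + t *\<^sub>R (y - a)) (y - a))"
      by (simp add: integral_unique)
    also have "\<dots> = integral {0..1} (\<lambda>t. \<Sum>b\<in>onb. ((y - a) \<bullet> b) * FD h (a + t *\<^sub>R (y - a)) b)"
    proof (rule integral_cong)
      fix t :: real assume t: "t \<in> {0..1}"
      show "FD h (a + t *\<^sub>R (y - a)) (y - a) = (\<Sum>b\<in>onb. ((y - a) \<bullet> b) * FD h (a + t *\<^sub>R (y - a)) b)"
        using linear_onb_expand[OF has_derivative_linear[OF d[OF t]], of "y - a"] by simp
    qed
    also have "\<dots> = (\<Sum>b\<in>onb. integral {0..1} (\<lambda>t. ((y - a) \<bullet> b) * FD h (a + t *\<^sub>R (y - a)) b))"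
    proof (rule integral_sum)
      fix b :: 'z
      have "(\<lambda>t. (\<lambda>p. FD h (a + fst p *\<^sub>R (snd p - a)) b) (t, y)) integrable_on {0..1}"
        by (rule integral_slice(1)[OF C]) (use seg y in auto)
      then show "(\<lambda>t. ((y - a) \<bullet> b) * FD h (a + t *\<^sub>R (y - a)) b) integrable_on {0..1}"
        by (intro integrable_on_mult_right) simp
    qed simp
    finally show ?thesis by (simp add: g_def)
  qed
  then show ?thesis using gC ga by (intro exI[of _ g]) auto
qed

section \<open>Diffeomorphic images of small balls are convex\<close>

text \<open>Near \<open>a\<close> the squared distance from \<open>f y\<close> to \<open>f a\<close> has positive definite second derivative, so its
  sublevel sets are convex.\<close>

lemma Cinf_diffeo_small_ball_convex:
  fixes f g :: "'e::finite_dim_inner \<Rightarrow> 'e"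
  assumes S: "open S" and T: "open T" and f: "Cinf_on S f" "f ` S \<subseteq> T" and g: "Cinf_on T g" "g ` T \<subseteq> S"
    and gf: "\<And>y. y \<in> S \<Longrightarrow> g (f y) = y" and fg: "\<And>w. w \<in> T \<Longrightarrow> f (g w) = w"
    and a: "a \<in> S"
  shows "\<exists>r0>0. \<forall>r. 0 < r \<longrightarrow> r \<le> r0 \<longrightarrow> ball (f a) r \<subseteq> T \<and> convex (g ` ball (f a) r)"
proof -
  have fa: "f a \<in> T" using f(2) a by auto
  have Df: "(f has_derivative FD f y) (at y)" if "y \<in> S" for y by (rule Cinf_on_has_derivative[OF f(1) that])
  have D2f: "((\<lambda>z. FD f z v) has_derivative FD (\<lambda>z. FD f z v) y) (at y)" if "y \<in> S" for y v
    by (rule Cinf_on_has_derivative[OF Cinf_on_FD[OF f(1)] that])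
  have Dg: "(g has_derivative FD g (f a)) (at (f a))" by (rule Cinf_on_has_derivative[OF g(1) fa])
  have inv: "FD g (f a) (FD f a v) = v" for v
  proof -
    have "((\<lambda>y. g (f y)) has_derivative (\<lambda>v. FD g (f a) (FD f a v))) (at a)"
      by (rule has_derivative_compose[OF Df[OF a] Dg])
    then have "((\<lambda>y. y) has_derivative (\<lambda>v. FD g (f a) (FD f a v))) (at a)"
      using has_derivative_cong_open[OF S a, of "\<lambda>y. g (f y)" "\<lambda>y. y"] gf by simp
    from has_derivative_unique[OF this has_derivative_ident] show ?thesis by (simp add: fun_eq_iff)
  qed
  \<comment> \<open>\<open>K\<close> bounds the inverse of the derivative at \<open>a\<close>, so
    that the derivative stretches lengths by at least 1/K there and by at least 1/(2K)
    nearby.\<close>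
  obtain K where K: "K > 0" "\<And>w. norm (FD g (f a) w) \<le> norm w * K"
    using bounded_linear.pos_bounded[OF has_derivative_bounded_linear[OF Dg]] by blast
  \<comment> \<open>In terms of basis vectors, \<open>s1\<close> measures the change of the first
    derivative and \<open>s2\<close> the size of the second; \<open>C\<close> bounds
    \<open>s2\<close> near \<open>a\<close> and is positive because of the added 1.\<close>
  define s1 where "s1 y = (\<Sum>b\<in>onb. norm (FD f y b - FD f a b))" for y
  define s2 where "s2 y = (\<Sum>b\<in>onb. \<Sum>b'\<in>onb. norm (FD (\<lambda>z. FD f z b) y b'))" for y
  define C where "C = s2 a + 1"
  have C: "C > 0" unfolding C_def s2_def by (intro add_nonneg_pos sum_nonneg) auto
  have c1: "continuous_on S s1" unfolding s1_def
    by (intro continuous_intros Cinf_on_continuous Cinf_on_FD f)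
  have c2: "continuous_on S s2" unfolding s2_def
    by (intro continuous_intros Cinf_on_continuous Cinf_on_FD f)
  have c3: "continuous_on S (\<lambda>y. norm (f y - f a))"
    by (intro continuous_intros Cinf_on_continuous f)
  have ev: "\<forall>\<^sub>F y in nhds a. h y < m" if "continuous_on S h" "h a < m" for h :: "'e \<Rightarrow> real" and m
  proof -
    have "isCont h a" using that(1) S a continuous_on_eq_continuous_at by blast
    then have "\<forall>\<^sub>F y in at a. h y < m" using that(2) by (auto simp: isCont_def intro: order_tendstoD)
    then show ?thesis using that(2) by (simp add: eventually_nhds_conv_at)
  qed
  have "\<forall>\<^sub>F y in nhds a. s1 y < 1 / (2 * K)" using K by (intro ev c1) (simp add: s1_def)
  moreover have "\<forall>\<^sub>F y in nhds a. s2 y < C" by (intro ev c2) (simp add: C_def)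
  \<comment> \<open>With this bound the term containing the second derivative is at most
    \<open>(norm v / (2 * K))\<^sup>2\<close>, which is also the lower bound for the square of the
    first derivative; so the latter absorbs it.\<close>
  moreover have "\<forall>\<^sub>F y in nhds a. norm (f y - f a) < 1 / (4 * K\<^sup>2 * C)" using K C by (intro ev c3) simp
  moreover have "\<forall>\<^sub>F y in nhds a. y \<in> S" using S a by (rule eventually_nhds_in_open)
  ultimately have "\<forall>\<^sub>F y in nhds a. s1 y < 1 / (2 * K) \<and> s2 y < C \<and> norm (f y - f a) < 1 / (4 * K\<^sup>2 * C) \<and> y \<in> S"
    by eventually_elim auto
  then obtain d where d: "d > 0" "\<And>y. y \<in> ball a d \<Longrightarrow>
      s1 y < 1 / (2 * K) \<and> s2 y < C \<and> norm (f y - f a) < 1 / (4 * K\<^sup>2 * C) \<and> y \<in> S"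
    unfolding eventually_nhds_metric by (auto simp: dist_commute)
  have nb: "\<bar>v \<bullet> b\<bar> \<le> norm v" if "b \<in> onb" for b v :: 'e
    using Cauchy_Schwarz_ineq2[of v b] norm_onb_le[OF that] by simp
  have lower: "norm v / (2 * K) \<le> norm (FD f y v)" if y: "y \<in> ball a d" for y v
  proof -
    have lin: "linear (\<lambda>v. FD f y v - FD f a v)"
      using linear_compose_sub[OF has_derivative_linear[OF Df] has_derivative_linear[OF Df[OF a]], of y] d(2)[OF y] by simp
    have "norm (FD f y v - FD f a v) = norm (\<Sum>b\<in>onb. (v \<bullet> b) *\<^sub>R (FD f y b - FD f a b))"
      by (simp only: linear_onb_expand[OF lin, of v])
    also have "\<dots> \<le> (\<Sum>b\<in>onb. norm v * norm (FD f y b - FD f a b))"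
      by (intro order_trans[OF norm_sum] sum_mono) (auto intro!: mult_right_mono nb)
    also have "\<dots> = norm v * s1 y" by (simp add: s1_def sum_distrib_left)
    also have "\<dots> \<le> norm v * (1 / (2 * K))" using d(2)[OF y] by (intro mult_left_mono) auto
    finally have 1: "norm (FD f y v - FD f a v) \<le> norm v * (1 / (2 * K))" .
    have "norm v \<le> norm (FD f a v) * K" using K(2)[of "FD f a v"] inv by simp
    then have "norm v / K \<le> norm (FD f a v)" using K(1) by (simp add: field_simps)
    also have "\<dots> \<le> norm (FD f y v) + norm (FD f y v - FD f a v)"
      using norm_triangle_ineq2[of "FD f a v" "FD f y v"] by (simp add: norm_minus_commute)
    finally show ?thesis using 1 K(1) by (simp add: field_simps)
  qed
  have upper: "norm (FD (\<lambda>z. FD f z v) y v) \<le> (norm v)\<^sup>2 * C" if y: "y \<in> ball a d" for y v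
  proof -
    have yS: "y \<in> S" using d(2)[OF y] by simp
    have "FD (\<lambda>z. FD f z v) y = FD (\<lambda>z. \<Sum>b\<in>onb. (v \<bullet> b) *\<^sub>R FD f z b) y"
      by (rule FD_cong_open[OF S yS]) (rule linear_onb_expand[OF has_derivative_linear[OF Df]])
    also have "\<dots> = (\<lambda>w. \<Sum>b\<in>onb. (v \<bullet> b) *\<^sub>R FD (\<lambda>z. FD f z b) y w)"
      by (rule FD_eq) (intro has_derivative_sum has_derivative_scaleR_right D2f yS)
    finally have "FD (\<lambda>z. FD f z v) y v = (\<Sum>b\<in>onb. (v \<bullet> b) *\<^sub>R FD (\<lambda>z. FD f z b) y v)" by simp
    also have "\<dots> = (\<Sum>b\<in>onb. (v \<bullet> b) *\<^sub>R (\<Sum>b'\<in>onb. (v \<bullet> b') *\<^sub>R FD (\<lambda>z. FD f z b) y b'))"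
      by (intro sum.cong refl arg_cong2[where f=scaleR] linear_onb_expand[OF has_derivative_linear[OF D2f[OF yS]]])
    finally have "norm (FD (\<lambda>z. FD f z v) y v) \<le> (\<Sum>b\<in>onb. norm v * (\<Sum>b'\<in>onb. norm v * norm (FD (\<lambda>z. FD f z b) y b')))"
      by (simp only:) (auto intro!: order_trans[OF norm_sum] sum_mono mult_mono nb sum_nonneg)
    also have "\<dots> = (norm v)\<^sup>2 * s2 y" by (simp add: s2_def sum_distrib_left power2_eq_square mult.assoc)
    also have "\<dots> \<le> (norm v)\<^sup>2 * C" using d(2)[OF y] by (intro mult_left_mono) auto
    finally show ?thesis .
  qed
  have conv: "convex {y \<in> ball a d. norm (f y - f a) < r}" for r
  proof (rule convexI)
    fix y y' :: 'e and u u' :: real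
    assume y: "y \<in> {y \<in> ball a d. norm (f y - f a) < r}" "y' \<in> {y \<in> ball a d. norm (f y - f a) < r}"
      and u: "0 \<le> u" "0 \<le> u'" "u + u' = 1"
    let ?w = "y' - y" and ?l = "\<lambda>s. y + s *\<^sub>R (y' - y)"
    have l: "?l s \<in> ball a d" if "s \<in> {0..1}" for s
      using segment_in_convex[OF convex_ball, of y a d y' s] y that by auto
    have lS: "?l s \<in> S" if "s \<in> {0..1}" for s using d(2)[OF l[OF that]] by simp
    \<comment> \<open>The squared distance along the segment. Its second derivative is twice the
      square of the first derivative of \<open>f\<close> plus twice the term that gets
      absorbed.\<close>
    define \<phi> where "\<phi> s = (f (?l s) - f a) \<bullet> (f (?l s) - f a)" for s
    define \<phi>' where "\<phi>' s = 2 * ((f (?l s) - f a) \<bullet> FD f (?l s) ?w)" for s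
    define \<phi>'' where "\<phi>'' s = 2 * (FD f (?l s) ?w \<bullet> FD f (?l s) ?w + (f (?l s) - f a) \<bullet> FD (\<lambda>z. FD f z ?w) (?l s) ?w)" for s
    have dl: "(?l has_derivative (\<lambda>r. r *\<^sub>R ?w)) (at s)" for s by (auto intro!: derivative_eq_intros)
    have e1: "((\<lambda>s. f (?l s) - f a) has_derivative (\<lambda>r. r *\<^sub>R FD f (?l s) ?w)) (at s)" if "s \<in> {0..1}" for s
      using has_derivative_diff[OF has_derivative_compose[OF dl Df[OF lS[OF that]]] has_derivative_const]
      by (simp add: linear_scale[OF has_derivative_linear[OF Df[OF lS[OF that]]]])
    have e2: "((\<lambda>s. FD f (?l s) ?w) has_derivative (\<lambda>r. r *\<^sub>R FD (\<lambda>z. FD f z ?w) (?l s) ?w)) (at s)" if "s \<in> {0..1}" for s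
      using has_derivative_compose[where f="?l" and g="\<lambda>z. FD f z ?w", OF dl D2f[OF lS[OF that]]]
      by (simp add: linear_scale[OF has_derivative_linear[OF D2f[OF lS[OF that]]]])
    have "convex_on {0..1} \<phi>"
    proof (rule f''_ge0_imp_convex)
      fix s :: real assume s: "s \<in> {0..1}"
      show "(\<phi> has_real_derivative \<phi>' s) (at s)"
      proof -
        have "(\<phi> has_derivative (\<lambda>r. (f (?l s) - f a) \<bullet> (r *\<^sub>R FD f (?l s) ?w) + (r *\<^sub>R FD f (?l s) ?w) \<bullet> (f (?l s) - f a))) (at s)"
          unfolding \<phi>_def by (rule has_derivative_inner[OF e1[OF s] e1[OF s]])
        moreover have "(\<lambda>r. (f (?l s) - f a) \<bullet> (r *\<^sub>R FD f (?l s) ?w) + (r *\<^sub>R FD f (?l s) ?w) \<bullet> (f (?l s) - f a)) = (*) (\<phi>' s)"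
          by (rule ext) (simp add: \<phi>'_def inner_commute[of "FD f (?l s) ?w"])
        ultimately show ?thesis by (simp add: has_field_derivative_def)
      qed
      have "(\<phi>' has_derivative (\<lambda>r. 2 * ((f (?l s) - f a) \<bullet> (r *\<^sub>R FD (\<lambda>z. FD f z ?w) (?l s) ?w) + (r *\<^sub>R FD f (?l s) ?w) \<bullet> FD f (?l s) ?w))) (at s)"
        unfolding \<phi>'_def by (rule has_derivative_mult_right[OF has_derivative_inner[OF e1[OF s] e2[OF s]]])
      moreover have "(\<lambda>r. 2 * ((f (?l s) - f a) \<bullet> (r *\<^sub>R FD (\<lambda>z. FD f z ?w) (?l s) ?w) + (r *\<^sub>R FD f (?l s) ?w) \<bullet> FD f (?l s) ?w)) = (*) (\<phi>'' s)"
        by (rule ext) (simp add: \<phi>''_def distrib_left distrib_right mult_ac)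
      ultimately show "(\<phi>' has_real_derivative \<phi>'' s) (at s)" by (simp add: has_field_derivative_def)
      have "\<bar>(f (?l s) - f a) \<bullet> FD (\<lambda>z. FD f z ?w) (?l s) ?w\<bar> \<le> norm (f (?l s) - f a) * norm (FD (\<lambda>z. FD f z ?w) (?l s) ?w)"
        by (rule Cauchy_Schwarz_ineq2)
      also have "\<dots> \<le> 1 / (4 * K\<^sup>2 * C) * ((norm ?w)\<^sup>2 * C)"
        using d(2)[OF l[OF s]] upper[OF l[OF s], of ?w] C by (intro mult_mono) auto
      also have "\<dots> = (norm ?w / (2 * K))\<^sup>2" using C K(1) by (simp add: power_divide power_mult_distrib)
      also have "\<dots> \<le> (norm (FD f (?l s) ?w))\<^sup>2" using lower[OF l[OF s], of ?w] K(1) by (intro power_mono) auto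
      also have "\<dots> = FD f (?l s) ?w \<bullet> FD f (?l s) ?w" by (simp add: power2_norm_eq_inner)
      finally show "0 \<le> \<phi>'' s" by (simp add: \<phi>''_def)
    qed simp
    then have "\<phi> ((1 - u') *\<^sub>R 0 + u' *\<^sub>R 1) \<le> (1 - u') * \<phi> 0 + u' * \<phi> 1"
      using u by (intro convex_onD) auto
    also have "\<dots> < r\<^sup>2"
    proof -
      have "\<phi> 0 < r\<^sup>2" "\<phi> 1 < r\<^sup>2"
        using y unfolding \<phi>_def power2_norm_eq_inner[symmetric] by (auto intro!: power_strict_mono)
      then show ?thesis using u convex_bound_lt[of "\<phi> 0" "r\<^sup>2" "\<phi> 1" "1 - u'" u'] by simp
    qed
    finally have "(norm (f (?l u') - f a))\<^sup>2 < r\<^sup>2" by (simp add: \<phi>_def power2_norm_eq_inner)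
    moreover have "0 \<le> r" using y(1) norm_ge_zero[of "f y - f a"] by (simp del: norm_ge_zero)
    ultimately have "norm (f (?l u') - f a) < r" by (rule power2_less_imp_less)
    moreover have "u *\<^sub>R y + u' *\<^sub>R y' = ?l u'"
    proof -
      have "u = 1 - u'" using u by simp
      then have "u *\<^sub>R y = y - u' *\<^sub>R y" by (simp only: scaleR_left_diff_distrib scaleR_one)
      then show ?thesis by (simp add: scaleR_right_diff_distrib)
    qed
    ultimately show "u *\<^sub>R y + u' *\<^sub>R y' \<in> {y \<in> ball a d. norm (f y - f a) < r}"
      using l[of u'] u by auto
  qed
  \<comment> \<open>On a small ball \<open>g\<close> stays inside \<open>ball a d\<close>, so the
    image of the ball is exactly a sublevel set within \<open>ball a d\<close>.\<close>
  have "open (T \<inter> g -` ball a d)"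
    using Cinf_on_continuous[OF g(1)] T by (intro continuous_open_preimage) auto
  moreover have "f a \<in> T \<inter> g -` ball a d" using fa gf[OF a] d(1) by simp
  ultimately obtain r0 where r0: "r0 > 0" "ball (f a) r0 \<subseteq> T \<inter> g -` ball a d"
    using open_contains_ball by blast
  show ?thesis
  proof (intro exI[of _ r0] conjI allI impI r0(1))
    fix r assume r: "0 < r" "r \<le> r0"
    then have sub: "ball (f a) r \<subseteq> T \<inter> g -` ball a d" using r0(2) subset_ball[of r r0 "f a"] by blast
    then show "ball (f a) r \<subseteq> T" by blast
    have "g ` ball (f a) r = {y \<in> ball a d. norm (f y - f a) < r}"
    proof (intro equalityI subsetI)
      fix y assume "y \<in> g ` ball (f a) r"
      then obtain w where w: "w \<in> ball (f a) r" "y = g w" by blast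
      then have "w \<in> T" "g w \<in> ball a d" using sub by auto
      then show "y \<in> {y \<in> ball a d. norm (f y - f a) < r}"
        using w fg[of w] by (simp add: dist_norm norm_minus_commute)
    next
      fix y assume "y \<in> {y \<in> ball a d. norm (f y - f a) < r}"
      then have "y \<in> S" "f y \<in> ball (f a) r" using d(2)[of y] by (auto simp: dist_norm norm_minus_commute)
      then show "y \<in> g ` ball (f a) r" using gf[of y] by (metis imageI)
    qed
    then show "convex (g ` ball (f a) r)" using conv by simp
  qed
qed

section \<open>Linear systems with finite rows\<close>

definition fscale :: "real \<Rightarrow> ('t \<Rightarrow> real) \<Rightarrow> 't \<Rightarrow> real" where
  "fscale r f = (\<lambda>t. r * f t)"

lemma vector_space_fscale: "vector_space fscale"
  by unfold_locales (auto simp: fscale_def algebra_simps plus_fun_def)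

text \<open>The rows are vectors in the space of functions on the unknowns. Prescribing a linear functional on a
  maximal independent set of rows and extending it by zero to a basis gives a solution whose value at
  an unknown involves only the finitely many rows occurring in the expansion of that unknown.\<close>

lemma finite_row_system_solution:
  fixes a :: "'j \<Rightarrow> 'i \<Rightarrow> real" and \<tau> :: "'j \<Rightarrow> 'i \<Rightarrow> 't" and c :: "'x \<Rightarrow> 'j \<Rightarrow> real"
  assumes fin: "\<And>J. J \<in> N \<Longrightarrow> finite (I J)"
    and sol: "\<And>x. x \<in> P \<Longrightarrow> \<exists>b. \<forall>J\<in>N. (\<Sum>i\<in>I J. a J i * b (\<tau> J i)) = c x J"
  shows "\<exists>Q S. (\<forall>t. finite (S t) \<and> S t \<subseteq> N) \<and>
    (\<forall>x\<in>P. \<forall>J\<in>N. (\<Sum>i\<in>I J. a J i * (\<Sum>K\<in>S (\<tau> J i). Q (\<tau> J i) K * c x K)) = c x J)"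
proof -
  interpret V: vector_space "fscale :: real \<Rightarrow> ('t \<Rightarrow> real) \<Rightarrow> 't \<Rightarrow> real"
    by (rule vector_space_fscale)
  interpret VR: vector_space_pair "fscale :: real \<Rightarrow> ('t \<Rightarrow> real) \<Rightarrow> 't \<Rightarrow> real" "(*) :: real \<Rightarrow> real \<Rightarrow> real"
    by unfold_locales (auto simp: algebra_simps)
  \<comment> \<open>These unit vectors span only the functions of finite support, but all rows lie
    there.\<close>
  define e :: "'t \<Rightarrow> 't \<Rightarrow> real" where "e t = (\<lambda>s. if s = t then 1 else 0)" for t
  have inj: "inj e"
  proof (rule injI)
    fix s t assume "e s = e t"
    then have "e s s = e t s" by simp
    then show "s = t" by (simp add: e_def split: if_splits)
  qed
  have sum_app: "(\<Sum>v\<in>A. F v) t = (\<Sum>v\<in>A. F v t)" for A and F :: "'z \<Rightarrow> 't \<Rightarrow> real" and t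
    by (induction A rule: infinite_finite_induct) (auto simp: plus_fun_def zero_fun_def)
  have indep: "V.independent (range e)"
    unfolding V.independent_explicit_finite_subsets
  proof (intro allI impI ballI)
    fix S u v assume S: "S \<subseteq> range e" "finite S" "(\<Sum>v\<in>S. fscale (u v) v) = 0" "v \<in> S"
    obtain t where t: "v = e t" using S by auto
    have "0 = (\<Sum>w\<in>S. fscale (u w) w) t" using S(3) by (simp only: zero_fun_def)
    also have "\<dots> = (\<Sum>w\<in>S. u w * w t)" by (simp only: sum_app fscale_def)
    also have "\<dots> = (\<Sum>w\<in>S. if w = v then u v else 0)"
    proof (rule sum.cong[OF refl])
      fix w assume "w \<in> S"
      then obtain s where "w = e s" using S(1) by auto
      then show "u w * w t = (if w = v then u v else 0)"
        using t inj_eq[OF inj, of s t] by (auto simp: e_def)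
    qed
    also have "\<dots> = u v" using S by simp
    finally show "u v = 0" by simp
  qed
  define w where "w J = (\<Sum>i\<in>I J. fscale (a J i) (e (\<tau> J i)))" for J
  \<comment> \<open>\<open>B\<close> is a basis of the row space made of rows, so the values
    prescribed on it are themselves right-hand sides. Its choice does not involve
    \<open>x\<close>.\<close>
  obtain B where B: "B \<subseteq> w ` N" "V.independent B" "w ` N \<subseteq> V.span B"
    using V.maximal_independent_subset[of "w ` N"] by blast
  obtain pick where pick: "\<And>v. v \<in> B \<Longrightarrow> pick v \<in> N \<and> w (pick v) = v"
  proof -
    have "\<forall>v\<in>B. \<exists>J. J \<in> N \<and> w J = v" using B(1) by auto
    then show ?thesis using that bchoice[of B "\<lambda>v J. J \<in> N \<and> w J = v"] by blast
  qed
  define \<beta> where "\<beta> x = VR.construct B (\<lambda>v. c x (pick v))" for x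
  have lin: "Vector_Spaces.linear fscale (*) (\<beta> x)" for x unfolding \<beta>_def by (rule VR.linear_construct[OF B(2)])
  have lin_w: "f (w J) = (\<Sum>i\<in>I J. a J i * f (e (\<tau> J i)))" if "Vector_Spaces.linear fscale (*) f" for f J
    unfolding w_def by (simp add: VR.linear_sum[OF that] VR.linear_scale[OF that])
  have key: "(\<Sum>i\<in>I J. a J i * \<beta> x (e (\<tau> J i))) = c x J" if x: "x \<in> P" and J: "J \<in> N" for x J
  proof -
    obtain b where b: "\<And>J. J \<in> N \<Longrightarrow> (\<Sum>i\<in>I J. a J i * b (\<tau> J i)) = c x J" using sol[OF x] by blast
    define b' where "b' = VR.construct (range e) (\<lambda>v. b (inv e v))"
    have lin': "Vector_Spaces.linear fscale (*) b'" unfolding b'_def by (rule VR.linear_construct[OF indep])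
    have b'e: "b' (e t) = b t" for t
      unfolding b'_def using VR.construct_basis[OF indep, of "e t"] by (simp add: inv_f_f[OF inj])
    have b'w: "b' (w J) = c x J" if "J \<in> N" for J
      using b[OF that] by (simp add: lin_w[OF lin'] b'e)
    \<comment> \<open>The solution given for this \<open>x\<close> defines a functional
      \<open>b'\<close> that agrees with \<open>\<beta> x\<close> on \<open>B\<close>, hence on
      every row. Solvability thus guarantees that the equations outside \<open>B\<close> are
      consistent with those in \<open>B\<close>.\<close>
    have "\<beta> x (w J) = b' (w J)"
    proof (rule VR.linear_eq_on[OF lin lin'])
      show "w J \<in> V.span B" using B(3) J by auto
      fix v assume "v \<in> B"
      then show "\<beta> x v = b' v"
        using VR.construct_basis[OF B(2), of v] b'w[of "pick v"] pick[of v] by (simp add: \<beta>_def)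
    qed
    then show ?thesis using lin_w[OF lin] b'w[OF J] by simp
  qed
  \<comment> \<open>\<open>VR.construct\<close> extends by zero from \<open>B\<close> to the full
    basis, so of the finite expansion of \<open>e t\<close> only the members of \<open>B\<close>
    count.\<close>
  define R where "R t = {v. V.representation (V.extend_basis B) (e t) v \<noteq> 0} \<inter> B" for t
  have finR: "finite (R t)" for t unfolding R_def using V.finite_representation by auto
  have injp: "inj_on pick B" by (metis inj_onI pick)
  have \<beta>e: "\<beta> x (e t) = (\<Sum>K\<in>pick ` R t. V.representation (V.extend_basis B) (e t) (w K) * c x K)" for x t
  proof -
    have "\<beta> x (e t) = (\<Sum>v\<in>R t. V.representation (V.extend_basis B) (e t) v * c x (pick v))"
      unfolding \<beta>_def VR.construct_def R_def
      by (rule sum.mono_neutral_cong_right) (use V.finite_representation in auto)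
    also have "\<dots> = (\<Sum>K\<in>pick ` R t. V.representation (V.extend_basis B) (e t) (w K) * c x K)"
      by (subst sum.reindex) (use injp pick in \<open>auto simp: R_def intro!: inj_on_subset[OF injp] sum.cong\<close>)
    finally show ?thesis .
  qed
  show ?thesis
    by (rule exI[of _ "\<lambda>t K. V.representation (V.extend_basis B) (e t) (w K)"], rule exI[of _ "\<lambda>t. pick ` R t"])
      (use key pick finR in \<open>auto simp: \<beta>e R_def\<close>)
qed

section \<open>Charts and smooth functions\<close>

abbreviation dm :: "('a, 'e) chart \<Rightarrow> 'a set" where "dm \<equiv> fst"
abbreviation ph :: "('a, 'e) chart \<Rightarrow> 'a \<Rightarrow> 'e" where "ph \<equiv> snd"
abbreviation iv :: "('a, 'e) chart \<Rightarrow> 'e \<Rightarrow> 'a" where "iv c \<equiv> inv_into (dm c) (ph c)"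

locale smooth_mfd =
  fixes X :: "'a topology" and A :: "('a, 'e::finite_dim_inner) chart set"
  assumes mfd: "smooth_manifold X A"
begin

lemma haus: "Hausdorff_space X" and sc: "second_countable X"
  using mfd by (auto simp: smooth_manifold_def)

lemma chart_open: "c \<in> A \<Longrightarrow> openin X (dm c)"
  and chart_image_open: "c \<in> A \<Longrightarrow> open (ph c ` dm c)"
  and chart_homeo: "c \<in> A \<Longrightarrow> homeomorphic_map (subtopology X (dm c)) (top_of_set (ph c ` dm c)) (ph c)"
  using mfd by (auto simp: smooth_manifold_def is_chart_def)

lemma chart_sub: "c \<in> A \<Longrightarrow> dm c \<subseteq> topspace X"
  using chart_open openin_subset by blast

lemma chart_cover: "p \<in> topspace X \<Longrightarrow> \<exists>c\<in>A. p \<in> dm c"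
proof -
  assume "p \<in> topspace X"
  then have "p \<in> (\<Union>(U, \<phi>)\<in>A. U)" using mfd by (auto simp: smooth_manifold_def)
  then obtain U \<phi> where "(U, \<phi>) \<in> A" "p \<in> U" by auto
  then show ?thesis by (intro bexI[of _ "(U, \<phi>)"]) auto
qed

lemma chart_transition: "c \<in> A \<Longrightarrow> c' \<in> A \<Longrightarrow> Cinf_on (ph c ` (dm c \<inter> dm c')) (\<lambda>y. ph c' (iv c y))"
proof -
  assume "c \<in> A" "c' \<in> A"
  then have "Cinf_on (ph c ` (dm c \<inter> dm c')) (ph c' \<circ> iv c)"
    using mfd unfolding smooth_manifold_def by (cases c, cases c') auto
  then show ?thesis by (simp add: o_def)
qed

lemma chart_inj: "c \<in> A \<Longrightarrow> inj_on (ph c) (dm c)"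
  using homeomorphic_imp_injective_map[OF chart_homeo, of c] chart_sub[of c]
  by (simp add: topspace_subtopology Int_absorb1)

lemma iv_ph [simp]: "c \<in> A \<Longrightarrow> p \<in> dm c \<Longrightarrow> iv c (ph c p) = p"
  by (simp add: chart_inj)

lemma ph_iv: "y \<in> ph c ` dm c \<Longrightarrow> ph c (iv c y) = y"
  by (simp add: f_inv_into_f)

lemma iv_in: "y \<in> ph c ` dm c \<Longrightarrow> iv c y \<in> dm c"
  by (simp add: inv_into_into)

lemma iv_in_sub: "c \<in> A \<Longrightarrow> W \<subseteq> dm c \<Longrightarrow> y \<in> ph c ` W \<Longrightarrow> iv c y \<in> W"
  by auto

lemma chart_open_image: "c \<in> A \<Longrightarrow> openin X W \<Longrightarrow> W \<subseteq> dm c \<Longrightarrow> open (ph c ` W)"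
proof -
  assume a: "c \<in> A" "openin X W" "W \<subseteq> dm c"
  have "openin (subtopology X (dm c)) W" using a by (simp add: openin_subset_topspace_eq openin_subtopology) blast
  then have "openin (top_of_set (ph c ` dm c)) (ph c ` W)"
    using homeomorphic_imp_open_map[OF chart_homeo[OF a(1)]] by (simp add: open_map_def)
  then show ?thesis using chart_image_open[OF a(1)] openin_open_trans by blast
qed

lemma chart_open_image_Int: "c \<in> A \<Longrightarrow> openin X W \<Longrightarrow> open (ph c ` (dm c \<inter> W))"
  by (intro chart_open_image openin_Int chart_open) auto

lemma chart_openin_vimage: "c \<in> A \<Longrightarrow> open S \<Longrightarrow> openin X {p \<in> dm c. ph c p \<in> S}"
proof -
  assume a: "c \<in> A" "open S"
  have "continuous_map (subtopology X (dm c)) (top_of_set (ph c ` dm c)) (ph c)"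
    using homeomorphic_imp_continuous_map[OF chart_homeo[OF a(1)]] .
  then have "continuous_map (subtopology X (dm c)) euclidean (ph c)"
    by (simp add: continuous_map_in_subtopology)
  then have "openin (subtopology X (dm c)) {p \<in> topspace (subtopology X (dm c)). ph c p \<in> S}"
    by (rule openin_continuous_map_preimage) (simp add: a(2))
  then show ?thesis
    using openin_trans_full[OF _ chart_open[OF a(1)]] chart_sub[OF a(1)]
    by (simp add: topspace_subtopology Int_absorb1)
qed

lemma chart_iv_continuous: "c \<in> A \<Longrightarrow> continuous_map (top_of_set (ph c ` dm c)) X (iv c)"
proof -
  assume a: "c \<in> A"
  show ?thesis
    unfolding continuous_map_def
  proof (intro conjI funcsetI allI impI)
    fix y assume "y \<in> topspace (top_of_set (ph c ` dm c))"
    then show "iv c y \<in> topspace X" using iv_in[of y c] chart_sub[OF a] by auto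
  next
    fix U assume U: "openin X U"
    have "{y \<in> topspace (top_of_set (ph c ` dm c)). iv c y \<in> U} = ph c ` (dm c \<inter> U)"
    proof (intro equalityI subsetI)
      fix y assume "y \<in> {y \<in> topspace (top_of_set (ph c ` dm c)). iv c y \<in> U}"
      then have "y \<in> ph c ` dm c" "iv c y \<in> U" by auto
      then show "y \<in> ph c ` (dm c \<inter> U)" using ph_iv[of y c] iv_in[of y c] by (metis IntI imageI)
    next
      fix y assume "y \<in> ph c ` (dm c \<inter> U)"
      then show "y \<in> {y \<in> topspace (top_of_set (ph c ` dm c)). iv c y \<in> U}" using a by auto
    qed
    then show "openin (top_of_set (ph c ` dm c)) {y \<in> topspace (top_of_set (ph c ` dm c)). iv c y \<in> U}"
      using chart_open_image_Int[OF a U] by (auto intro: open_subset)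
  qed
qed

section \<open>Smooth functions on open subsets of the manifold\<close>

definition smooth_on :: "'a set \<Rightarrow> ('a \<Rightarrow> real) \<Rightarrow> bool" where
  "smooth_on W f \<longleftrightarrow> (\<forall>c\<in>A. Cinf_on (ph c ` (dm c \<inter> W)) (\<lambda>y. f (iv c y)))"

lemma smooth_fun_iff: "smooth_fun A f \<longleftrightarrow> smooth_on (topspace X) f"
  using chart_sub unfolding smooth_fun_def smooth_on_def
  by (auto simp: o_def Int_absorb2)

lemma smooth_on_subset: "smooth_on W f \<Longrightarrow> V \<subseteq> W \<Longrightarrow> smooth_on V f"
  unfolding smooth_on_def by (meson Cinf_on_subset Int_mono image_mono order_refl)

lemma smooth_onD:
  "smooth_on W f \<Longrightarrow> c \<in> A \<Longrightarrow> V \<subseteq> dm c \<Longrightarrow> V \<subseteq> W \<Longrightarrow> Cinf_on (ph c ` V) (\<lambda>y. f (iv c y))"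
  unfolding smooth_on_def by (meson Cinf_on_subset Int_greatest image_mono)

lemma transition_open_compose:
  assumes c: "c \<in> A" "c' \<in> A" and V: "openin X V" "V \<subseteq> dm c" "V \<subseteq> dm c'"
    and f: "Cinf_on (ph c ` V) f"
  shows "Cinf_on (ph c' ` V) (\<lambda>y. f (ph c (iv c' y)))"
proof (rule Cinf_on_compose[OF f])
  show "Cinf_on (ph c' ` V) (\<lambda>y. ph c (iv c' y))"
    by (rule Cinf_on_subset[OF chart_transition[OF c(2,1)]]) (use V in auto)
  show "open (ph c' ` V)" by (rule chart_open_image[OF c(2) V(1,3)])
  show "(\<lambda>y. ph c (iv c' y)) ` ph c' ` V \<subseteq> ph c ` V" using c V by auto
qed

text \<open>Transition maps carry smoothness from one chart around a point to every other chart
  there.\<close>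

lemma smooth_onI:
  assumes W: "openin X W" and
    loc: "\<And>p. p \<in> W \<Longrightarrow> \<exists>c\<in>A. \<exists>V. openin X V \<and> p \<in> V \<and> V \<subseteq> W \<and> V \<subseteq> dm c \<and> Cinf_on (ph c ` V) (\<lambda>y. f (iv c y))"
  shows "smooth_on W f"
  unfolding smooth_on_def
proof
  fix c' assume c': "c' \<in> A"
  show "Cinf_on (ph c' ` (dm c' \<inter> W)) (\<lambda>y. f (iv c' y))"
  proof (rule Cinf_on_local[OF _ chart_open_image_Int[OF c' W]])
    fix y assume "y \<in> ph c' ` (dm c' \<inter> W)"
    then obtain p where p: "p \<in> dm c'" "p \<in> W" "y = ph c' p" by auto
    obtain c V where V: "c \<in> A" "openin X V" "p \<in> V" "V \<subseteq> W" "V \<subseteq> dm c" "Cinf_on (ph c ` V) (\<lambda>y. f (iv c y))"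
      using loc[OF p(2)] by blast
    let ?V = "V \<inter> dm c'"
    have o: "openin X ?V" using V(2) chart_open[OF c'] by auto
    have f: "Cinf_on (ph c ` ?V) (\<lambda>y. f (iv c y))" by (rule Cinf_on_subset[OF V(6)]) auto
    have "Cinf_on (ph c' ` ?V) (\<lambda>y. f (iv c (ph c (iv c' y))))"
      by (rule transition_open_compose[OF V(1) c' o _ _ f]) (use V in auto)
    moreover have "open (ph c' ` ?V)" by (rule chart_open_image[OF c' o]) auto
    moreover have "f (iv c' y) = f (iv c (ph c (iv c' y)))" if "y \<in> ph c' ` ?V" for y
      using that V c' by (auto simp: subset_iff)
    ultimately have "Cinf_on (ph c' ` ?V) (\<lambda>y. f (iv c' y))"
      by (rule Cinf_on_congI)
    then show "\<exists>T. open T \<and> y \<in> T \<and> Cinf_on (T \<inter> ph c' ` (dm c' \<inter> W)) (\<lambda>y. f (iv c' y))"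
      using \<open>open (ph c' ` ?V)\<close> p V(3) by (intro exI[of _ "ph c' ` ?V"]) (auto intro: Cinf_on_subset)
  qed
qed

lemma smooth_on_local:
  assumes W: "openin X W" and loc: "\<And>p. p \<in> W \<Longrightarrow> \<exists>V. openin X V \<and> p \<in> V \<and> smooth_on V f"
  shows "smooth_on W f"
proof (rule smooth_onI[OF W])
  fix p assume p: "p \<in> W"
  then obtain V where V: "openin X V" "p \<in> V" "smooth_on V f" using loc by blast
  have "p \<in> topspace X" using p W openin_subset by blast
  then obtain c where c: "c \<in> A" "p \<in> dm c" using chart_cover by blast
  show "\<exists>c\<in>A. \<exists>V. openin X V \<and> p \<in> V \<and> V \<subseteq> W \<and> V \<subseteq> dm c \<and> Cinf_on (ph c ` V) (\<lambda>y. f (iv c y))"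
    using c p V W chart_open[OF c(1)]
    by (intro bexI[OF _ c(1)] exI[of _ "V \<inter> W \<inter> dm c"] conjI openin_Int smooth_onD[OF V(3)]) auto
qed

lemma smooth_on_cong:
  assumes "openin X W" "\<And>p. p \<in> W \<Longrightarrow> f p = g p"
  shows "smooth_on W f \<longleftrightarrow> smooth_on W g"
proof -
  have "Cinf_on (ph c ` (dm c \<inter> W)) (\<lambda>y. f (iv c y)) \<longleftrightarrow> Cinf_on (ph c ` (dm c \<inter> W)) (\<lambda>y. g (iv c y))" if "c \<in> A" for c
    by (rule Cinf_on_cong[OF chart_open_image_Int[OF that assms(1)]]) (use assms that in auto)
  then show ?thesis by (simp add: smooth_on_def)
qed

lemma smooth_on_const: "smooth_on W (\<lambda>_. r)"
  by (simp add: smooth_on_def Cinf_on_const)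

lemma smooth_on_add: "openin X W \<Longrightarrow> smooth_on W f \<Longrightarrow> smooth_on W g \<Longrightarrow> smooth_on W (\<lambda>p. f p + g p)"
  unfolding smooth_on_def by (intro ballI Cinf_on_add chart_open_image_Int) auto

lemma smooth_on_diff: "openin X W \<Longrightarrow> smooth_on W f \<Longrightarrow> smooth_on W g \<Longrightarrow> smooth_on W (\<lambda>p. f p - g p)"
  unfolding smooth_on_def by (intro ballI Cinf_on_diff chart_open_image_Int) auto

lemma smooth_on_mult: "openin X W \<Longrightarrow> smooth_on W f \<Longrightarrow> smooth_on W g \<Longrightarrow> smooth_on W (\<lambda>p. f p * g p)"
  unfolding smooth_on_def by (intro ballI Cinf_on_mult chart_open_image_Int) auto

lemma smooth_on_divide:
  "openin X W \<Longrightarrow> smooth_on W f \<Longrightarrow> smooth_on W g \<Longrightarrow> (\<And>p. p \<in> W \<Longrightarrow> g p \<noteq> 0) \<Longrightarrow> smooth_on W (\<lambda>p. f p / g p)"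
  unfolding smooth_on_def
proof (intro ballI Cinf_on_divide chart_open_image_Int)
  fix c y
  assume "\<And>p. p \<in> W \<Longrightarrow> g p \<noteq> 0" "c \<in> A" "y \<in> ph c ` (dm c \<inter> W)"
  then show "g (iv c y) \<noteq> 0" using iv_in_sub[of c "dm c \<inter> W" y] by blast
qed auto

lemma smooth_on_flat: "openin X W \<Longrightarrow> smooth_on W f \<Longrightarrow> smooth_on W (\<lambda>p. flat n (f p))"
  unfolding smooth_on_def by (intro ballI Cinf_on_flat_comp chart_open_image_Int) auto

lemma smooth_on_sum:
  "openin X W \<Longrightarrow> (\<And>i. i \<in> I \<Longrightarrow> smooth_on W (f i)) \<Longrightarrow> smooth_on W (\<lambda>p. \<Sum>i\<in>I. f i p)"
  unfolding smooth_on_def by (intro ballI Cinf_on_sum chart_open_image_Int) auto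

lemma smooth_on_prod:
  "openin X W \<Longrightarrow> (\<And>i. i \<in> I \<Longrightarrow> smooth_on W (f i)) \<Longrightarrow> smooth_on W (\<lambda>p. \<Prod>i\<in>I. f i p)"
  unfolding smooth_on_def by (intro ballI Cinf_on_prod chart_open_image_Int) auto

lemma smooth_on_chart_comp:
  assumes c: "c \<in> A" and W: "openin X W" "W \<subseteq> dm c" and h: "Cinf_on (ph c ` W) h"
  shows "smooth_on W (\<lambda>p. h (ph c p))"
proof (rule smooth_onI[OF W(1)])
  fix p assume "p \<in> W"
  have "Cinf_on (ph c ` W) (\<lambda>y. h (ph c (iv c y)))"
    using h W by (subst Cinf_on_cong[OF chart_open_image[OF c W], of _ h]) (auto intro: arg_cong[of _ _ h] ph_iv)
  then show "\<exists>c'\<in>A. \<exists>V. openin X V \<and> p \<in> V \<and> V \<subseteq> W \<and> V \<subseteq> dm c' \<and> Cinf_on (ph c' ` V) (\<lambda>y. h (ph c (iv c' y)))"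
    using c W \<open>p \<in> W\<close> by blast
qed

lemma smooth_on_open_preimage:
  assumes f: "smooth_on W f" and W: "openin X W" and S: "open S"
  shows "openin X {p \<in> W. f p \<in> S}"
proof (subst openin_subopen, intro ballI)
  fix p assume p: "p \<in> {p \<in> W. f p \<in> S}"
  then have "p \<in> topspace X" using W openin_subset by blast
  then obtain c where c: "c \<in> A" "p \<in> dm c" using chart_cover by blast
  let ?S = "ph c ` (dm c \<inter> W)"
  have "open (?S \<inter> (\<lambda>y. f (iv c y)) -` S)"
    using Cinf_on_continuous[of ?S "\<lambda>y. f (iv c y)"] f c(1) chart_open_image_Int[OF c(1) W] S
    by (intro continuous_open_preimage) (auto simp: smooth_on_def)
  then have o: "openin X {q \<in> dm c. ph c q \<in> ?S \<inter> (\<lambda>y. f (iv c y)) -` S}"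
    by (rule chart_openin_vimage[OF c(1)])
  have "{q \<in> dm c. ph c q \<in> ?S \<inter> (\<lambda>y. f (iv c y)) -` S} \<subseteq> {p \<in> W. f p \<in> S}"
    using c(1) chart_inj[OF c(1)] by (auto simp: inj_on_def)
  then show "\<exists>T. openin X T \<and> p \<in> T \<and> T \<subseteq> {p \<in> W. f p \<in> S}"
    using o c p by (intro exI[of _ "{q \<in> dm c. ph c q \<in> ?S \<inter> (\<lambda>y. f (iv c y)) -` S}"]) auto
qed

section \<open>Global smooth functions, bump functions and cutoffs\<close>

abbreviation SF where "SF \<equiv> smooth_functions X A"

lemma SF_iff: "f \<in> SF \<longleftrightarrow> smooth_on (topspace X) f \<and> (\<forall>p. p \<notin> topspace X \<longrightarrow> f p = 0)"
  by (simp add: smooth_functions_def smooth_fun_iff)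

lemma SF_lin: "f \<in> SF \<Longrightarrow> g \<in> SF \<Longrightarrow> (\<lambda>q. a * f q + b * g q) \<in> SF"
  unfolding SF_iff by (auto intro!: smooth_on_add smooth_on_mult smooth_on_const)

lemma SF_mult: "f \<in> SF \<Longrightarrow> g \<in> SF \<Longrightarrow> (\<lambda>q. f q * g q) \<in> SF"
  unfolding SF_iff by (auto intro!: smooth_on_mult)

text \<open>The product is smooth on the two open sets \<open>N\<close> and the complement of
  \<open>K\<close>, which cover the space. This turns functions defined near a point into elements
  of \<open>SF\<close>.\<close>

lemma SF_extend:
  assumes N: "openin X N" and K: "closedin X K" "K \<subseteq> N" and h: "smooth_on N h"
    and chi: "smooth_on N ch" "\<And>q. q \<notin> K \<Longrightarrow> ch q = 0"
  shows "(\<lambda>q. ch q * h q) \<in> SF"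
  unfolding SF_iff
proof (intro conjI allI impI)
  have Ks: "K \<subseteq> topspace X" using K(1) closedin_subset by blast
  show "ch q * h q = 0" if "q \<notin> topspace X" for q using that Ks chi(2)[of q] by auto
  show "smooth_on (topspace X) (\<lambda>q. ch q * h q)"
  proof (rule smooth_on_local)
    fix p assume p: "p \<in> topspace X"
    show "\<exists>V. openin X V \<and> p \<in> V \<and> smooth_on V (\<lambda>q. ch q * h q)"
    proof (cases "p \<in> N")
      case True
      then show ?thesis using N chi(1) h by (intro exI[of _ N]) (auto intro: smooth_on_mult)
    next
      case False
      have o: "openin X (topspace X - K)" using K(1) by blast
      have "smooth_on (topspace X - K) (\<lambda>q. ch q * h q) \<longleftrightarrow> smooth_on (topspace X - K) (\<lambda>q. 0)"
        by (rule smooth_on_cong[OF o]) (use chi in auto)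
      then show ?thesis using o p False K(2) smooth_on_const by (intro exI[of _ "topspace X - K"]) auto
    qed
  qed simp
qed

text \<open>A radial bump in a chart, extended by zero. The closed ball is compact, so its image in
  the manifold is compact, and the Hausdorff property makes that image closed, as the extension by
  zero requires.\<close>

lemma bump_exists:
  assumes N: "openin X N" and p: "p \<in> N"
  shows "\<exists>ch\<in>SF. (\<forall>q. 0 \<le> ch q) \<and> 0 < ch p \<and> (\<exists>K. closedin X K \<and> K \<subseteq> N \<and> (\<forall>q. q \<notin> K \<longrightarrow> ch q = 0))"
proof -
  have "p \<in> topspace X" using N p openin_subset by blast
  then obtain c where c: "c \<in> A" "p \<in> dm c" using chart_cover by blast
  have "open (ph c ` (dm c \<inter> N))" by (rule chart_open_image_Int[OF c(1) N])
  moreover have "ph c p \<in> ph c ` (dm c \<inter> N)" using c p by auto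
  ultimately obtain r where r: "r > 0" "cball (ph c p) r \<subseteq> ph c ` (dm c \<inter> N)"
    using open_contains_cball by metis
  define K where "K = iv c ` cball (ph c p) r"
  have KN: "K \<subseteq> dm c \<inter> N" using r(2) iv_in_sub[OF c(1), of "dm c \<inter> N"] by (auto simp: K_def)
  have "compactin (top_of_set (ph c ` dm c)) (cball (ph c p) r)"
    using r(2) compact_cball_finite_dim by (auto simp: compactin_subtopology compactin_euclidean_iff)
  then have "compactin X K" unfolding K_def by (rule image_compactin[OF _ chart_iv_continuous[OF c(1)]])
  then have Kc: "closedin X K" by (rule compactin_imp_closedin[OF haus])
  have Kiff: "q \<in> K \<longleftrightarrow> q \<in> dm c \<and> ph c q \<in> cball (ph c p) r" for q
  proof
    assume "q \<in> K"
    then obtain y where y: "y \<in> cball (ph c p) r" "q = iv c y" by (auto simp: K_def)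
    then have "y \<in> ph c ` dm c" using r(2) by auto
    then show "q \<in> dm c \<and> ph c q \<in> cball (ph c p) r" using y iv_in[of y c] ph_iv[of y c] by auto
  next
    assume "q \<in> dm c \<and> ph c q \<in> cball (ph c p) r"
    then show "q \<in> K" using c(1) by (metis K_def imageI iv_ph)
  qed
  define ch' where "ch' = (\<lambda>q. psi (r\<^sup>2 - (ph c q - ph c p) \<bullet> (ph c q - ph c p)))"
  define ch where "ch q = (if q \<in> K then ch' q else 0)" for q
  have sm: "smooth_on (dm c) ch'"
  proof -
    have "smooth_on (dm c) (\<lambda>q. (\<lambda>y. psi (r\<^sup>2 - (y - ph c p) \<bullet> (y - ph c p))) (ph c q))"
      by (rule smooth_on_chart_comp[OF c(1) chart_open[OF c(1)]]) (auto intro!: Cinf_intros chart_image_open c(1))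
    then show ?thesis by (simp add: ch'_def)
  qed
  \<comment> \<open>\<open>ch'\<close> already vanishes outside the ball, so \<open>ch\<close>
    coincides with it on the whole chart and is smooth there.\<close>
  have "ch q = ch' q" if "q \<in> dm c" for q
  proof -
    have "r\<^sup>2 \<le> (ph c q - ph c p) \<bullet> (ph c q - ph c p)" if "r < dist (ph c p) (ph c q)"
      using that r(1) power_mono[of r "norm (ph c q - ph c p)" 2]
      by (simp add: dist_norm norm_minus_commute power2_norm_eq_inner[symmetric])
    then show ?thesis using that by (auto simp: ch_def Kiff ch'_def not_le)
  qed
  then have sm': "smooth_on (dm c) ch" using sm smooth_on_cong[OF chart_open[OF c(1)], of ch ch'] by simp
  have "(\<lambda>q. ch q * 1) \<in> SF"
    by (rule SF_extend[OF chart_open[OF c(1)] Kc _ smooth_on_const sm']) (use KN in \<open>auto simp: ch_def\<close>)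
  then have "ch \<in> SF" by simp
  moreover have "0 < ch p" using r c by (simp add: ch_def Kiff ch'_def)
  moreover have "0 \<le> ch q" for q by (simp add: ch_def ch'_def)
  ultimately show ?thesis using Kc KN by (intro bexI[of _ ch]) (auto simp: ch_def)
qed

text \<open>From a bump \<open>b\<close>, the quotient \<open>ch\<close> is 1 where \<open>b\<close>
  exceeds half its value at \<open>p\<close> and 0 where \<open>b\<close> vanishes. The two summands
  of the denominator never vanish together, as \<open>b q > 0\<close> or
  \<open>b q < b p / 2\<close> always holds.\<close>

lemma cutoff_exists:
  assumes N: "openin X N" and p: "p \<in> N"
  shows "\<exists>ch\<in>SF. \<exists>W K. openin X W \<and> p \<in> W \<and> W \<subseteq> N \<and> (\<forall>q\<in>W. ch q = 1) \<and> closedin X K \<and> K \<subseteq> N \<and> (\<forall>q. q \<notin> K \<longrightarrow> ch q = 0)"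
proof -
  obtain b K where b: "b \<in> SF" "\<And>q. 0 \<le> b q" "0 < b p" "closedin X K" "K \<subseteq> N" "\<And>q. q \<notin> K \<Longrightarrow> b q = 0"
    using bump_exists[OF N p] by blast
  have bs: "smooth_on (topspace X) b" using b(1) by (simp add: SF_iff)
  define ch where "ch q = psi (b q) / (psi (b q) + psi (b p / 2 - b q))" for q
  define W where "W = {q \<in> topspace X. b q \<in> {b p / 2<..}}"
  have pos: "psi (b q) + psi (b p / 2 - b q) > 0" for q
  proof (cases "b q > 0")
    case True
    then show ?thesis by (intro add_pos_nonneg) auto
  next
    case False
    then show ?thesis using b(2)[of q] b(3) by (intro add_nonneg_pos) auto
  qed
  have W: "openin X W" unfolding W_def by (rule smooth_on_open_preimage[OF bs]) auto
  have K0: "ch q = 0" if "q \<notin> K" for q using b(6)[OF that] by (simp add: ch_def)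
  have W1: "ch q = 1" if "q \<in> W" for q
  proof -
    have "psi (b p / 2 - b q) = 0" using that by (simp add: W_def)
    moreover have "psi (b q) > 0" using that b(3) by (simp add: W_def)
    ultimately show ?thesis by (simp add: ch_def del: psi_eq_0_iff psi_pos_iff)
  qed
  have "smooth_on (topspace X) ch" unfolding ch_def
    using pos by (intro smooth_on_divide smooth_on_add smooth_on_flat smooth_on_diff smooth_on_const bs openin_topspace) (metis less_irrefl)
  moreover have "ch q = 0" if "q \<notin> topspace X" for q
    using that b(4) closedin_subset K0 by blast
  ultimately have "ch \<in> SF" by (simp add: SF_iff)
  moreover have "W \<subseteq> K" using K0 W1 by force
  moreover have "p \<in> W" using b(3) N p openin_subset by (auto simp: W_def)
  ultimately show ?thesis using W W1 K0 b(4,5) by blast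
qed

section \<open>Partitions of unity\<close>

text \<open>Local finiteness is forced by multiplying the \<open>i\<close>-th bump function of a countable family with
  functions that vanish where one of the earlier bump functions exceeds \<open>1 / Suc i\<close>.\<close>

lemma partition_of_unity:
  assumes ne: "topspace X \<noteq> {}" and N: "\<forall>p\<in>topspace X. openin X (N p) \<and> p \<in> N p"
  shows "\<exists>(\<rho> :: nat \<Rightarrow> 'a \<Rightarrow> real) s K. (\<forall>i. \<rho> i \<in> SF \<and> s i \<in> topspace X \<and> closedin X (K i) \<and> K i \<subseteq> N (s i) \<and>
      (\<forall>q. q \<notin> K i \<longrightarrow> \<rho> i q = 0)) \<and>
    (\<forall>p\<in>topspace X. \<exists>W. openin X W \<and> p \<in> W \<and> finite {i. K i \<inter> W \<noteq> {}}) \<and>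
    (\<forall>p\<in>topspace X. (\<Sum>i | \<rho> i p \<noteq> 0. \<rho> i p) = 1)"
proof -
  have "\<forall>p\<in>topspace X. \<exists>ch K. ch \<in> SF \<and> (\<forall>q. 0 \<le> ch q) \<and> 0 < ch p \<and> closedin X K \<and> K \<subseteq> N p \<and> (\<forall>q. q \<notin> K \<longrightarrow> ch q = 0)"
  proof
    fix p assume "p \<in> topspace X"
    then have "openin X (N p)" "p \<in> N p" using N by auto
    from bump_exists[OF this]
    show "\<exists>ch K. ch \<in> SF \<and> (\<forall>q. 0 \<le> ch q) \<and> 0 < ch p \<and> closedin X K \<and> K \<subseteq> N p \<and> (\<forall>q. q \<notin> K \<longrightarrow> ch q = 0)"
      by (elim bexE conjE exE) (intro exI conjI)
  qed
  then obtain ch L where ch: "\<And>p. p \<in> topspace X \<Longrightarrow> ch p \<in> SF \<and> (\<forall>q. 0 \<le> ch p q) \<and> 0 < ch p p \<and>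
      closedin X (L p) \<and> L p \<subseteq> N p \<and> (\<forall>q. q \<notin> L p \<longrightarrow> ch p q = 0)"
    by metis
  define V where "V p = {q \<in> topspace X. ch p q \<in> {0<..}}" for p
  have Vo: "openin X (V p)" if "p \<in> topspace X" for p
    unfolding V_def using ch[OF that] by (intro smooth_on_open_preimage) (auto simp: SF_iff)
  have "Lindelof_space X" by (rule second_countable_imp_Lindelof_space[OF sc])
  moreover have "\<Union> (V ` topspace X) = topspace X" using ch by (auto simp: V_def)
  ultimately obtain \<V> where \<V>: "countable \<V>" "\<V> \<subseteq> V ` topspace X" "\<Union>\<V> = topspace X"
    using Vo unfolding Lindelof_space_def by (metis (no_types, lifting) imageE)
  then obtain C where C: "countable C" "C \<subseteq> topspace X" "\<V> = V ` C"
    using countable_subset_image[of \<V> V "topspace X"] by blast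
  have "C \<noteq> {}" using \<V>(3) C(3) ne by (metis Union_empty image_empty)
  \<comment> \<open>An enumeration with repetitions, so that finite covers are indexed by
    \<open>nat\<close> as well.\<close>
  then obtain s :: "nat \<Rightarrow> 'a" where s: "range s = C" using C(1) by (metis uncountable_def)
  have st: "s i \<in> topspace X" for i using s C(2) by auto
  define b where "b i = ch (s i)" for i
  have b: "b i \<in> SF" "0 \<le> b i q" "closedin X (L (s i))" "L (s i) \<subseteq> N (s i)" "q \<notin> L (s i) \<Longrightarrow> b i q = 0" for i q
    using ch[OF st[of i]] by (auto simp: b_def)
  have bs: "smooth_on (topspace X) (b i)" for i using b(1)[of i] by (simp add: SF_iff)
  have cov: "\<exists>i. 0 < b i p" if "p \<in> topspace X" for p
  proof -
    have "p \<in> \<Union> (V ` range s)" using that \<V>(3) C(3) s by simp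
    then show ?thesis by (auto simp: V_def b_def)
  qed
  define f where "f i q = b i q * (\<Prod>j<i. psi (inverse (real (Suc i)) - b j q))" for i q
  define K where "K i = L (s i) \<inter> {q \<in> topspace X. \<forall>j<i. b j q \<le> inverse (real (Suc i))}" for i
  have fs: "smooth_on (topspace X) (f i)" for i
    unfolding f_def by (intro smooth_on_mult smooth_on_prod smooth_on_flat smooth_on_diff smooth_on_const bs openin_topspace)
  have f0: "f i q = 0" if "q \<notin> topspace X" for i q
    using that b(1)[of i] by (simp add: f_def SF_iff)
  have fn: "0 \<le> f i q" for i q unfolding f_def by (intro mult_nonneg_nonneg b prod_nonneg) auto
  have fK: "f i q = 0" if qK: "q \<notin> K i" for i q
  proof (cases "q \<in> L (s i) \<and> q \<in> topspace X")
    case True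
    then obtain j where j: "j < i" "b j q > inverse (real (Suc i))" using qK by (auto simp: K_def not_le)
    then have "(\<Prod>j<i. psi (inverse (real (Suc i)) - b j q)) = 0" by (intro prod_zero bexI[of _ j]) auto
    then show ?thesis by (simp add: f_def)
  next
    case False
    then show ?thesis using b(5)[of q i] f0[of q i] by (auto simp: f_def)
  qed
  have Kc: "closedin X (K i)" for i
  proof -
    have "openin X {q \<in> topspace X. b j q \<in> {inverse (real (Suc i))<..}}" for j
      by (rule smooth_on_open_preimage[OF bs]) auto
    then have "openin X (\<Union>j<i. {q \<in> topspace X. b j q \<in> {inverse (real (Suc i))<..}})" by blast
    moreover have "{q \<in> topspace X. \<forall>j<i. b j q \<le> inverse (real (Suc i))}
        = topspace X - (\<Union>j<i. {q \<in> topspace X. b j q \<in> {inverse (real (Suc i))<..}})"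
      by (auto simp: not_less)
    ultimately have "closedin X {q \<in> topspace X. \<forall>j<i. b j q \<le> inverse (real (Suc i))}" by auto
    then show ?thesis unfolding K_def using b(3) by (intro closedin_Int)
  qed
  have lf: "\<exists>W. openin X W \<and> p \<in> W \<and> finite {i. K i \<inter> W \<noteq> {}}" if p: "p \<in> topspace X" for p
  proof -
    \<comment> \<open>Near \<open>p\<close> the bump with index \<open>m\<close> stays above half
      its value at \<open>p\<close>, hence above 1/(i+1) for all large \<open>i\<close>, and the
      corresponding \<open>K i\<close> miss that neighbourhood.\<close>
    obtain m where m: "0 < b m p" using cov[OF p] by blast
    obtain n where n: "inverse (real (Suc n)) < b m p / 2" using reals_Archimedean[of "b m p / 2"] m by auto
    define W where "W = {q \<in> topspace X. b m q \<in> {b m p / 2<..}}"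
    have *: "K i \<inter> W = {}" if "i > max m n" for i
    proof -
      have "inverse (real (Suc i)) \<le> inverse (real (Suc n))" using that by (intro le_imp_inverse_le) auto
      then have "inverse (real (Suc i)) < b m p / 2" using n by linarith
      moreover have "b m q \<le> inverse (real (Suc i))" if "q \<in> K i" for q
        using that \<open>i > max m n\<close> by (auto simp: K_def)
      moreover have "b m p / 2 < b m q" if "q \<in> W" for q using that by (simp add: W_def)
      ultimately show ?thesis by (meson disjoint_iff less_le_trans less_asym)
    qed
    have "{i. K i \<inter> W \<noteq> {}} \<subseteq> {..max m n}"
    proof
      fix i assume "i \<in> {i. K i \<inter> W \<noteq> {}}"
      then have "\<not> i > max m n" using *[of i] by blast
      then show "i \<in> {..max m n}" by (simp only: not_less atMost_iff)
    qed
    then have "finite {i. K i \<inter> W \<noteq> {}}" using finite_subset by blast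
    moreover have "openin X W" unfolding W_def by (rule smooth_on_open_preimage[OF bs]) auto
    ultimately show ?thesis using p m by (intro exI[of _ W]) (auto simp: W_def)
  qed
  have finf: "finite {i. f i p \<noteq> 0}" if p: "p \<in> topspace X" for p
  proof -
    obtain W where "p \<in> W" "finite {i. K i \<inter> W \<noteq> {}}" using lf[OF p] by blast
    then show ?thesis using fK by (elim finite_subset[rotated]) blast
  qed
  define F where "F q = (\<Sum>i | f i q \<noteq> 0. f i q)" for q
  have Fpos: "F p > 0" if p: "p \<in> topspace X" for p
  proof -
    \<comment> \<open>At the least index with a positive bump all earlier bumps vanish, so no factor
      of \<open>f i p\<close> is zero: the truncation leaves no point uncovered.\<close>
    define i where "i = (LEAST i. 0 < b i p)"
    have i: "0 < b i p" unfolding i_def using cov[OF p] by (rule LeastI_ex)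
    have j: "b j p = 0" if "j < i" for j using not_less_Least[of j "\<lambda>i. 0 < b i p"] that b(2)[of j p] by (simp add: i_def)
    have "f i p > 0" unfolding f_def using i j by (intro mult_pos_pos prod_pos) auto
    then show ?thesis unfolding F_def using finf[OF p] fn
      by (intro sum_pos2[of _ i]) auto
  qed
  have Fs: "smooth_on (topspace X) F"
  proof (rule smooth_on_local)
    fix p assume p: "p \<in> topspace X"
    obtain W where W: "openin X W" "p \<in> W" "finite {i. K i \<inter> W \<noteq> {}}" using lf[OF p] by blast
    have "F q = (\<Sum>i | K i \<inter> W \<noteq> {}. f i q)" if "q \<in> W" for q
      unfolding F_def using W(3) that fK by (intro sum.mono_neutral_left) blast+
    then have "smooth_on W F \<longleftrightarrow> smooth_on W (\<lambda>q. \<Sum>i | K i \<inter> W \<noteq> {}. f i q)" by (rule smooth_on_cong[OF W(1)])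
    moreover have "smooth_on W (\<lambda>q. \<Sum>i | K i \<inter> W \<noteq> {}. f i q)"
      using openin_subset[OF W(1)] by (intro smooth_on_sum W(1) smooth_on_subset[OF fs])
    ultimately show "\<exists>V. openin X V \<and> p \<in> V \<and> smooth_on V F" using W by blast
  qed simp
  define \<rho> where "\<rho> i q = f i q / F q" for i q
  have \<rho>s: "\<rho> i \<in> SF" for i
    unfolding SF_iff \<rho>_def using Fpos f0 by (auto intro!: smooth_on_divide fs Fs simp: less_imp_neq[symmetric])
  have "(\<Sum>i | \<rho> i p \<noteq> 0. \<rho> i p) = 1" if p: "p \<in> topspace X" for p
  proof -
    have "{i. \<rho> i p \<noteq> 0} = {i. f i p \<noteq> 0}" using Fpos[OF p] by (auto simp: \<rho>_def)
    then have "(\<Sum>i | \<rho> i p \<noteq> 0. \<rho> i p) = (\<Sum>i | f i p \<noteq> 0. f i p / F p)" by (simp only: \<rho>_def)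
    also have "\<dots> = F p / F p" unfolding sum_divide_distrib[symmetric] F_def[symmetric] ..
    finally show ?thesis using Fpos[OF p] by simp
  qed
  then have sum1: "\<forall>p\<in>topspace X. (\<Sum>i | \<rho> i p \<noteq> 0. \<rho> i p) = 1" by blast
  have "K i \<subseteq> N (s i)" for i using b(4)[of i] by (auto simp: K_def)
  moreover have "\<rho> i q = 0" if "q \<notin> K i" for i q using fK[OF that] by (simp add: \<rho>_def)
  ultimately have "\<forall>i. \<rho> i \<in> SF \<and> s i \<in> topspace X \<and> closedin X (K i) \<and> K i \<subseteq> N (s i) \<and> (\<forall>q. q \<notin> K i \<longrightarrow> \<rho> i q = 0)"
    using \<rho>s st Kc by simp
  moreover have "\<forall>p\<in>topspace X. \<exists>W. openin X W \<and> p \<in> W \<and> finite {i. K i \<inter> W \<noteq> {}}" using lf by (rule ballI)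
  ultimately show ?thesis using sum1 by (intro exI conjI)
qed

end

section \<open>Tangent vectors\<close>

context smooth_mfd
begin

abbreviation TS where "TS \<equiv> tangent_space X A"
abbreviation cv where "cv \<equiv> coord_vec X A"

lemma cv_eq: "cv c p e f = (if f \<in> SF then FD (\<lambda>y. f (iv c y)) (ph c p) e else 0)"
  by (cases c) (simp add: coord_vec_def o_def)

lemma SF_chart: "f \<in> SF \<Longrightarrow> c \<in> A \<Longrightarrow> Cinf_on (ph c ` dm c) (\<lambda>y. f (iv c y))"
  using smooth_onD[of "topspace X" f c "dm c"] chart_sub by (auto simp: SF_iff)

lemma SF_chart_has_derivative:
  "f \<in> SF \<Longrightarrow> c \<in> A \<Longrightarrow> p \<in> dm c \<Longrightarrow>
    ((\<lambda>y. f (iv c y)) has_derivative FD (\<lambda>y. f (iv c y)) (ph c p)) (at (ph c p))"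
  using Cinf_on_has_derivative[OF SF_chart] by blast

lemma cv_linear:
  assumes "c \<in> A" "p \<in> dm c"
  shows "cv c p (a *\<^sub>R e + b *\<^sub>R e') = (\<lambda>f. a * cv c p e f + b * cv c p e' f)"
proof
  fix f
  show "cv c p (a *\<^sub>R e + b *\<^sub>R e') f = a * cv c p e f + b * cv c p e' f"
  proof (cases "f \<in> SF")
    case True
    have "linear (FD (\<lambda>y. f (iv c y)) (ph c p))"
      using has_derivative_linear[OF SF_chart_has_derivative[OF True assms]] .
    then show ?thesis using True by (simp add: cv_eq linear_add linear_scale)
  qed (simp add: cv_eq)
qed

lemma cv_tangent:
  assumes c: "c \<in> A" "p \<in> dm c"
  shows "cv c p e \<in> TS p"
  unfolding tangent_space_def
proof (intro CollectI conjI ballI allI impI)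
  fix f g a b assume fg: "f \<in> SF" "g \<in> SF"
  note d = SF_chart_has_derivative[OF fg(1) c] SF_chart_has_derivative[OF fg(2) c]
  have "((\<lambda>y. a * f (iv c y) + b * g (iv c y)) has_derivative
      (\<lambda>e. a * FD (\<lambda>y. f (iv c y)) (ph c p) e + b * FD (\<lambda>y. g (iv c y)) (ph c p) e)) (at (ph c p))"
    by (intro has_derivative_add has_derivative_mult_right d)
  then show "cv c p e (\<lambda>q. a * f q + b * g q) = a * cv c p e f + b * cv c p e g"
    using fg SF_lin[OF fg] by (simp add: cv_eq FD_eq)
  have "((\<lambda>y. f (iv c y) * g (iv c y)) has_derivative
      (\<lambda>e. f (iv c (ph c p)) * FD (\<lambda>y. g (iv c y)) (ph c p) e + FD (\<lambda>y. f (iv c y)) (ph c p) e * g (iv c (ph c p)))) (at (ph c p))"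
    by (intro has_derivative_mult d)
  then show "cv c p e (\<lambda>q. f q * g q) = f p * cv c p e g + g p * cv c p e f"
    using fg SF_mult[OF fg] c by (simp add: cv_eq FD_eq)
qed (simp add: cv_eq)

lemma cv_change:
  assumes c: "c \<in> A" "p \<in> dm c" and c': "c' \<in> A" "p \<in> dm c'"
  shows "cv c' p e = cv c p (FD (\<lambda>y. ph c (iv c' y)) (ph c' p) e)"
proof
  fix f
  show "cv c' p e f = cv c p (FD (\<lambda>y. ph c (iv c' y)) (ph c' p) e) f"
  proof (cases "f \<in> SF")
    case True
    let ?S = "ph c' ` (dm c' \<inter> dm c)"
    have S: "open ?S" "ph c' p \<in> ?S"
      using chart_open_image_Int[OF c'(1) chart_open[OF c(1)]] c c' by auto
    have "((\<lambda>y. ph c (iv c' y)) has_derivative FD (\<lambda>y. ph c (iv c' y)) (ph c' p)) (at (ph c' p))"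
      by (rule Cinf_on_has_derivative[OF chart_transition[OF c'(1) c(1)] S(2)])
    moreover have "((\<lambda>y. f (iv c y)) has_derivative FD (\<lambda>y. f (iv c y)) (ph c p)) (at (ph c (iv c' (ph c' p))))"
      using SF_chart_has_derivative[OF True c] c' by simp
    ultimately have "((\<lambda>y. f (iv c (ph c (iv c' y)))) has_derivative
      (\<lambda>e. FD (\<lambda>y. f (iv c y)) (ph c p) (FD (\<lambda>y. ph c (iv c' y)) (ph c' p) e))) (at (ph c' p))"
      by (rule has_derivative_compose)
    then have "((\<lambda>y. f (iv c' y)) has_derivative
      (\<lambda>e. FD (\<lambda>y. f (iv c y)) (ph c p) (FD (\<lambda>y. ph c (iv c' y)) (ph c' p) e))) (at (ph c' p))"
      by (rule has_derivative_transform_within_open[OF _ S]) (use c c' in auto)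
    then show ?thesis using True by (simp add: cv_eq FD_eq)
  qed (simp add: cv_eq)
qed

text \<open>Tangent vectors act on global functions only, so the coordinates are multiplied by a
  cutoff that is 1 near \<open>p\<close>.\<close>

lemma coordinate_functions:
  assumes c: "c \<in> A" "p \<in> dm c"
  shows "\<exists>W F. openin X W \<and> p \<in> W \<and> W \<subseteq> dm c \<and> (\<forall>b. F b \<in> SF \<and> (\<forall>q\<in>W. F b q = ph c q \<bullet> b))"
proof -
  obtain ch W K where ch: "ch \<in> SF" "openin X W" "p \<in> W" "W \<subseteq> dm c" "\<And>q. q \<in> W \<Longrightarrow> ch q = 1"
    "closedin X K" "K \<subseteq> dm c" "\<And>q. q \<notin> K \<Longrightarrow> ch q = 0"
    using cutoff_exists[OF chart_open[OF c(1)] c(2)] by blast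
  have "smooth_on (dm c) (\<lambda>q. ph c q \<bullet> b)" for b
    by (rule smooth_on_chart_comp[OF c(1) chart_open[OF c(1)]])
      (auto intro!: Cinf_intros chart_image_open c(1))
  moreover have "smooth_on (dm c) ch"
    using ch(1) chart_sub[OF c(1)] by (auto simp: SF_iff intro: smooth_on_subset)
  ultimately have "(\<lambda>q. ch q * (ph c q \<bullet> b)) \<in> SF" for b
    by (intro SF_extend[OF chart_open[OF c(1)] ch(6,7)] ch(8)) auto
  then show ?thesis using ch by (intro exI[of _ W] exI[of _ "\<lambda>b q. ch q * (ph c q \<bullet> b)"]) auto
qed

lemma cv_coordinate:
  assumes c: "c \<in> A" and W: "openin X W" "W \<subseteq> dm c" "q \<in> W"
    and F: "F \<in> SF" "\<And>q. q \<in> W \<Longrightarrow> F q = ph c q \<bullet> b"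
  shows "cv c q e F = e \<bullet> b"
proof -
  have "((\<lambda>y. y \<bullet> b) has_derivative (\<lambda>e. e \<bullet> b)) (at (ph c q))"
    by (auto intro!: derivative_eq_intros)
  then have "((\<lambda>y. F (iv c y)) has_derivative (\<lambda>e. e \<bullet> b)) (at (ph c q))"
    by (rule has_derivative_transform_within_open[OF _ chart_open_image[OF c W(1,2)]])
      (use W F c in \<open>auto simp: subset_iff\<close>)
  then show ?thesis using F(1) by (simp add: cv_eq FD_eq)
qed

lemma cv_inj:
  assumes c: "c \<in> A" "p \<in> dm c" and eq: "cv c p e = cv c p e'"
  shows "e = e'"
proof -
  obtain W F where W: "openin X W" "p \<in> W" "W \<subseteq> dm c" and F: "\<And>b. F b \<in> SF" "\<And>b q. q \<in> W \<Longrightarrow> F b q = ph c q \<bullet> b"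
    using coordinate_functions[OF c] by blast
  have "e \<bullet> b = e' \<bullet> b" for b
    using cv_coordinate[OF c(1) W(1,3,2) F(1) F(2), where e=e and b=b]
      cv_coordinate[OF c(1) W(1,3,2) F(1) F(2), where e=e' and b=b] eq by simp
  then show ?thesis by (rule onb_eqI)
qed

lemma SF_sum: "finite I \<Longrightarrow> (\<And>i. i \<in> I \<Longrightarrow> f i \<in> SF) \<Longrightarrow> (\<lambda>q. \<Sum>i\<in>I. f i q) \<in> SF"
  by (auto simp: SF_iff intro!: smooth_on_sum)

lemma TS_lin: "v \<in> TS p \<Longrightarrow> f \<in> SF \<Longrightarrow> g \<in> SF \<Longrightarrow> v (\<lambda>q. a * f q + b * g q) = a * v f + b * v g"
  and TS_mult: "v \<in> TS p \<Longrightarrow> f \<in> SF \<Longrightarrow> g \<in> SF \<Longrightarrow> v (\<lambda>q. f q * g q) = f p * v g + g p * v f"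
  and TS_outside: "v \<in> TS p \<Longrightarrow> f \<notin> SF \<Longrightarrow> v f = 0"
  by (auto simp: tangent_space_def)

lemma SF_zero: "(\<lambda>q. 0) \<in> SF"
  by (simp add: SF_iff smooth_on_const)

lemma TS_zero: "v \<in> TS p \<Longrightarrow> v (\<lambda>q. 0) = 0"
  using TS_lin[of v p "\<lambda>q. 0" "\<lambda>q. 0" 0 0] SF_zero by simp

lemma TS_sum:
  assumes v: "v \<in> TS p" and "finite I" and "\<And>i. i \<in> I \<Longrightarrow> f i \<in> SF"
  shows "v (\<lambda>q. \<Sum>i\<in>I. f i q) = (\<Sum>i\<in>I. v (f i))"
  using assms(2,3)
proof (induction I rule: finite_induct)
  case empty
  show ?case using TS_zero[OF v] by simp
next
  case (insert i I)
  then have "v (\<lambda>q. 1 * f i q + 1 * (\<Sum>i\<in>I. f i q)) = 1 * v (f i) + 1 * v (\<lambda>q. \<Sum>i\<in>I. f i q)"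
    by (intro TS_lin[OF v] SF_sum) auto
  then show ?case using insert by simp
qed

text \<open>With \<open>h\<close> the difference of the functions and a bump \<open>b\<close>
  supported where it vanishes, the product of \<open>b\<close> and \<open>h\<close> is zero, and the
  Leibniz rule leaves \<open>b p * v h = 0\<close>.\<close>

lemma TS_local:
  assumes v: "v \<in> TS p" and W: "openin X W" "p \<in> W" and fg: "f \<in> SF" "g \<in> SF" "\<And>q. q \<in> W \<Longrightarrow> f q = g q"
  shows "v f = v g"
proof -
  obtain b K where b: "b \<in> SF" "0 < b p" "K \<subseteq> W" "\<And>q. q \<notin> K \<Longrightarrow> b q = 0"
    using bump_exists[OF W] by blast
  define h where "h = (\<lambda>q. 1 * f q + (-1) * g q)"
  have h: "h \<in> SF" unfolding h_def by (rule SF_lin[OF fg(1,2)])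
  have "b q * h q = 0" for q
    using b(3,4) fg(3) by (cases "q \<in> W") (auto simp: h_def)
  then have "(\<lambda>q. b q * h q) = (\<lambda>q. 0)" by (rule ext)
  then have "v (\<lambda>q. b q * h q) = 0" by (simp only: TS_zero[OF v])
  moreover have "h p = 0" using fg(3) W by (simp add: h_def)
  ultimately have "b p * v h = 0" using TS_mult[OF v b(1) h] by simp
  then have "v h = 0" using b(2) by simp
  then show ?thesis using TS_lin[OF v fg(1,2), of 1 "-1"] by (simp add: h_def)
qed

text \<open>By Hadamard's lemma \<open>f\<close> is, near \<open>p\<close>, a constant plus products
  with a factor vanishing at \<open>p\<close>. The Leibniz rule keeps only the derivative of that
  factor times a partial derivative of \<open>f\<close>, so the components of \<open>v\<close> are
  its values on the cut-off coordinates.\<close>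

lemma cv_surj:
  assumes v: "v \<in> TS p" and c: "c \<in> A" "p \<in> dm c"
  shows "\<exists>e. cv c p e = v"
proof -
  obtain W F where W: "openin X W" "p \<in> W" "W \<subseteq> dm c" and F: "\<And>b. F b \<in> SF" "\<And>b q. q \<in> W \<Longrightarrow> F b q = ph c q \<bullet> b"
    using coordinate_functions[OF c] by blast
  have "cv c p (\<Sum>b\<in>onb. v (F b) *\<^sub>R b) f = v f" for f
  proof (cases "f \<in> SF")
    case True
    let ?a = "ph c p" and ?h = "\<lambda>y. f (iv c y)"
    have "open (ph c ` dm c)" "?a \<in> ph c ` dm c" using c chart_image_open by auto
    then obtain r where r: "r > 0" "ball ?a r \<subseteq> ph c ` dm c" using open_contains_ball by blast
    obtain g where g: "\<And>b. b \<in> onb \<Longrightarrow> Cinf_on (ball ?a r) (g b)" "\<And>b. b \<in> onb \<Longrightarrow> g b ?a = FD ?h ?a b"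
      "\<And>y. onb \<noteq> ({} :: 'e set) \<Longrightarrow> y \<in> ball ?a r \<Longrightarrow> ?h y = ?h ?a + (\<Sum>b\<in>onb. ((y - ?a) \<bullet> b) * g b y)"
      using hadamard[OF Cinf_on_subset[OF SF_chart[OF True c(1)] r(2)] r(1)] by blast
    have g3: "?h y = ?h ?a + (\<Sum>b\<in>onb. ((y - ?a) \<bullet> b) * g b y)" if "y \<in> ball ?a r" for y
    \<comment> \<open>Dimension 0, where \<open>hadamard\<close> is silent: all points
      coincide.\<close>
    proof (cases "onb = ({} :: 'e set)")
      case True
      then have "y = ?a" using onb_expand[of y] onb_expand[of ?a] by simp
      then show ?thesis by simp
    qed (use g(3) that in blast)
    define N where "N = {q \<in> dm c. ph c q \<in> ball ?a r}"
    have N: "openin X N" unfolding N_def by (rule chart_openin_vimage[OF c(1) open_ball])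
    have pN: "p \<in> N" using c r(1) by (simp add: N_def)
    obtain ch V K where ch: "ch \<in> SF" "openin X V" "p \<in> V" "V \<subseteq> N" "\<And>q. q \<in> V \<Longrightarrow> ch q = 1"
      "closedin X K" "K \<subseteq> N" "\<And>q. q \<notin> K \<Longrightarrow> ch q = 0"
      using cutoff_exists[OF N pN] by blast
    have chN: "smooth_on N ch"
      using ch(1) openin_subset[OF N] by (auto simp: SF_iff intro: smooth_on_subset)
    define G where "G b = (\<lambda>q. ch q * g b (ph c q))" for b
    have G: "G b \<in> SF" if "b \<in> onb" for b
      unfolding G_def
    proof (rule SF_extend[OF N ch(6,7) _ chN ch(8)])
      show "smooth_on N (\<lambda>q. g b (ph c q))"
        by (rule smooth_on_chart_comp[OF c(1) N]) (auto simp: N_def intro: Cinf_on_subset[OF g(1)[OF that]])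
    qed
    \<comment> \<open>A cut-off constant 1. It equals its own square near \<open>p\<close>, which
      forces \<open>v one = 0\<close>.\<close>
    define one where "one = (\<lambda>q. ch q * 1)"
    have one: "one \<in> SF" using ch(1) by (simp add: one_def)
    have v1: "v one = 0"
    proof -
      have "v (\<lambda>q. one q * one q) = v one"
        by (rule TS_local[OF v ch(2,3) SF_mult[OF one one] one]) (simp add: one_def ch(5))
      then show ?thesis using TS_mult[OF v one one] ch(3,5) by (simp add: one_def)
    qed
    \<comment> \<open>The product of the coordinate difference, which vanishes at \<open>p\<close>,
      with the Hadamard coefficient, both made global by the cutoffs.\<close>
    define H where "H b = (\<lambda>q. (1 * F b q + (- (?a \<bullet> b)) * one q) * G b q)" for b
    have Fa: "(\<lambda>q. 1 * F b q + (- (?a \<bullet> b)) * one q) \<in> SF" for b by (rule SF_lin[OF F(1) one])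
    have H: "H b \<in> SF" if "b \<in> onb" for b unfolding H_def by (rule SF_mult[OF Fa G[OF that]])
    have HS: "(\<lambda>q. \<Sum>b\<in>onb. H b q) \<in> SF" by (rule SF_sum) (auto intro: H)
    let ?f = "\<lambda>q. f p * one q + 1 * (\<Sum>b\<in>onb. H b q)"
    have "v f = v ?f"
    proof (rule TS_local[OF v _ _ True SF_lin[OF one HS]])
      show "openin X (V \<inter> W)" "p \<in> V \<inter> W" using ch(2,3) W by auto
      fix q assume q: "q \<in> V \<inter> W"
      then have "ph c q \<in> ball ?a r" "q \<in> dm c" using ch(4) by (auto simp: N_def)
      from g3[OF this(1)] this(2)
      have "f q = f p + (\<Sum>b\<in>onb. ((ph c q - ?a) \<bullet> b) * g b (ph c q))" using c by simp
      moreover have "H b q = ((ph c q - ?a) \<bullet> b) * g b (ph c q)" for b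
        using q ch(5) F(2) by (simp add: H_def G_def one_def inner_diff_left)
      ultimately show "f q = ?f q" using q ch(5) by (simp add: one_def)
    qed
    also have "\<dots> = (\<Sum>b\<in>onb. v (H b))"
      using TS_lin[OF v one HS, of "f p" 1] v1 TS_sum[OF v finite_onb H] by simp
    also have "\<dots> = (\<Sum>b\<in>onb. v (F b) * FD ?h ?a b)"
    proof (rule sum.cong[OF refl])
      fix b :: 'e assume b: "b \<in> onb"
      have "v (H b) = (1 * F b p + (- (?a \<bullet> b)) * one p) * v (G b) + G b p * v (\<lambda>q. 1 * F b q + (- (?a \<bullet> b)) * one q)"
        unfolding H_def by (rule TS_mult[OF v Fa G[OF b]])
      also have "1 * F b p + (- (?a \<bullet> b)) * one p = 0" using F(2) W(2) ch(3,5) by (simp add: one_def)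
      also have "v (\<lambda>q. 1 * F b q + (- (?a \<bullet> b)) * one q) = v (F b)" using TS_lin[OF v F(1)[of b] one, of 1 "- (?a \<bullet> b)"] v1 by simp
      also have "G b p = FD ?h ?a b" using g(2)[OF b] ch(3,5) by (simp add: G_def)
      finally show "v (H b) = v (F b) * FD ?h ?a b" by simp
    qed
    also have "\<dots> = FD ?h ?a (\<Sum>b\<in>onb. v (F b) *\<^sub>R b)"
    proof -
      have "linear (FD ?h ?a)" by (rule has_derivative_linear[OF SF_chart_has_derivative[OF True c]])
      then show ?thesis by (simp add: linear_sum linear_scale)
    qed
    finally show ?thesis using True by (simp add: cv_eq)
  next
    case False
    then show ?thesis using TS_outside[OF v] by (simp add: cv_eq)
  qed
  then show ?thesis by blast
qed

text \<open>The inverse of \<open>cv c p\<close>: the description is unique by \<open>cv_inj\<close>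
  and, on tangent vectors, satisfiable by \<open>cv_surj\<close>.\<close>

definition cmp :: "('a, 'e) chart \<Rightarrow> 'a \<Rightarrow> 'a tvec \<Rightarrow> 'e" where
  "cmp c p v = (THE e. cv c p e = v)"

lemma cmp_cv [simp]: "c \<in> A \<Longrightarrow> p \<in> dm c \<Longrightarrow> cmp c p (cv c p e) = e"
  unfolding cmp_def by (rule the_equality) (auto intro: cv_inj)

lemma cv_cmp [simp]: "c \<in> A \<Longrightarrow> p \<in> dm c \<Longrightarrow> v \<in> TS p \<Longrightarrow> cv c p (cmp c p v) = v"
  using cv_surj[of v p c] by auto

text \<open>Smoothness of forms is tested on global vector fields only, so constant coordinate
  fields are extended by means of a cutoff.\<close>

lemma vector_field_extension:
  assumes c: "c \<in> A" "p \<in> dm c"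
  shows "\<exists>W Y. openin X W \<and> p \<in> W \<and> W \<subseteq> dm c \<and> (\<forall>e. Y e \<in> vector_fields X A \<and> (\<forall>q\<in>W. Y e q = cv c q e))"
proof -
  obtain ch W K where ch: "ch \<in> SF" "openin X W" "p \<in> W" "W \<subseteq> dm c" "\<And>q. q \<in> W \<Longrightarrow> ch q = 1"
    "closedin X K" "K \<subseteq> dm c" "\<And>q. q \<notin> K \<Longrightarrow> ch q = 0"
    using cutoff_exists[OF chart_open[OF c(1)] c(2)] by blast
  define Y where "Y e = (\<lambda>q f. ch q * cv c q e f)" for e
  have "Y e \<in> vector_fields X A" for e
    unfolding vector_fields_def
  proof (intro CollectI conjI ballI)
    fix q assume "q \<in> topspace X"
    show "Y e q \<in> TS q"
    proof (cases "q \<in> dm c")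
      case True
      have "Y e q = cv c q (ch q *\<^sub>R e + 0 *\<^sub>R e)" unfolding cv_linear[OF c(1) True] by (simp add: Y_def)
      then show ?thesis using cv_tangent[OF c(1) True] by simp
    next
      case False
      then have "ch q = 0" using ch(7,8) by blast
      then have "Y e q = (\<lambda>f. 0)" by (simp add: Y_def)
      then show ?thesis by (simp add: tangent_space_def)
    qed
  next
    fix f assume f: "f \<in> SF"
    have "smooth_on (dm c) (\<lambda>q. FD (\<lambda>y. f (iv c y)) (ph c q) e)"
      by (rule smooth_on_chart_comp[OF c(1) chart_open[OF c(1)]])
        (auto intro: Cinf_on_FD[OF SF_chart[OF f c(1)]])
    moreover have "smooth_on (dm c) ch"
      using ch(1) chart_sub[OF c(1)] by (auto simp: SF_iff intro: smooth_on_subset)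
    ultimately have "(\<lambda>q. ch q * FD (\<lambda>y. f (iv c y)) (ph c q) e) \<in> SF"
      by (intro SF_extend[OF chart_open[OF c(1)] ch(6,7)] ch(8)) auto
    then show "smooth_fun A (\<lambda>q. Y e q f)" using f by (simp add: Y_def cv_eq SF_iff smooth_fun_iff)
  qed
  then show ?thesis using ch by (intro exI[of _ W] exI[of _ Y]) (auto simp: Y_def)
qed

text \<open>The components are the values of the field on the cut-off coordinate functions, and
  those are smooth by the definition of a vector field.\<close>

lemma vector_field_cmp_Cinf:
  assumes Y: "Y \<in> vector_fields X A" and c: "c \<in> A"
  shows "Cinf_on (ph c ` dm c) (\<lambda>y. cmp c (iv c y) (Y (iv c y)))"
proof (rule Cinf_on_local[OF _ chart_image_open[OF c]])
  fix y assume "y \<in> ph c ` dm c"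
  then obtain p where p: "p \<in> dm c" "y = ph c p" by blast
  obtain W F where W: "openin X W" "p \<in> W" "W \<subseteq> dm c" and F: "\<And>b. F b \<in> SF" "\<And>b q. q \<in> W \<Longrightarrow> F b q = ph c q \<bullet> b"
    using coordinate_functions[OF c p(1)] by blast
  have o: "open (ph c ` W)" by (rule chart_open_image[OF c W(1,3)])
  have "smooth_on (topspace X) (\<lambda>q. Y q (F b))" for b
    using Y F(1) by (auto simp: vector_fields_def smooth_fun_iff)
  then have "Cinf_on (ph c ` W) (\<lambda>y. Y (iv c y) (F b))" for b
    using W(3) chart_sub[OF c] by (intro smooth_onD[where W="topspace X", OF _ c]) auto
  then have "Cinf_on (ph c ` W) (\<lambda>y. \<Sum>b\<in>onb. Y (iv c y) (F b) *\<^sub>R b)"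
    by (intro Cinf_intros o)
  moreover have "cmp c (iv c y) (Y (iv c y)) = (\<Sum>b\<in>onb. Y (iv c y) (F b) *\<^sub>R b)" if "y \<in> ph c ` W" for y
  proof -
    define q where "q = iv c y"
    have q: "q \<in> W" using that iv_in_sub[OF c W(3)] by (simp add: q_def)
    then have qd: "q \<in> dm c" "q \<in> topspace X" using W(3) chart_sub[OF c] by auto
    have "Y q \<in> TS q" using Y qd by (auto simp: vector_fields_def)
    then have "cv c q (cmp c q (Y q)) = Y q" by (rule cv_cmp[OF c qd(1)])
    then have "Y q (F b) = cmp c q (Y q) \<bullet> b" for b
      using cv_coordinate[OF c W(1,3) q F(1) F(2), where e="cmp c q (Y q)" and b=b] by simp
    then show ?thesis by (simp add: onb_expand q_def[symmetric])
  qed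
  ultimately have "Cinf_on (ph c ` W) (\<lambda>y. cmp c (iv c y) (Y (iv c y)))"
    by (rule Cinf_on_congI[OF _ o])
  then show "\<exists>T. open T \<and> y \<in> T \<and> Cinf_on (T \<inter> ph c ` dm c) (\<lambda>y. cmp c (iv c y) (Y (iv c y)))"
    using o p W by (intro exI[of _ "ph c ` W"]) (auto intro: Cinf_on_subset)
qed

end

section \<open>Smooth families of forms\<close>

lemma list_split_two:
  assumes "i < j" "j < length es"
  shows "es = take i es @ es ! i # take (j - Suc i) (drop (Suc i) es) @ es ! j # drop (Suc j) es"
proof -
  have "es = take i es @ es ! i # drop (Suc i) es" using assms by (intro id_take_nth_drop) simp
  also have "drop (Suc i) es = take (j - Suc i) (drop (Suc i) es) @ drop (Suc i) es ! (j - Suc i) # drop (Suc (j - Suc i)) (drop (Suc i) es)"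
    using assms by (intro id_take_nth_drop) simp
  also have "drop (Suc i) es ! (j - Suc i) = es ! j" using assms by simp
  also have "drop (Suc (j - Suc i)) (drop (Suc i) es) = drop (Suc j) es"
    using assms by (simp add: Suc_diff_Suc)
  finally show ?thesis .
qed

context smooth_mfd
begin

abbreviation rep where "rep \<equiv> coord_rep X A"

lemma rep_eq: "rep c \<alpha> y es = \<alpha> (iv c y) (map (cv c (iv c y)) es)"
  by (cases c) (simp add: coord_rep_def)

lemma rep_ph: "c \<in> A \<Longrightarrow> p \<in> dm c \<Longrightarrow> rep c \<alpha> (ph c p) es = \<alpha> p (map (cv c p) es)"
  by (simp add: rep_eq)

text \<open>The linear isomorphism \<open>cv c p\<close> transports one description to the other;
  updating a slot corresponds to splitting the list there.\<close>

lemma alternating_multilinear_iff: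
  assumes c: "c \<in> A" "p \<in> dm c"
  shows "alternating_multilinear q (TS p) \<alpha> \<longleftrightarrow> altm q (\<lambda>es. \<alpha> (map (cv c p) es))"
proof
  assume a: "alternating_multilinear q (TS p) \<alpha>"
  have a1: "\<alpha> (vs[i := (\<lambda>f. r * v f + s * w f)]) = r * \<alpha> (vs[i := v]) + s * \<alpha> (vs[i := w])"
    if "length vs = q" "set vs \<subseteq> TS p" "i < q" "v \<in> TS p" "w \<in> TS p" for vs i v w r s
    using a that unfolding alternating_multilinear_def by blast
  have a2: "\<alpha> vs = 0" if "length vs = q" "set vs \<subseteq> TS p" "i < j" "j < q" "vs ! i = vs ! j" for vs i j
    using a that unfolding alternating_multilinear_def by blast
  have s: "set (map (cv c p) es) \<subseteq> TS p" for es using cv_tangent[OF c] by auto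
  show "altm q (\<lambda>es. \<alpha> (map (cv c p) es))"
  proof (rule altmI)
    fix xs ys :: "'e list" assume len: "Suc (length xs + length ys) = q"
    have "\<alpha> (map (cv c p) (xs @ (r *\<^sub>R v + t *\<^sub>R w) # ys)) = r * \<alpha> (map (cv c p) (xs @ v # ys)) + t * \<alpha> (map (cv c p) (xs @ w # ys))" for r t v w
    proof -
      have upd: "(map (cv c p) (xs @ v # ys))[length xs := u] = map (cv c p) xs @ u # map (cv c p) ys" for u
        by (simp add: list_update_append)
      have "\<alpha> ((map (cv c p) (xs @ v # ys))[length xs := (\<lambda>f. r * cv c p v f + t * cv c p w f)])
        = r * \<alpha> ((map (cv c p) (xs @ v # ys))[length xs := cv c p v]) + t * \<alpha> ((map (cv c p) (xs @ v # ys))[length xs := cv c p w])"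
        using len by (intro a1 s cv_tangent[OF c]) auto
      then show ?thesis unfolding upd by (simp add: cv_linear[OF c])
    qed
    from this[of 1 _ 1] this[of _ _ 0] show "linear (\<lambda>v. \<alpha> (map (cv c p) (xs @ v # ys)))"
      by (intro linearI) (simp_all del: map_append list.map)
  next
    fix xs ys zs :: "'e list" and v assume len: "Suc (Suc (length xs + length ys + length zs)) = q"
    show "\<alpha> (map (cv c p) (xs @ v # ys @ v # zs)) = 0"
      by (rule a2[OF _ s, of _ "length xs" "length xs + Suc (length ys)"])
        (use len in \<open>simp_all add: nth_append\<close>)
  qed
next
  assume a: "altm q (\<lambda>es. \<alpha> (map (cv c p) es))"
  show "alternating_multilinear q (TS p) \<alpha>"
    unfolding alternating_multilinear_def
  proof (intro allI impI conjI ballI)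
    fix vs :: "'a tvec list" and i v w r s
    assume vs: "length vs = q" "set vs \<subseteq> TS p" and i: "i < q" and v: "v \<in> TS p" "w \<in> TS p"
    define es where "es = map (cmp c p) vs"
    have es: "map (cv c p) es = vs" unfolding es_def map_map by (rule map_idI) (use vs(2) c in auto)
    have len: "length es = q" using vs by (simp add: es_def)
    have upd: "vs[i := cv c p u] = map (cv c p) (take i es @ u # drop (Suc i) es)" for u
      using i len by (simp add: es[symmetric] map_update[symmetric] upd_conv_take_nth_drop)
    obtain e e' where e: "v = cv c p e" "w = cv c p e'" using cv_surj[OF _ c] v by metis
    have l: "linear (\<lambda>u. \<alpha> (map (cv c p) (take i es @ u # drop (Suc i) es)))"
      using i len by (intro altm_linear[OF a]) auto
    show "\<alpha> (vs[i := (\<lambda>f. r * v f + s * w f)]) = r * \<alpha> (vs[i := v]) + s * \<alpha> (vs[i := w])"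
      unfolding e cv_linear[OF c, symmetric] upd linear_add[OF l] linear_scale[OF l] by simp
  next
    fix vs :: "'a tvec list" and i j
    assume vs: "length vs = q" "set vs \<subseteq> TS p" and ij: "i < j" "j < q" "vs ! i = vs ! j"
    define es where "es = map (cmp c p) vs"
    have es: "map (cv c p) es = vs" unfolding es_def map_map by (rule map_idI) (use vs(2) c in auto)
    have len: "length es = q" using vs by (simp add: es_def)
    have eq: "es ! i = es ! j" using ij vs by (simp add: es_def)
    let ?L = "take i es @ es ! i # take (j - Suc i) (drop (Suc i) es) @ es ! i # drop (Suc j) es"
    have "\<alpha> (map (cv c p) ?L) = 0" by (rule altm_zero[OF a]) (use ij len in auto)
    moreover have "es = ?L" using list_split_two[of i j es] ij len eq by simp
    ultimately show "\<alpha> vs = 0" using es by (metis (no_types, lifting))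
  qed
qed

text \<open>Forms on an open set \<open>B\<close> are total functions whose values off \<open>B\<close> are irrelevant, and the tangent
  vectors are those of the whole manifold, so that restriction to a smaller set is the identity.\<close>

definition frm :: "'p::finite_dim_inner set \<Rightarrow> 'a set \<Rightarrow> nat \<Rightarrow> ('p \<Rightarrow> 'a form) \<Rightarrow> bool" where
  "frm P B q \<alpha> \<longleftrightarrow> (\<forall>c\<in>A. sform (ph c ` (dm c \<inter> B) \<times> P) q (\<lambda>(y, x). rep c (\<alpha> x) y))"

lemma frm_sform: "frm P B q \<alpha> \<Longrightarrow> c \<in> A \<Longrightarrow> B' \<subseteq> B \<Longrightarrow> B' \<subseteq> dm c \<Longrightarrow> sform (ph c ` B' \<times> P) q (\<lambda>(y, x). rep c (\<alpha> x) y)"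
  unfolding frm_def by (elim ballE) (auto elim!: sform_subset)

lemma frm_sform1:
  assumes "frm P B q \<alpha>" "c \<in> A" "openin X B'" "B' \<subseteq> B" "B' \<subseteq> dm c" "x \<in> P"
  shows "sform (ph c ` B') q (rep c (\<alpha> x))"
proof -
  have o: "open (ph c ` B')" by (rule chart_open_image[OF assms(2,3,5)])
  have "sform (ph c ` B') q (\<lambda>y. (\<lambda>(y, x). rep c (\<alpha> x) y) (y, x))"
    by (rule sform_compose[OF frm_sform[OF assms(1,2,4,5)] _ o]) (use assms(6) o in \<open>auto intro!: Cinf_intros\<close>)
  then show ?thesis by simp
qed

lemma frm_subset: "frm P B q \<alpha> \<Longrightarrow> B' \<subseteq> B \<Longrightarrow> frm P B' q \<alpha>"
  unfolding frm_def by (auto intro: frm_sform[unfolded frm_def] elim!: sform_subset)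

lemma frm_alternating:
  assumes "frm P B q \<alpha>" "p \<in> B" "x \<in> P" "B \<subseteq> topspace X"
  shows "alternating_multilinear q (TS p) (\<alpha> x p)"
proof -
  obtain c where c: "c \<in> A" "p \<in> dm c" using assms chart_cover by blast
  have "altm q ((\<lambda>(y, x). rep c (\<alpha> x) y) (ph c p, x))"
    using assms c by (intro sform_altm[OF frm_sform[OF assms(1) c(1), of "B \<inter> dm c"]]) auto
  then show ?thesis unfolding alternating_multilinear_iff[OF c] using c by (simp add: rep_eq[abs_def])
qed

lemma frm_local:
  assumes P: "open P" and B: "openin X B"
    and loc: "\<And>p. p \<in> B \<Longrightarrow> \<exists>V. openin X V \<and> p \<in> V \<and> frm P V q \<alpha>"
  shows "frm P B q \<alpha>"
  unfolding frm_def sform_def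
proof (intro ballI conjI allI impI)
  fix c z assume c: "c \<in> A" and "z \<in> ph c ` (dm c \<inter> B) \<times> P"
  then obtain p x where p: "p \<in> dm c" "p \<in> B" "x \<in> P" "z = (ph c p, x)" by auto
  obtain V where V: "openin X V" "p \<in> V" "frm P V q \<alpha>" using loc[OF p(2)] by blast
  show "altm q (case z of (y, x) \<Rightarrow> rep c (\<alpha> x) y)"
    using sform_altm[OF frm_sform[OF V(3) c, of "V \<inter> dm c"], of z] p V by auto
next
  fix c and es :: "'e list" assume c: "c \<in> A" and len: "length es = q"
  show "Cinf_on (ph c ` (dm c \<inter> B) \<times> P) (\<lambda>z. (case z of (y, x) \<Rightarrow> rep c (\<alpha> x) y) es)"
  proof (rule Cinf_on_local)
    fix z assume "z \<in> ph c ` (dm c \<inter> B) \<times> P"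
    then obtain p x where p: "p \<in> dm c" "p \<in> B" "x \<in> P" "z = (ph c p, x)" by auto
    obtain V where V: "openin X V" "p \<in> V" "frm P V q \<alpha>" using loc[OF p(2)] by blast
    have "Cinf_on (ph c ` (V \<inter> dm c) \<times> P) (\<lambda>z. (case z of (y, x) \<Rightarrow> rep c (\<alpha> x) y) es)"
      by (rule sform_Cinf[OF frm_sform[OF V(3) c] len]) auto
    moreover have "open (ph c ` (V \<inter> dm c))"
      using V(1) chart_open[OF c] by (intro chart_open_image[OF c] openin_Int) auto
    ultimately show "\<exists>T. open T \<and> z \<in> T \<and> Cinf_on (T \<inter> ph c ` (dm c \<inter> B) \<times> P) (\<lambda>z. (case z of (y, x) \<Rightarrow> rep c (\<alpha> x) y) es)"
      using P p V by (intro exI[of _ "ph c ` (V \<inter> dm c) \<times> P"]) (auto intro: Cinf_on_subset open_Times)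
  qed (intro open_Times P chart_open_image_Int[OF c B])
qed

lemma frm_cong:
  assumes P: "open P" and B: "openin X B"
    and eq: "\<And>x p vs. x \<in> P \<Longrightarrow> p \<in> B \<Longrightarrow> length vs = q \<Longrightarrow> set vs \<subseteq> TS p \<Longrightarrow> \<alpha> x p vs = \<beta> x p vs"
  shows "frm P B q \<alpha> \<longleftrightarrow> frm P B q \<beta>"
proof -
  have "sform (ph c ` (dm c \<inter> B) \<times> P) q (\<lambda>(y, x). rep c (\<alpha> x) y) \<longleftrightarrow>
    sform (ph c ` (dm c \<inter> B) \<times> P) q (\<lambda>(y, x). rep c (\<beta> x) y)" if c: "c \<in> A" for c
  proof (rule sform_cong)
    show "open (ph c ` (dm c \<inter> B) \<times> P)" by (intro open_Times P chart_open_image_Int[OF c B])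
    fix z and es :: "'e list" assume "z \<in> ph c ` (dm c \<inter> B) \<times> P" "length es = q"
    moreover from this obtain p x where p: "p \<in> dm c" "p \<in> B" "x \<in> P" "z = (ph c p, x)" by auto
    ultimately show "(case z of (y, x) \<Rightarrow> rep c (\<alpha> x) y) es = (case z of (y, x) \<Rightarrow> rep c (\<beta> x) y) es"
      using c cv_tangent[OF c p(1)] by (auto simp: rep_ph intro!: eq)
  qed
  then show ?thesis by (simp add: frm_def)
qed

lemma frm_add:
  assumes P: "open P" and B: "openin X B" and "frm P B q \<alpha>" "frm P B q \<beta>"
  shows "frm P B q (\<lambda>x p vs. \<alpha> x p vs + \<beta> x p vs)"
  unfolding frm_def
proof
  fix c assume c: "c \<in> A"
  let ?S = "ph c ` (dm c \<inter> B) \<times> P"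
  have S: "open ?S" by (intro open_Times P chart_open_image_Int[OF c B])
  have a: "sform ?S q (\<lambda>(y, x). rep c (\<alpha> x) y)" "sform ?S q (\<lambda>(y, x). rep c (\<beta> x) y)"
    using assms c by (auto simp: frm_def)
  show "sform ?S q (\<lambda>(y, x). rep c (\<lambda>p vs. \<alpha> x p vs + \<beta> x p vs) y)"
    unfolding sform_def
  proof (intro conjI ballI allI impI)
    fix z assume z: "z \<in> ?S"
    from altm_add[OF sform_altm[OF a(1) z] sform_altm[OF a(2) z], of 1 1]
    show "altm q (case z of (y, x) \<Rightarrow> rep c (\<lambda>p vs. \<alpha> x p vs + \<beta> x p vs) y)"
      by (simp add: split_def rep_eq[abs_def])
  next
    fix es :: "'e list" assume len: "length es = q"
    from Cinf_on_add[OF sform_Cinf[OF a(1) len] sform_Cinf[OF a(2) len] S]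
    show "Cinf_on ?S (\<lambda>z. (case z of (y, x) \<Rightarrow> rep c (\<lambda>p vs. \<alpha> x p vs + \<beta> x p vs) y) es)"
      by (simp add: split_def rep_eq)
  qed
qed

lemma frm_mult:
  assumes P: "open P" and B: "openin X B" and \<rho>: "smooth_on B \<rho>" and \<alpha>: "frm P B q \<alpha>"
  shows "frm P B q (\<lambda>x p vs. \<rho> p * \<alpha> x p vs)"
  unfolding frm_def
proof
  fix c assume c: "c \<in> A"
  let ?S = "ph c ` (dm c \<inter> B) \<times> P"
  have o: "open (ph c ` (dm c \<inter> B))" by (rule chart_open_image_Int[OF c B])
  then have S: "open ?S" by (intro open_Times P)
  have a: "sform ?S q (\<lambda>(y, x). rep c (\<alpha> x) y)" using \<alpha> c by (auto simp: frm_def)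
  show "sform ?S q (\<lambda>(y, x). rep c (\<lambda>p vs. \<rho> p * \<alpha> x p vs) y)"
    unfolding sform_def
  proof (intro conjI ballI allI impI)
    fix z assume z: "z \<in> ?S"
    from altm_add[OF sform_altm[OF a z] sform_altm[OF a z], of "\<rho> (iv c (fst z))" 0]
    show "altm q (case z of (y, x) \<Rightarrow> rep c (\<lambda>p vs. \<rho> p * \<alpha> x p vs) y)"
      by (simp add: split_def rep_eq[abs_def])
  next
    fix es :: "'e list" assume len: "length es = q"
    have "Cinf_on (ph c ` (dm c \<inter> B)) (\<lambda>y. \<rho> (iv c y))" using \<rho> c by (simp add: smooth_on_def)
    from Cinf_on_mult[OF Cinf_on_fst_lift[OF this o P] sform_Cinf[OF a len] S]
    show "Cinf_on ?S (\<lambda>z. (case z of (y, x) \<Rightarrow> rep c (\<lambda>p vs. \<rho> p * \<alpha> x p vs) y) es)"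
      by (simp add: split_def rep_eq)
  qed
qed

lemma frm_zero: "frm P B q (\<lambda>x p vs. 0)"
  by (auto simp: frm_def sform_def rep_eq[abs_def] split_def intro!: altmI Cinf_on_const linear_zero)

lemma frm_sum:
  assumes P: "open P" and B: "openin X B" and "\<And>i. i \<in> I \<Longrightarrow> frm P B q (\<alpha> i)"
  shows "frm P B q (\<lambda>x p vs. \<Sum>i\<in>I. \<alpha> i x p vs)"
  using assms(3)
proof (induction I rule: infinite_finite_induct)
  case (insert i I)
  then show ?case using frm_add[OF P B, of q "\<alpha> i" "\<lambda>x p vs. \<Sum>i\<in>I. \<alpha> i x p vs"] by simp
qed (simp_all add: frm_zero)

lemma frm_cmult:
  assumes P: "open P" and B: "openin X B" and \<alpha>: "frm P B q \<alpha>"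
  shows "frm P B q (\<lambda>x p vs. r * \<alpha> x p vs)"
  using frm_mult[OF P B smooth_on_const \<alpha>] .

lemma frm_diff:
  assumes P: "open P" and B: "openin X B" and "frm P B q \<alpha>" "frm P B q \<beta>"
  shows "frm P B q (\<lambda>x p vs. \<alpha> x p vs - \<beta> x p vs)"
  using frm_add[OF P B assms(3) frm_cmult[OF P B assms(4), of "-1"]] by simp

lemma rep_change:
  assumes c: "c \<in> A" "c' \<in> A" and y: "y \<in> ph c' ` (dm c' \<inter> dm c)"
  shows "rep c' \<alpha> y es = rep c \<alpha> (ph c (iv c' y)) (map (FD (\<lambda>y. ph c (iv c' y)) y) es)"
proof -
  obtain p where p: "p \<in> dm c" "p \<in> dm c'" "y = ph c' p" using y by auto
  have "cv c' p = (\<lambda>e. cv c p (FD (\<lambda>y. ph c (iv c' y)) (ph c' p) e))"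
    by (rule ext) (rule cv_change[OF c(1) p(1) c(2) p(2)])
  then show ?thesis using c p by (simp add: rep_eq o_def)
qed

text \<open>In another chart the coefficients are those of the pullback along the transition map.
  Its derivative acts on the arguments, which thereby move with the point, and
  \<open>Cinf_on_sform_args\<close> applies.\<close>

lemma frm_chartI:
  assumes P: "open P" and c: "c \<in> A" and B: "openin X B" "B \<subseteq> dm c"
    and R: "sform (ph c ` B \<times> P) q (\<lambda>(y, x). rep c (\<alpha> x) y)"
  shows "frm P B q \<alpha>"
  unfolding frm_def
proof
  fix c' assume c': "c' \<in> A"
  let ?S = "ph c' ` (dm c' \<inter> B)" and ?g = "\<lambda>y. ph c (iv c' y)"
  have o: "open ?S" by (rule chart_open_image_Int[OF c' B(1)])
  then have oP: "open (?S \<times> P)" by (intro open_Times P)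
  have g: "Cinf_on ?S ?g" by (rule Cinf_on_subset[OF chart_transition[OF c' c]]) (use B in auto)
  have gS: "?g ` ?S \<subseteq> ph c ` B" using c' by auto
  have "sform (?S \<times> P) q (\<lambda>z. (\<lambda>(y, x). rep c (\<alpha> x) y) (?g (fst z), snd z))"
    by (rule sform_compose[OF R _ oP]) (use gS in \<open>auto intro!: Cinf_intros Cinf_on_fst_lift g o P oP\<close>)
  then have R': "sform (?S \<times> P) q (\<lambda>z. rep c (\<alpha> (snd z)) (?g (fst z)))" by simp
  have "sform (?S \<times> P) q (\<lambda>z es. rep c (\<alpha> (snd z)) (?g (fst z)) (map (FD ?g (fst z)) es))"
    unfolding sform_def
  proof (intro conjI ballI allI impI)
    fix z assume z: "z \<in> ?S \<times> P"
    then have "linear (FD ?g (fst z))" by (intro has_derivative_linear[OF Cinf_on_has_derivative[OF g]]) auto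
    from altm_map_linear[OF sform_altm[OF R' z] this]
    show "altm q (\<lambda>es. rep c (\<alpha> (snd z)) (?g (fst z)) (map (FD ?g (fst z)) es))" .
  next
    fix es :: "'e list" assume len: "length es = q"
    have "Cinf_on (?S \<times> P) (\<lambda>z. rep c (\<alpha> (snd z)) (?g (fst z)) ([] @ map (\<lambda>w. w z) (map (\<lambda>e z. FD ?g (fst z) e) es)))"
      by (rule Cinf_on_sform_args[OF R' oP])
        (use len in \<open>auto intro!: Cinf_on_fst_lift[of ?S "\<lambda>y. FD ?g y e" for e] Cinf_on_FD g o P\<close>)
    then show "Cinf_on (?S \<times> P) (\<lambda>z. rep c (\<alpha> (snd z)) (?g (fst z)) (map (FD ?g (fst z)) es))"
      by (simp add: o_def)
  qed
  moreover have "(case z of (y, x) \<Rightarrow> rep c' (\<alpha> x) y) es = rep c (\<alpha> (snd z)) (?g (fst z)) (map (FD ?g (fst z)) es)"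
    if "z \<in> ?S \<times> P" for z es
    using rep_change[OF c c', of "fst z" "\<alpha> (snd z)" es] that B(2) by (auto simp: split_def)
  ultimately show "sform (?S \<times> P) q (\<lambda>(y, x). rep c' (\<alpha> x) y)"
    by (subst sform_cong[OF oP])
qed

text \<open>Transport of coordinate coefficients to the manifold; meaningful only over
  \<open>dm c\<close> and on tangent vectors.\<close>

definition lift_form :: "('a, 'e) chart \<Rightarrow> ('e \<Rightarrow> 'e list \<Rightarrow> real) \<Rightarrow> 'a form" where
  "lift_form c R p vs = R (ph c p) (map (cmp c p) vs)"

lemma rep_lift_form: "c \<in> A \<Longrightarrow> y \<in> ph c ` dm c \<Longrightarrow> rep c (lift_form c R) y es = R y es"
  by (auto simp: rep_eq lift_form_def o_def map_idI)

lemma frm_lift_form: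
  assumes P: "open P" and c: "c \<in> A" and B: "openin X B" "B \<subseteq> dm c"
    and R: "sform (ph c ` B \<times> P) q (\<lambda>(y, x). R x y)"
  shows "frm P B q (\<lambda>x. lift_form c (R x))"
proof (rule frm_chartI[OF P c B])
  have "(case z of (y, x) \<Rightarrow> rep c (lift_form c (R x)) y) es = (case z of (y, x) \<Rightarrow> R x y) es"
    if "z \<in> ph c ` B \<times> P" for z es
    using that B c by (auto simp: subset_iff rep_lift_form)
  then show "sform (ph c ` B \<times> P) q (\<lambda>(y, x). rep c (lift_form c (R x)) y)"
    using R by (subst sform_cong[OF open_Times[OF chart_open_image[OF c B] P]])
qed

subsection \<open>Exterior derivative of forms on the manifold\<close>

text \<open>A relation instead of an operator: values off \<open>B\<close> and off tangent vectors
  are irrelevant, so the derivative is not unique as a total function. Restriction to smaller sets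
  costs nothing in this form.\<close>

definition dfm :: "'a set \<Rightarrow> nat \<Rightarrow> 'a form \<Rightarrow> 'a form \<Rightarrow> bool" where
  "dfm B k \<eta> \<omega> \<longleftrightarrow> (\<forall>c\<in>A. \<forall>y\<in>ph c ` (dm c \<inter> B). \<forall>es. length es = Suc k \<longrightarrow> rep c \<omega> y es = dloc (rep c \<eta>) y es)"

lemma has_ext_deriv_iff: "has_ext_deriv X A k \<eta> \<omega> \<longleftrightarrow> dfm (topspace X) k \<eta> \<omega>"
proof -
  have "has_ext_deriv X A k \<eta> \<omega> \<longleftrightarrow> (\<forall>c\<in>A. \<forall>y\<in>ph c ` dm c. \<forall>es. length es = Suc k \<longrightarrow> rep c \<omega> y es = dloc (rep c \<eta>) y es)"
    unfolding has_ext_deriv_def dloc_def omit_def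
    by (auto simp: lessThan_Suc_atMost simp del: sum.lessThan_Suc)
  moreover have "dm c \<inter> topspace X = dm c" if "c \<in> A" for c using chart_sub[OF that] by auto
  ultimately show ?thesis by (simp add: dfm_def)
qed

lemma dfm_rep: "dfm B k \<eta> \<omega> \<Longrightarrow> c \<in> A \<Longrightarrow> y \<in> ph c ` (dm c \<inter> B) \<Longrightarrow> length es = Suc k \<Longrightarrow> rep c \<omega> y es = dloc (rep c \<eta>) y es"
  by (auto simp: dfm_def)

lemma dfm_subset: "dfm B k \<eta> \<omega> \<Longrightarrow> B' \<subseteq> B \<Longrightarrow> dfm B' k \<eta> \<omega>"
  by (auto simp: dfm_def)

lemma dfm_local:
  assumes "\<And>p. p \<in> B \<Longrightarrow> \<exists>V. p \<in> V \<and> dfm V k \<eta> \<omega>"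
  shows "dfm B k \<eta> \<omega>"
  unfolding dfm_def
proof (intro ballI allI impI)
  fix c y and es :: "'e list" assume c: "c \<in> A" and y: "y \<in> ph c ` (dm c \<inter> B)" and len: "length es = Suc k"
  obtain p where p: "p \<in> dm c" "p \<in> B" "y = ph c p" using y by auto
  obtain V where V: "p \<in> V" "dfm V k \<eta> \<omega>" using assms[OF p(2)] by blast
  show "rep c \<omega> y es = dloc (rep c \<eta>) y es" by (rule dfm_rep[OF V(2) c _ len]) (use p V in auto)
qed

lemma dfm_cong:
  assumes B: "openin X B"
    and \<eta>: "\<And>p vs. p \<in> B \<Longrightarrow> length vs = k \<Longrightarrow> set vs \<subseteq> TS p \<Longrightarrow> \<eta> p vs = \<eta>' p vs"
    and \<omega>: "\<And>p vs. p \<in> B \<Longrightarrow> length vs = Suc k \<Longrightarrow> set vs \<subseteq> TS p \<Longrightarrow> \<omega> p vs = \<omega>' p vs"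
    and d: "dfm B k \<eta> \<omega>"
  shows "dfm B k \<eta>' \<omega>'"
  unfolding dfm_def
proof (intro ballI allI impI)
  fix c y and es :: "'e list" assume c: "c \<in> A" and y: "y \<in> ph c ` (dm c \<inter> B)" and len: "length es = Suc k"
  have e1: "rep c \<eta> z fs = rep c \<eta>' z fs" if "z \<in> ph c ` (dm c \<inter> B)" "length fs = k" for z fs
    using that c cv_tangent[OF c] by (auto simp: rep_eq intro!: \<eta>)
  have e2: "rep c \<omega> y es = rep c \<omega>' y es"
    using y c cv_tangent[OF c] len by (auto simp: rep_eq intro!: \<omega>)
  have "dloc (rep c \<eta>) y es = dloc (rep c \<eta>') y es"
    by (rule dloc_cong[OF chart_open_image_Int[OF c B] y]) (use len in \<open>auto intro!: e1\<close>)
  then show "rep c \<omega>' y es = dloc (rep c \<eta>') y es" using dfm_rep[OF d c y len] e2 by simp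
qed

text \<open>The exterior derivative commutes with pullback along transition maps, so the one chart
  containing \<open>B\<close> decides.\<close>

lemma dfm_chartI:
  assumes c: "c \<in> A" and B: "openin X B" "B \<subseteq> dm c"
    and \<eta>: "sform (ph c ` B) k (rep c \<eta>)"
    and d: "\<And>y es. y \<in> ph c ` B \<Longrightarrow> length es = Suc k \<Longrightarrow> rep c \<omega> y es = dloc (rep c \<eta>) y es"
  shows "dfm B k \<eta> \<omega>"
  unfolding dfm_def
proof (intro ballI allI impI)
  fix c' y and es :: "'e list" assume c': "c' \<in> A" and y: "y \<in> ph c' ` (dm c' \<inter> B)" and len: "length es = Suc k"
  let ?S = "ph c' ` (dm c' \<inter> B)" and ?g = "\<lambda>y. ph c (iv c' y)"
  have o: "open ?S" by (rule chart_open_image_Int[OF c' B(1)])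
  have g: "Cinf_on ?S ?g" by (rule Cinf_on_subset[OF chart_transition[OF c' c]]) (use B in auto)
  have gS: "?g ` ?S \<subseteq> ph c ` B" using c' by auto
  have ch: "rep c' \<alpha> z fs = rep c \<alpha> (?g z) (map (FD ?g z) fs)" if "z \<in> ?S" for z fs \<alpha>
    using that B(2) by (intro rep_change[OF c c']) auto
  have "dloc (rep c' \<eta>) y es = dloc (\<lambda>z fs. rep c \<eta> (?g z) (map (FD ?g z) fs)) y es"
    by (rule dloc_cong[OF o y]) (rule ch)
  also have "\<dots> = dloc (rep c \<eta>) (?g y) (map (FD ?g y) es)"
    by (rule dloc_pullback[OF \<eta> chart_open_image[OF c B] g gS o y len])
  also have "\<dots> = rep c \<omega> (?g y) (map (FD ?g y) es)"
    using gS y len by (intro d[symmetric]) auto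
  also have "\<dots> = rep c' \<omega> y es" by (rule ch[OF y, symmetric])
  finally show "rep c' \<omega> y es = dloc (rep c' \<eta>) y es" by simp
qed

lemma dfm_diff:
  assumes B: "openin X B" and \<eta>: "frm P B k \<eta>" "frm P B k \<eta>'" and x: "x \<in> P"
    and d: "dfm B k (\<eta> x) \<omega>" "dfm B k (\<eta>' x) \<omega>'"
  shows "dfm B k (\<lambda>p vs. \<eta> x p vs - \<eta>' x p vs) (\<lambda>p vs. \<omega> p vs - \<omega>' p vs)"
  unfolding dfm_def
proof (intro ballI allI impI)
  fix c y and es :: "'e list" assume c: "c \<in> A" and y: "y \<in> ph c ` (dm c \<inter> B)" and len: "length es = Suc k"
  have o: "openin X (dm c \<inter> B)" using chart_open[OF c] B by auto
  have s: "sform (ph c ` (dm c \<inter> B)) k (rep c (\<eta> x))" "sform (ph c ` (dm c \<inter> B)) k (rep c (\<eta>' x))"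
    by (rule frm_sform1[OF _ c o _ _ x], (rule \<eta>)?; auto)+
  have "rep c (\<lambda>p vs. \<eta> x p vs - \<eta>' x p vs) = (\<lambda>z fs. rep c (\<eta> x) z fs - rep c (\<eta>' x) z fs)"
    by (intro ext) (simp add: rep_eq)
  then show "rep c (\<lambda>p vs. \<omega> p vs - \<omega>' p vs) y es = dloc (rep c (\<lambda>p vs. \<eta> x p vs - \<eta>' x p vs)) y es"
    using dloc_diff[OF s y len] dfm_rep[OF d(1) c y len] dfm_rep[OF d(2) c y len] by (simp add: rep_eq)
qed

subsection \<open>Comparison with the definition by vector fields\<close>

lemma prod_atlas_smooth_iff:
  assumes P: "open P"
  shows "smooth_fun (prod_atlas A P) F \<longleftrightarrow> (\<forall>c\<in>A. Cinf_on (ph c ` dm c \<times> P) (\<lambda>(y, x). F (iv c y, x)))"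
proof -
  have "Cinf_on (map_prod (ph c) id ` (dm c \<times> P)) (F \<circ> inv_into (dm c \<times> P) (map_prod (ph c) id))
    \<longleftrightarrow> Cinf_on (ph c ` dm c \<times> P) (\<lambda>(y, x). F (iv c y, x))" if c: "c \<in> A" for c
  proof -
    have im: "map_prod (ph c) id ` (dm c \<times> P) = ph c ` dm c \<times> P" by (auto simp: map_prod_def)
    have inj: "inj_on (map_prod (ph c) id) (dm c \<times> P)"
      using chart_inj[OF c] by (auto simp: inj_on_def)
    have "(F \<circ> inv_into (dm c \<times> P) (map_prod (ph c) id)) z = (case z of (y, x) \<Rightarrow> F (iv c y, x))"
      if "z \<in> ph c ` dm c \<times> P" for z
    proof -
      obtain p x where p: "p \<in> dm c" "x \<in> P" "z = (ph c p, x)" using \<open>z \<in> ph c ` dm c \<times> P\<close> by auto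
      have "inv_into (dm c \<times> P) (map_prod (ph c) id) (map_prod (ph c) id (p, x)) = (p, x)"
        by (rule inv_into_f_f[OF inj]) (use p in auto)
      then show ?thesis using p c by simp
    qed
    then show ?thesis unfolding im
      by (intro Cinf_on_cong open_Times chart_image_open c P)
  qed
  then show ?thesis by (auto simp: smooth_fun_def prod_atlas_def)
qed

text \<open>Constant coordinate vectors are locally the values of global fields, so testing on
  global fields controls each coefficient, jointly with the parameter.\<close>

lemma smooth_family_imp_frm:
  assumes P: "open P" and \<tau>: "smooth_family X A P q \<tau>"
  shows "frm P (topspace X) q \<tau>"
  unfolding frm_def sform_def
proof (intro ballI conjI allI impI)
  fix c z assume c: "c \<in> A" and "z \<in> ph c ` (dm c \<inter> topspace X) \<times> P"
  then obtain p x where p: "p \<in> dm c" "p \<in> topspace X" "x \<in> P" "z = (ph c p, x)" by auto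
  then have "alternating_multilinear q (TS p) (\<tau> x p)"
    using \<tau> by (auto simp: smooth_family_def smooth_forms_def)
  then show "altm q (case z of (y, x) \<Rightarrow> rep c (\<tau> x) y)"
    unfolding alternating_multilinear_iff[OF c p(1)] using p c by (simp add: rep_eq[abs_def])
next
  fix c and es :: "'e list" assume c: "c \<in> A" and len: "length es = q"
  show "Cinf_on (ph c ` (dm c \<inter> topspace X) \<times> P) (\<lambda>z. (case z of (y, x) \<Rightarrow> rep c (\<tau> x) y) es)"
  proof (rule Cinf_on_local)
    fix z assume "z \<in> ph c ` (dm c \<inter> topspace X) \<times> P"
    then obtain p x where p: "p \<in> dm c" "x \<in> P" "z = (ph c p, x)" by auto
    obtain W Y where W: "openin X W" "p \<in> W" "W \<subseteq> dm c"
      and Y: "\<And>e. Y e \<in> vector_fields X A" "\<And>e q. q \<in> W \<Longrightarrow> Y e q = cv c q e"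
      using vector_field_extension[OF c p(1)] by blast
    let ?Ys = "map Y es"
    have "smooth_fun (prod_atlas A P) (\<lambda>(m, x). form_eval (\<tau> x) ?Ys m)"
    proof -
      have "set ?Ys \<subseteq> vector_fields X A" "length ?Ys = q" using Y(1) len by auto
      then show ?thesis using \<tau> unfolding smooth_family_def by blast
    qed
    then have C: "Cinf_on (ph c ` dm c \<times> P) (\<lambda>(y, x). form_eval (\<tau> x) ?Ys (iv c y))"
      using c by (simp add: prod_atlas_smooth_iff[OF P])
    have o: "open (ph c ` W)" by (rule chart_open_image[OF c W(1,3)])
    have "Cinf_on (ph c ` W \<times> P) (\<lambda>z. (case z of (y, x) \<Rightarrow> rep c (\<tau> x) y) es)"
    proof (rule Cinf_on_congI)
      show "Cinf_on (ph c ` W \<times> P) (\<lambda>(y, x). form_eval (\<tau> x) ?Ys (iv c y))"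
        by (rule Cinf_on_subset[OF C]) (use W in auto)
      fix z assume "z \<in> ph c ` W \<times> P"
      then obtain q x where "q \<in> W" "z = (ph c q, x)" by auto
      then show "(case z of (y, x) \<Rightarrow> rep c (\<tau> x) y) es = (case z of (y, x) \<Rightarrow> form_eval (\<tau> x) ?Ys (iv c y))"
        using W(3) c by (auto simp: rep_eq form_eval_def Y(2) subset_iff o_def)
    qed (intro open_Times o P)
    then show "\<exists>T. open T \<and> z \<in> T \<and> Cinf_on (T \<inter> ph c ` (dm c \<inter> topspace X) \<times> P) (\<lambda>z. (case z of (y, x) \<Rightarrow> rep c (\<tau> x) y) es)"
      using o P p W by (intro exI[of _ "ph c ` W \<times> P"]) (auto intro: Cinf_on_subset open_Times)
  qed (intro open_Times P chart_open_image_Int[OF c] openin_topspace)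
qed

text \<open>In a chart, global fields become arguments that move smoothly with the point, by
  \<open>vector_field_cmp_Cinf\<close>, and are fed into the smooth coefficients.\<close>

lemma frm_imp_smooth_family:
  fixes P :: "'p::finite_dim_inner set"
  assumes P: "open P" and \<tau>: "frm P (topspace X) q \<tau>"
  shows "smooth_family X A P q \<tau>"
proof -
  have C: "Cinf_on (ph c ` dm c \<times> P) (\<lambda>(y, x). form_eval (\<tau> x) Ys (iv c y))"
    if c: "c \<in> A" and Ys: "length Ys = q" "set Ys \<subseteq> vector_fields X A" for c Ys
  proof -
    let ?S = "ph c ` dm c \<times> P"
    have o: "open (ph c ` dm c)" and S: "open ?S" by (intro open_Times P chart_image_open c)+
    have R: "sform ?S q (\<lambda>(y, x). rep c (\<tau> x) y)"
      by (rule frm_sform[OF \<tau> c chart_sub[OF c]]) simp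
    let ?Ws = "map (\<lambda>Y (z::'e \<times> 'p). cmp c (iv c (fst z)) (Y (iv c (fst z)))) Ys"
    have "Cinf_on ?S (\<lambda>z. (case z of (y, x) \<Rightarrow> rep c (\<tau> x) y) ([] @ map (\<lambda>w. w z) ?Ws))"
    proof (rule Cinf_on_sform_args[OF R S])
      fix w assume "w \<in> set ?Ws"
      then obtain Y where Y: "Y \<in> vector_fields X A" "w = (\<lambda>z::'e \<times> 'p. cmp c (iv c (fst z)) (Y (iv c (fst z))))"
        using Ys by auto
      show "Cinf_on ?S w" unfolding Y(2)
        by (rule Cinf_on_fst_lift[OF vector_field_cmp_Cinf[OF Y(1) c] o P])
    qed (use Ys in simp)
    then show ?thesis
    proof (rule Cinf_on_congI[OF _ S])
      fix z assume "z \<in> ?S"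
      then obtain p x where p: "p \<in> dm c" "x \<in> P" "z = (ph c p, x)" by auto
      have "Y p \<in> TS p" if "Y \<in> set Ys" for Y
        using that Ys(2) p chart_sub[OF c] by (auto simp: vector_fields_def subset_iff)
      then show "(case z of (y, x) \<Rightarrow> form_eval (\<tau> x) Ys (iv c y)) = (case z of (y, x) \<Rightarrow> rep c (\<tau> x) y) ([] @ map (\<lambda>w. w z) ?Ws)"
        using p c by (simp add: form_eval_def rep_eq o_def cong: map_cong)
    qed
  qed
  show ?thesis
    unfolding smooth_family_def
  proof (intro conjI ballI allI impI)
    fix Ys assume "length Ys = q" "set Ys \<subseteq> vector_fields X A"
    then show "smooth_fun (prod_atlas A P) (\<lambda>(m, x). form_eval (\<tau> x) Ys m)"
      using C by (simp add: prod_atlas_smooth_iff[OF P])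
  next
    fix x assume x: "x \<in> P"
    show "\<tau> x \<in> smooth_forms X A q"
      unfolding smooth_forms_def
    proof (intro CollectI conjI ballI allI impI)
      fix p assume "p \<in> topspace X"
      then show "alternating_multilinear q (TS p) (\<tau> x p)" using frm_alternating[OF \<tau> _ x] by simp
    next
      fix Ys assume Ys: "length Ys = q" "set Ys \<subseteq> vector_fields X A"
      have "Cinf_on (ph c ` dm c) (\<lambda>y. form_eval (\<tau> x) Ys (iv c y))" if c: "c \<in> A" for c
      proof -
        have "Cinf_on (ph c ` dm c) (\<lambda>y. (\<lambda>(y, x). form_eval (\<tau> x) Ys (iv c y)) (y, x))"
          by (rule Cinf_on_compose[OF C[OF c Ys]]) (use x c in \<open>auto intro!: Cinf_intros chart_image_open\<close>)
        then show ?thesis by simp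
      qed
      then show "smooth_fun A (form_eval (\<tau> x) Ys)" by (auto simp: smooth_fun_def o_def)
    qed
  qed
qed

lemma smooth_form_imp_frm:
  assumes P: "open P" and \<eta>: "\<eta> \<in> smooth_forms X A q"
  shows "frm P (topspace X) q (\<lambda>_. \<eta>)"
proof (rule smooth_family_imp_frm[OF P])
  have "Cinf_on (ph c ` dm c \<times> P) (\<lambda>z. form_eval \<eta> Ys (iv c (fst z)))"
    if c: "c \<in> A" and Ys: "length Ys = q" "set Ys \<subseteq> vector_fields X A" for c Ys
  proof (rule Cinf_on_fst_lift[OF _ chart_image_open[OF c] P])
    have "smooth_fun A (form_eval \<eta> Ys)" using \<eta> Ys by (auto simp: smooth_forms_def)
    then show "Cinf_on (ph c ` dm c) (\<lambda>y. form_eval \<eta> Ys (iv c y))"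
      using c by (cases c) (auto simp: smooth_fun_def o_def)
  qed
  then show "smooth_family X A P q (\<lambda>_. \<eta>)"
    using \<eta> by (simp add: smooth_family_def prod_atlas_smooth_iff[OF P] split_def)
qed

end

section \<open>Good covers\<close>

context smooth_mfd
begin

text \<open>Since the \<open>S j\<close> are closed and locally finite, a small neighbourhood of
  \<open>p\<close> meets only those, finitely many, that contain \<open>p\<close>. A ball in one
  chart that is small enough for the corresponding transition maps is convex in all of their
  charts.\<close>

lemma convex_neighbourhood:
  assumes S: "\<And>j::nat. closedin X (S j) \<and> d j \<in> A \<and> S j \<subseteq> dm (d j)"
    and lf: "\<And>p. p \<in> topspace X \<Longrightarrow> \<exists>W. openin X W \<and> p \<in> W \<and> finite {j. S j \<inter> W \<noteq> {}}"
    and p: "p \<in> topspace X"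
  shows "\<exists>N. openin X N \<and> p \<in> N \<and> (\<forall>j. N \<inter> S j \<noteq> {} \<longrightarrow> N \<subseteq> dm (d j) \<and> convex (ph (d j) ` N))"
proof -
  obtain W where W: "openin X W" "p \<in> W" "finite {j. S j \<inter> W \<noteq> {}}" using lf[OF p] by blast
  obtain c where c: "c \<in> A" "p \<in> dm c" using chart_cover[OF p] by blast
  define J where "J = {j. S j \<inter> W \<noteq> {} \<and> p \<in> S j}"
  have finJ: "finite J" using W(3) by (rule finite_subset[rotated]) (auto simp: J_def)
  have dA: "d j \<in> A" for j using S by blast
  \<comment> \<open>Avoids the sets \<open>S j\<close> that meet \<open>W\<close> but miss
    \<open>p\<close>, and stays inside the charts of those that contain \<open>p\<close>.\<close>
  define V where "V = (W \<inter> dm c) \<inter> (topspace X - (\<Union>j\<in>{j. S j \<inter> W \<noteq> {}} - J. S j)) \<inter> (topspace X \<inter> (\<Inter>j\<in>J. dm (d j)))"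
  have V: "openin X V"
  proof -
    have "closedin X (\<Union>j\<in>{j. S j \<inter> W \<noteq> {}} - J. S j)"
      using W(3) S by (intro closedin_Union) auto
    then have 1: "openin X (topspace X - (\<Union>j\<in>{j. S j \<inter> W \<noteq> {}} - J. S j))" by auto
    have 2: "openin X (topspace X \<inter> (\<Inter>j\<in>J. dm (d j)))"
    proof (cases "J = {}")
      case False
      then have "openin X (\<Inter>j\<in>J. dm (d j))" using finJ chart_open[OF dA] by (intro openin_INT2) auto
      then show ?thesis by auto
    qed simp
    show ?thesis unfolding V_def
      by (rule openin_Int[OF openin_Int[OF openin_Int[OF W(1) chart_open[OF c(1)]] 1] 2])
  qed
  have pV: "p \<in> V" using W(2) c(2) p S by (auto simp: V_def J_def)
  have VJ: "j \<in> J" if "q \<in> V" "q \<in> S j" for q j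
    using that by (auto simp: V_def J_def)
  have Vd: "V \<subseteq> dm (d j)" if "j \<in> J" for j using that by (auto simp: V_def)
  have Vc: "V \<subseteq> dm c" by (auto simp: V_def)
  have oc: "open (ph c ` V)" by (rule chart_open_image[OF c(1) V Vc])
  have "ph c p \<in> ph c ` V" using pV by auto
  then obtain r' where r': "r' > 0" "ball (ph c p) r' \<subseteq> ph c ` V" using oc open_contains_ball by blast
  have "\<exists>r0>0. \<forall>r. 0 < r \<longrightarrow> r \<le> r0 \<longrightarrow> convex ((\<lambda>y. ph (d j) (iv c y)) ` ball (ph c p) r)" if j: "j \<in> J" for j
  proof -
    have pe: "ph c (iv (d j) (ph (d j) p)) = ph c p" using Vd[OF j] pV dA by auto
    have "\<exists>r0>0. \<forall>r. 0 < r \<longrightarrow> r \<le> r0 \<longrightarrow> ball (ph c (iv (d j) (ph (d j) p))) r \<subseteq> ph c ` V \<and>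
        convex ((\<lambda>y. ph (d j) (iv c y)) ` ball (ph c (iv (d j) (ph (d j) p))) r)"
    proof (rule Cinf_diffeo_small_ball_convex[where S="ph (d j) ` V" and T="ph c ` V"
        and f="\<lambda>y. ph c (iv (d j) y)" and g="\<lambda>y. ph (d j) (iv c y)" and a="ph (d j) p"])
      show "open (ph (d j) ` V)" by (rule chart_open_image[OF dA V Vd[OF j]])
      show "Cinf_on (ph (d j) ` V) (\<lambda>y. ph c (iv (d j) y))"
        by (rule Cinf_on_subset[OF chart_transition[OF dA c(1)]]) (use Vd[OF j] Vc in auto)
      show "Cinf_on (ph c ` V) (\<lambda>y. ph (d j) (iv c y))"
        by (rule Cinf_on_subset[OF chart_transition[OF c(1) dA]]) (use Vd[OF j] Vc in auto)
      have e1: "iv (d j) (ph (d j) q) = q" "iv c (ph c q) = q" if "q \<in> V" for q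
        using that Vd[OF j] Vc dA c(1) by auto
      show "(\<lambda>y. ph c (iv (d j) y)) ` ph (d j) ` V \<subseteq> ph c ` V" using e1 by auto
      show "(\<lambda>y. ph (d j) (iv c y)) ` ph c ` V \<subseteq> ph (d j) ` V" using e1 by auto
      show "ph (d j) (iv c (ph c (iv (d j) y))) = y" if "y \<in> ph (d j) ` V" for y using that e1 by auto
      show "ph c (iv (d j) (ph (d j) (iv c y))) = y" if "y \<in> ph c ` V" for y using that e1 by auto
      show "ph (d j) p \<in> ph (d j) ` V" using pV by auto
    qed (rule oc)
    then show ?thesis unfolding pe by blast
  qed
  then obtain r0 where r0: "\<And>j. j \<in> J \<Longrightarrow> r0 j > 0"
    "\<And>j r. j \<in> J \<Longrightarrow> 0 < r \<Longrightarrow> r \<le> r0 j \<Longrightarrow> convex ((\<lambda>y. ph (d j) (iv c y)) ` ball (ph c p) r)"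
    by metis
  define r where "r = Min (insert r' (r0 ` J))"
  have r: "0 < r" "r \<le> r'" "\<And>j. j \<in> J \<Longrightarrow> r \<le> r0 j"
    using finJ r' r0(1) by (auto simp: r_def)
  define N where "N = iv c ` ball (ph c p) r"
  have ballV: "ball (ph c p) r \<subseteq> ph c ` V" using r(2) r'(2) by auto
  then have NV: "N \<subseteq> V" using iv_in_sub[OF c(1) Vc] by (auto simp: N_def)
  have "N = {q \<in> dm c. ph c q \<in> ph c ` V \<inter> ball (ph c p) r}"
  proof (intro equalityI subsetI)
    fix q assume "q \<in> N"
    then obtain y where y: "y \<in> ball (ph c p) r" "q = iv c y" by (auto simp: N_def)
    then obtain q' where "q' \<in> V" "y = ph c q'" using ballV by blast
    then show "q \<in> {q \<in> dm c. ph c q \<in> ph c ` V \<inter> ball (ph c p) r}" using y Vc c(1) by auto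
  next
    fix q assume "q \<in> {q \<in> dm c. ph c q \<in> ph c ` V \<inter> ball (ph c p) r}"
    then show "q \<in> N" unfolding N_def using c(1) by (metis (mono_tags, lifting) IntD2 imageI iv_ph mem_Collect_eq)
  qed
  then have N: "openin X N" using chart_openin_vimage[OF c(1) open_Int[OF oc open_ball]] by simp
  have "iv c (ph c p) \<in> N" unfolding N_def using r(1) by (intro imageI) simp
  then have pN: "p \<in> N" using c by simp
  have "N \<subseteq> dm (d j) \<and> convex (ph (d j) ` N)" if "N \<inter> S j \<noteq> {}" for j
  proof -
    have j: "j \<in> J" using that NV VJ by blast
    have "ph (d j) ` N = (\<lambda>y. ph (d j) (iv c y)) ` ball (ph c p) r" by (simp add: N_def image_image)
    then show ?thesis using r0(2)[OF j r(1) r(3)[OF j]] NV Vd[OF j] by auto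
  qed
  then show ?thesis using N pN by blast
qed

text \<open>Intersecting inside the space gives the empty list the value
  \<open>topspace X\<close>.\<close>

definition BI :: "(nat \<Rightarrow> 'a set) \<Rightarrow> nat list \<Rightarrow> 'a set" where
  "BI B I = {p \<in> topspace X. \<forall>i\<in>set I. p \<in> B i}"

text \<open>Two rounds: a partition of unity subordinate to the charts supplies closed sets
  \<open>S j\<close>, and a second one is subordinate to the neighbourhoods adapted to them. A point
  of an intersection lies in some \<open>S j\<close>; all members through that point are then convex
  in the one chart \<open>d j\<close>, and so is their intersection.\<close>

lemma good_cover_exists:
  assumes ne: "topspace X \<noteq> {}"
  shows "\<exists>(B :: nat \<Rightarrow> 'a set) \<rho> K. (\<forall>i. openin X (B i) \<and> \<rho> i \<in> SF \<and> closedin X (K i) \<and> K i \<subseteq> B i \<and>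
      (\<forall>q. q \<notin> K i \<longrightarrow> \<rho> i q = 0)) \<and>
    (\<forall>p\<in>topspace X. \<exists>W. openin X W \<and> p \<in> W \<and> finite {i. K i \<inter> W \<noteq> {}}) \<and>
    (\<forall>p\<in>topspace X. (\<Sum>i | \<rho> i p \<noteq> 0. \<rho> i p) = 1) \<and>
    (\<forall>I. I \<noteq> [] \<longrightarrow> BI B I \<noteq> {} \<longrightarrow> (\<exists>c\<in>A. BI B I \<subseteq> dm c \<and> convex (ph c ` BI B I)))"
proof -
  obtain ch where ch: "\<And>p. p \<in> topspace X \<Longrightarrow> ch p \<in> A \<and> p \<in> dm (ch p)" using chart_cover by metis
  have chN: "\<forall>p\<in>topspace X. openin X (dm (ch p)) \<and> p \<in> dm (ch p)" using ch chart_open by blast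
  obtain \<sigma> :: "nat \<Rightarrow> 'a \<Rightarrow> real" and s S where S:
    "\<And>j. s j \<in> topspace X" "\<And>j. closedin X (S j)" "\<And>j. S j \<subseteq> dm (ch (s j))"
    "\<And>j q. q \<notin> S j \<Longrightarrow> \<sigma> j q = 0"
    "\<And>p. p \<in> topspace X \<Longrightarrow> \<exists>W. openin X W \<and> p \<in> W \<and> finite {j. S j \<inter> W \<noteq> {}}"
    "\<And>p. p \<in> topspace X \<Longrightarrow> (\<Sum>j | \<sigma> j p \<noteq> 0. \<sigma> j p) = 1"
    using partition_of_unity[where N="\<lambda>p. dm (ch p)", OF ne chN] by (elim exE conjE) blast
  define d where "d j = ch (s j)" for j
  have d: "closedin X (S j) \<and> d j \<in> A \<and> S j \<subseteq> dm (d j)" for j using S(1-3) ch by (auto simp: d_def)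
  have covS: "\<exists>j. p \<in> S j" if "p \<in> topspace X" for p
  proof (rule ccontr)
    assume "\<nexists>j. p \<in> S j"
    then have "\<sigma> j p = 0" for j using S(4) by blast
    then show False using S(6)[OF that] by simp
  qed
  obtain N where N: "\<And>p. p \<in> topspace X \<Longrightarrow> openin X (N p)" "\<And>p. p \<in> topspace X \<Longrightarrow> p \<in> N p"
    "\<And>p j. p \<in> topspace X \<Longrightarrow> N p \<inter> S j \<noteq> {} \<Longrightarrow> N p \<subseteq> dm (d j) \<and> convex (ph (d j) ` N p)"
    using convex_neighbourhood[OF d S(5)] by metis
  have NN: "\<forall>p\<in>topspace X. openin X (N p) \<and> p \<in> N p" using N by blast
  obtain \<rho> :: "nat \<Rightarrow> 'a \<Rightarrow> real" and t K where K:
    "\<And>i. \<rho> i \<in> SF" "\<And>i. t i \<in> topspace X" "\<And>i. closedin X (K i)" "\<And>i. K i \<subseteq> N (t i)"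
    "\<And>i q. q \<notin> K i \<Longrightarrow> \<rho> i q = 0"
    "\<forall>p\<in>topspace X. \<exists>W. openin X W \<and> p \<in> W \<and> finite {i. K i \<inter> W \<noteq> {}}"
    "\<forall>p\<in>topspace X. (\<Sum>i | \<rho> i p \<noteq> 0. \<rho> i p) = 1"
    using partition_of_unity[where N=N, OF ne NN] by (elim exE conjE) blast
  define B where "B i = N (t i)" for i
  have "\<exists>c\<in>A. BI B I \<subseteq> dm c \<and> convex (ph c ` BI B I)" if I: "I \<noteq> []" "BI B I \<noteq> {}" for I
  proof -
    obtain q where q: "q \<in> BI B I" using I by blast
    obtain j where j: "q \<in> S j" using covS q by (auto simp: BI_def)
    have Bj: "B i \<subseteq> dm (d j) \<and> convex (ph (d j) ` B i)" if "i \<in> set I" for i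
      unfolding B_def by (rule N(3)[OF K(2)]) (use q j that in \<open>auto simp: BI_def B_def\<close>)
    have "B i \<subseteq> topspace X" for i using N(1)[OF K(2)] openin_subset by (auto simp: B_def)
    then have eq: "BI B I = (\<Inter>i\<in>set I. B i)" using I(1) by (auto simp: BI_def) (metis list.set_sel(1) subsetD)
    have inj: "inj_on (ph (d j)) (dm (d j))" using chart_inj d by blast
    obtain i0 where i0: "i0 \<in> set I" using I(1) by (cases I) auto
    have "ph (d j) ` (\<Inter>i\<in>set I. B i) = (\<Inter>i\<in>set I. ph (d j) ` B i)"
      by (rule image_INT[OF inj _ i0]) (use Bj in auto)
    then have "convex (ph (d j) ` BI B I)" using Bj eq by (simp add: convex_INT)
    moreover have "BI B I \<subseteq> dm (d j)" using eq Bj i0 by blast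
    ultimately show ?thesis using d by blast
  qed
  then have "\<forall>I. I \<noteq> [] \<longrightarrow> BI B I \<noteq> {} \<longrightarrow> (\<exists>c\<in>A. BI B I \<subseteq> dm c \<and> convex (ph c ` BI B I))" by blast
  moreover have "\<forall>i. openin X (B i) \<and> \<rho> i \<in> SF \<and> closedin X (K i) \<and> K i \<subseteq> B i \<and> (\<forall>q. q \<notin> K i \<longrightarrow> \<rho> i q = 0)"
    using K N by (simp add: B_def)
  ultimately show ?thesis using K(6,7) by (intro exI[of _ B] exI[of _ \<rho>] exI[of _ K] conjI)
qed

section \<open>Primitives and derivatives in a single chart\<close>

text \<open>Freezes the parameter, since single forms are handled as constant families.\<close>

lemma frm_const:
  assumes P: "open P" and B: "openin X B" and \<alpha>: "frm P B q \<alpha>" and x: "x \<in> P"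
  shows "frm P B q (\<lambda>_. \<alpha> x)"
  unfolding frm_def
proof
  fix c assume c: "c \<in> A"
  let ?S = "ph c ` (dm c \<inter> B)"
  have o: "open ?S" by (rule chart_open_image_Int[OF c B])
  have "openin X (dm c \<inter> B)" using chart_open[OF c] B by auto
  then have s: "sform ?S q (rep c (\<alpha> x))" by (intro frm_sform1[OF \<alpha> c _ _ _ x]) auto
  have "sform (?S \<times> P) q (\<lambda>z. rep c (\<alpha> x) (fst z))"
    by (rule sform_compose[OF s]) (use o P in \<open>auto intro!: Cinf_intros open_Times\<close>)
  then show "sform (?S \<times> P) q (\<lambda>(y, _). rep c (\<alpha> x) y)" by (simp add: split_def)
qed

lemma dfm_closed:
  assumes B: "openin X B" and \<eta>: "frm P B k \<eta>" "x \<in> P" and d: "dfm B k (\<eta> x) \<omega>"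
  shows "dfm B (Suc k) \<omega> (\<lambda>p vs. 0)"
  unfolding dfm_def
proof (intro ballI allI impI)
  fix c y and es :: "'e list" assume c: "c \<in> A" and y: "y \<in> ph c ` (dm c \<inter> B)" and len: "length es = Suc (Suc k)"
  have o: "open (ph c ` (dm c \<inter> B))" by (rule chart_open_image_Int[OF c B])
  have oB: "openin X (dm c \<inter> B)" using chart_open[OF c] B by auto
  have s: "sform (ph c ` (dm c \<inter> B)) k (rep c (\<eta> x))"
    by (rule frm_sform1[OF \<eta>(1) c oB _ _ \<eta>(2)]) auto
  have "dloc (rep c \<omega>) y es = dloc (dloc (rep c (\<eta> x))) y es"
    by (rule dloc_cong[OF o y]) (use len in \<open>auto intro!: dfm_rep[OF d c]\<close>)
  also have "\<dots> = 0" by (rule dloc_dloc[OF s o y len])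
  finally show "rep c (\<lambda>p vs. 0) y es = dloc (rep c \<omega>) y es" by (simp add: rep_eq)
qed

lemma frm_empty: "frm P {} q \<alpha>"
  by (simp add: frm_def sform_def Cinf_on_empty)

lemma dfm_empty: "dfm {} k \<eta> \<omega>"
  by (simp add: dfm_def)

text \<open>The centre \<open>b\<close> of the contraction does not depend on \<open>x\<close>, so
  the homotopy operator acts on the whole family at once and keeps it smooth.\<close>

lemma local_primitive:
  assumes P: "open P" and B: "openin X B" and good: "B = {} \<or> (\<exists>c\<in>A. B \<subseteq> dm c \<and> convex (ph c ` B))"
    and a: "frm P B (Suc q) a" and closed: "\<And>x. x \<in> P \<Longrightarrow> dfm B (Suc q) (a x) (\<lambda>p vs. 0)"
  shows "\<exists>\<alpha>. frm P B q \<alpha> \<and> (\<forall>x\<in>P. dfm B q (\<alpha> x) (a x))"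
proof (cases "B = {}")
  case True
  then show ?thesis using frm_empty dfm_empty by blast
next
  case False
  then obtain c b where c: "c \<in> A" "B \<subseteq> dm c" "convex (ph c ` B)" and b: "b \<in> ph c ` B" using good by blast
  let ?S = "ph c ` B"
  have S: "open ?S" by (rule chart_open_image[OF c(1) B c(2)])
  define R where "R x = rep c (a x)" for x
  have R: "sform (?S \<times> P) (Suc q) (\<lambda>(y, x). R x y)"
    unfolding R_def by (rule frm_sform[OF a c(1) _ c(2)]) simp
  have R1: "sform ?S (Suc q) (R x)" if "x \<in> P" for x
    unfolding R_def by (rule frm_sform1[OF a c(1) B _ c(2) that]) simp
  define \<alpha> where "\<alpha> x = lift_form c (hloc b (R x))" for x
  have \<alpha>: "frm P B q \<alpha>"
    unfolding \<alpha>_def by (rule frm_lift_form[OF P c(1) B c(2)]) (rule sform_hloc[OF R S c(3) b P])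
  have rep\<alpha>: "rep c (\<alpha> x) y es = hloc b (R x) y es" if "y \<in> ?S" for x y es
    unfolding \<alpha>_def using that c(2) by (intro rep_lift_form[OF c(1)]) auto
  have "dfm B q (\<alpha> x) (a x)" if x: "x \<in> P" for x
  proof (rule dfm_chartI[OF c(1) B c(2)])
    show "sform ?S q (rep c (\<alpha> x))" by (rule frm_sform1[OF \<alpha> c(1) B _ c(2) x]) simp
    fix y and es :: "'e list" assume y: "y \<in> ?S" and len: "length es = Suc q"
    have "dloc (rep c (\<alpha> x)) y es = dloc (hloc b (R x)) y es"
      by (rule dloc_cong[OF S y]) (rule rep\<alpha>)
    also have "\<dots> = R x y es"
    proof (rule poincare_hloc[OF R1[OF x] S c(3) b _ y len])
      fix z and fs :: "'e list" assume z: "z \<in> ?S" and "length fs = Suc (Suc q)"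
      then have "rep c (\<lambda>p vs. 0) z fs = dloc (rep c (a x)) z fs"
        using c(2) by (intro dfm_rep[OF closed[OF x] c(1)]) auto
      then show "dloc (R x) z fs = 0" by (simp add: R_def rep_eq)
    qed
    finally show "rep c (a x) y es = dloc (rep c (\<alpha> x)) y es" by (simp add: R_def)
  qed
  then show ?thesis using \<alpha> by blast
qed

text \<open>Because \<open>dfm\<close> is a relation, a derivative has to be constructed: it is
  computed in the chart and lifted.\<close>

lemma local_derivative:
  assumes P: "open P" and B: "openin X B" and chart: "B = {} \<or> (\<exists>c\<in>A. B \<subseteq> dm c)"
    and \<kappa>: "frm P B q \<kappa>"
  shows "\<exists>D. frm P B (Suc q) D \<and> (\<forall>x\<in>P. dfm B q (\<kappa> x) (D x))"
proof (cases "B = {}")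
  case True
  then show ?thesis using frm_empty dfm_empty by blast
next
  case False
  then obtain c where c: "c \<in> A" "B \<subseteq> dm c" using chart by blast
  let ?S = "ph c ` B"
  have S: "open ?S" by (rule chart_open_image[OF c(1) B c(2)])
  have R: "sform (?S \<times> P) q (\<lambda>(y, x). rep c (\<kappa> x) y)"
    by (rule frm_sform[OF \<kappa> c(1) _ c(2)]) simp
  define D where "D x = lift_form c (dloc (rep c (\<kappa> x)))" for x
  have "frm P B (Suc q) D"
    unfolding D_def by (rule frm_lift_form[OF P c(1) B c(2)]) (rule sform_dloc[OF R S P])
  moreover have "dfm B q (\<kappa> x) (D x)" if x: "x \<in> P" for x
  proof (rule dfm_chartI[OF c(1) B c(2)])
    show "sform ?S q (rep c (\<kappa> x))" by (rule frm_sform1[OF \<kappa> c(1) B _ c(2) x]) simp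
    show "rep c (D x) y es = dloc (rep c (\<kappa> x)) y es" if "y \<in> ?S" for y es
      unfolding D_def using that c(2) by (intro rep_lift_form[OF c(1)]) auto
  qed
  ultimately show ?thesis by blast
qed

lemma dfm_sum:
  assumes B: "openin X B" and \<eta>: "\<And>i. i \<in> I \<Longrightarrow> frm P B k (\<eta> i)" and x: "x \<in> P"
    and d: "\<And>i. i \<in> I \<Longrightarrow> dfm B k (\<eta> i x) (\<omega> i)"
  shows "dfm B k (\<lambda>p vs. \<Sum>i\<in>I. r i * \<eta> i x p vs) (\<lambda>p vs. \<Sum>i\<in>I. r i * \<omega> i p vs)"
  unfolding dfm_def
proof (intro ballI allI impI)
  fix c y and es :: "'e list" assume c: "c \<in> A" and y: "y \<in> ph c ` (dm c \<inter> B)" and len: "length es = Suc k"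
  have o: "openin X (dm c \<inter> B)" using chart_open[OF c] B by auto
  have s: "sform (ph c ` (dm c \<inter> B)) k (rep c (\<eta> i x))" if "i \<in> I" for i
    by (rule frm_sform1[OF \<eta>[OF that] c o _ _ x]) auto
  have "FD (\<lambda>z. rep c (\<lambda>p vs. \<Sum>i\<in>I. r i * \<eta> i x p vs) z (omit j es)) y (es ! j)
    = (\<Sum>i\<in>I. r i * FD (\<lambda>z. rep c (\<eta> i x) z (omit j es)) y (es ! j))" if "j < length es" for j
  proof -
    have l: "length (omit j es) = k" using that len by simp
    have "((\<lambda>z. \<Sum>i\<in>I. r i * rep c (\<eta> i x) z (omit j es)) has_derivative
      (\<lambda>e. \<Sum>i\<in>I. r i * FD (\<lambda>z. rep c (\<eta> i x) z (omit j es)) y e)) (at y)"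
      by (intro has_derivative_sum has_derivative_mult_right sform_has_derivative[OF s l y])
    from FD_eq[OF this] show ?thesis by (simp add: rep_eq)
  qed
  then have "dloc (rep c (\<lambda>p vs. \<Sum>i\<in>I. r i * \<eta> i x p vs)) y es
    = (\<Sum>j<length es. \<Sum>i\<in>I. r i * ((-1) ^ j * FD (\<lambda>z. rep c (\<eta> i x) z (omit j es)) y (es ! j)))"
    by (simp add: dloc_def sum_distrib_left mult.left_commute)
  also have "\<dots> = (\<Sum>i\<in>I. r i * dloc (rep c (\<eta> i x)) y es)"
    unfolding dloc_def sum_distrib_left by (rule sum.swap)
  also have "\<dots> = (\<Sum>i\<in>I. r i * rep c (\<omega> i) y es)"
    by (intro sum.cong refl) (simp add: dfm_rep[OF d c y len])
  finally show "rep c (\<lambda>p vs. \<Sum>i\<in>I. r i * \<omega> i p vs) y es = dloc (rep c (\<lambda>p vs. \<Sum>i\<in>I. r i * \<eta> i x p vs)) y es"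
    by (simp add: rep_eq)
qed

text \<open>Lets an identity between forms be differentiated although \<open>dfm\<close> is only a
  relation.\<close>

lemma dfm_unique:
  assumes B: "openin X B" and d: "dfm B k \<eta> \<omega>" "dfm B k \<eta>' \<omega>'"
    and eq: "\<And>p vs. p \<in> B \<Longrightarrow> length vs = k \<Longrightarrow> set vs \<subseteq> TS p \<Longrightarrow> \<eta> p vs = \<eta>' p vs"
    and p: "p \<in> B" "length vs = Suc k" "set vs \<subseteq> TS p"
  shows "\<omega> p vs = \<omega>' p vs"
proof -
  have "dfm B k \<eta>' \<omega>" by (rule dfm_cong[OF B eq _ d(1)]) auto
  have "p \<in> topspace X" using p B openin_subset by blast
  then obtain c where c: "c \<in> A" "p \<in> dm c" using chart_cover by blast
  define es where "es = map (cmp c p) vs"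
  have es: "map (cv c p) es = vs" unfolding es_def map_map by (rule map_idI) (use p(3) c in auto)
  have y: "ph c p \<in> ph c ` (dm c \<inter> B)" and len: "length es = Suc k" using c p by (auto simp: es_def)
  have "rep c \<omega> (ph c p) es = rep c \<omega>' (ph c p) es"
    using dfm_rep[OF \<open>dfm B k \<eta>' \<omega>\<close> c(1) y len] dfm_rep[OF d(2) c(1) y len] by simp
  then show ?thesis using c es by (simp add: rep_ph)
qed

text \<open>Supplies the smooth right-hand sides of the linear system in degree zero.\<close>

lemma frm_param_Cinf:
  assumes P: "open P" and B: "B \<subseteq> topspace X" and \<alpha>: "frm P B q \<alpha>" and p: "p \<in> B" "length vs = q" "set vs \<subseteq> TS p"
  shows "Cinf_on P (\<lambda>x. \<alpha> x p vs)"
proof -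
  obtain c where c: "c \<in> A" "p \<in> dm c" using chart_cover p B by blast
  define es where "es = map (cmp c p) vs"
  have es: "map (cv c p) es = vs" unfolding es_def map_map by (rule map_idI) (use p(3) c in auto)
  have len: "length es = q" using p by (simp add: es_def)
  have "Cinf_on P (\<lambda>x. (\<lambda>z. (case z of (y, x) \<Rightarrow> rep c (\<alpha> x) y) es) (ph c p, x))"
    by (rule Cinf_on_compose[OF sform_Cinf[OF frm_sform[OF \<alpha> c(1), of "B \<inter> dm c"] len]])
      (use p c P in \<open>auto intro!: Cinf_intros\<close>)
  then show ?thesis using c es by (simp add: rep_ph)
qed

lemma closed_0form_constant_on:
  assumes B: "openin X B" and c: "c \<in> A" "B \<subseteq> dm c" "convex (ph c ` B)"
    and \<alpha>: "frm P B 0 \<alpha>" "x \<in> P" and d: "dfm B 0 (\<alpha> x) (\<lambda>p vs. 0)" and pq: "p \<in> B" "q \<in> B"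
  shows "\<alpha> x p [] = \<alpha> x q []"
proof -
  have "rep c (\<alpha> x) (ph c p) [] = rep c (\<alpha> x) (ph c q) []"
  proof (rule closed_0form_constant[OF _ c(3)])
    show "sform (ph c ` B) 0 (rep c (\<alpha> x))" by (rule frm_sform1[OF \<alpha>(1) c(1) B _ c(2) \<alpha>(2)]) simp
    show "dloc (rep c (\<alpha> x)) z [e] = 0" if "z \<in> ph c ` B" for z e
    proof -
      have "rep c (\<lambda>p vs. 0) z [e] = dloc (rep c (\<alpha> x)) z [e]"
        using that c(2) by (intro dfm_rep[OF d c(1)]) auto
      then show ?thesis by (simp add: rep_eq)
    qed
  qed (use pq in auto)
  then show ?thesis using pq c by (auto simp: rep_ph subset_iff)
qed

text \<open>\<open>\<beta>\<close> is given only on the overlap with \<open>B\<close>; the factor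
  \<open>\<rho>\<close> vanishes off a closed subset of \<open>B\<close>, so near other points the
  product is the zero form.\<close>

lemma frm_extend_zero:
  assumes P: "open P" and B: "openin X B" and C: "openin X C" and K: "closedin X K" "K \<subseteq> B"
    and \<rho>: "\<rho> \<in> SF" "\<And>q. q \<notin> K \<Longrightarrow> \<rho> q = 0" and \<beta>: "frm P (B \<inter> C) q \<beta>"
  shows "frm P C q (\<lambda>x p vs. \<rho> p * \<beta> x p vs)"
proof (rule frm_local[OF P C])
  fix p assume p: "p \<in> C"
  show "\<exists>V. openin X V \<and> p \<in> V \<and> frm P V q (\<lambda>x p vs. \<rho> p * \<beta> x p vs)"
  proof (cases "p \<in> B")
    case True
    have o: "openin X (B \<inter> C)" using B C by auto
    have "smooth_on (B \<inter> C) \<rho>" using \<rho>(1) openin_subset[OF o] by (auto simp: SF_iff intro: smooth_on_subset)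
    then show ?thesis using frm_mult[OF P o _ \<beta>] o p True by blast
  next
    case False
    have o: "openin X (C - K)" using C K(1) by auto
    have "frm P (C - K) q (\<lambda>x p vs. \<rho> p * \<beta> x p vs) \<longleftrightarrow> frm P (C - K) q (\<lambda>x p vs. 0)"
      by (rule frm_cong[OF P o]) (simp add: \<rho>(2))
    then show ?thesis using frm_zero o p False K(2) by blast
  qed
qed

lemma dfm_const0: "dfm B 0 (\<lambda>p vs. r) (\<lambda>p vs. 0)"
  by (simp add: dfm_def rep_eq[abs_def] dloc_def)

end

section \<open>The Cech--de Rham descent\<close>

text \<open>The Cech differential on cochains indexed by arbitrary lists. Restriction to the smaller
  intersection leaves no trace because forms are total functions.\<close>

definition cech :: "(nat list \<Rightarrow> 'a form) \<Rightarrow> nat list \<Rightarrow> 'a form" where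
  "cech a J p vs = (\<Sum>j<length J. (-1) ^ j * a (omit j J) p vs)"

lemma cech_Cons:
  "cech a (i # J) p vs = a J p vs - (\<Sum>j<length J. (-1) ^ j * a (i # omit j J) p vs)"
  by (simp add: cech_def sum.lessThan_Suc_shift sum_negf del: sum.lessThan_Suc)

lemma cech_cech:
  assumes "length J = Suc (Suc m)"
  shows "cech (cech a) J p vs = 0"
proof -
  have "cech (cech a) J p vs = (\<Sum>j<Suc (Suc m). \<Sum>l<Suc m. (-1) ^ (j + l) * a (omit l (omit j J)) p vs)"
    unfolding cech_def[of "cech a"] assms
  proof (rule sum.cong[OF refl])
    fix j assume "j \<in> {..<Suc (Suc m)}"
    then have "length (omit j J) = Suc m" using assms by simp
    then show "(-1) ^ j * cech a (omit j J) p vs = (\<Sum>l<Suc m. (-1) ^ (j + l) * a (omit l (omit j J)) p vs)"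
      by (simp add: cech_def sum_distrib_left power_add mult.assoc del: sum.lessThan_Suc)
  qed
  also have "\<dots> = 0"
    by (rule alternating_double_sum_zero) (simp add: omit_omit assms)
  finally show ?thesis .
qed

lemma cech_diff: "cech (\<lambda>I p vs. a I p vs - b I p vs) J p vs = cech a J p vs - cech b J p vs"
  by (simp add: cech_def right_diff_distrib sum_subtractf)

locale good_cover = smooth_mfd X A
  for X :: "'a topology" and A :: "('a, 'e::finite_dim_inner) chart set" +
  fixes B :: "nat \<Rightarrow> 'a set" and \<rho> :: "nat \<Rightarrow> 'a \<Rightarrow> real" and K :: "nat \<Rightarrow> 'a set"
  assumes B_open: "\<And>i. openin X (B i)"
    and \<rho>_SF: "\<And>i. \<rho> i \<in> smooth_functions X A" and K_closed: "\<And>i. closedin X (K i)" and K_B: "\<And>i. K i \<subseteq> B i"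
    and \<rho>_K: "\<And>i q. q \<notin> K i \<Longrightarrow> \<rho> i q = 0"
    and K_locally_finite: "\<And>p. p \<in> topspace X \<Longrightarrow> \<exists>W. openin X W \<and> p \<in> W \<and> finite {i. K i \<inter> W \<noteq> {}}"
    and \<rho>_sum: "\<And>p. p \<in> topspace X \<Longrightarrow> (\<Sum>i | \<rho> i p \<noteq> 0. \<rho> i p) = 1"
    and good: "\<And>I. I \<noteq> [] \<Longrightarrow> BI B I = {} \<or> (\<exists>c\<in>A. BI B I \<subseteq> fst c \<and> convex (snd c ` BI B I))"
begin

abbreviation BJ :: "nat list \<Rightarrow> 'a set" where "BJ \<equiv> BI B"

lemma BJ_sub: "BJ I \<subseteq> topspace X"
  by (auto simp: BI_def)

lemma BJ_Cons: "BJ (i # I) = B i \<inter> BJ I"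
  by (auto simp: BI_def)

lemma BJ_open: "openin X (BJ I)"
proof (induction I)
  case Nil
  show ?case by (simp add: BI_def)
next
  case (Cons i I)
  then show ?case using B_open by (simp add: BJ_Cons openin_Int)
qed

lemma BJ_omit: "BJ J \<subseteq> BJ (omit j J)"
  by (auto simp: BI_def omit_def dest: in_set_takeD in_set_dropD)

lemma frm_cech:
  assumes P: "open P" and a: "\<And>I. length I = m \<Longrightarrow> frm P (BJ I) q (\<lambda>x. a x I)" and J: "length J = Suc m"
  shows "frm P (BJ J) q (\<lambda>x. cech (a x) J)"
  unfolding cech_def[abs_def]
proof (intro frm_sum frm_cmult P BJ_open)
  fix j assume "j \<in> {..<length J}"
  then show "frm P (BJ J) q (\<lambda>x. a x (omit j J))"
    using J by (intro frm_subset[OF a BJ_omit]) simp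
qed

lemma dfm_cech:
  assumes a: "\<And>I. length I = m \<Longrightarrow> frm P (BJ I) q (\<lambda>x. a x I)" and J: "length J = Suc m" and x: "x \<in> P"
    and d: "\<And>I. length I = m \<Longrightarrow> dfm (BJ I) q (a x I) (b I)"
  shows "dfm (BJ J) q (cech (a x) J) (cech b J)"
  unfolding cech_def[abs_def]
proof (rule dfm_sum[OF BJ_open _ x])
  fix j assume "j \<in> {..<length J}"
  then have l: "length (omit j J) = m" using J by simp
  show "frm P (BJ J) q (\<lambda>x. a x (omit j J))" by (rule frm_subset[OF a[OF l] BJ_omit])
  show "dfm (BJ J) q (a x (omit j J)) (b (omit j J))" by (rule dfm_subset[OF d[OF l] BJ_omit])
qed

text \<open>The contracting homotopy of a partition of unity. Keeping only the indices of nonzero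
  weight makes the sum finite at each point of the manifold.\<close>

definition contr :: "(nat list \<Rightarrow> 'a form) \<Rightarrow> nat list \<Rightarrow> 'a form" where
  "contr t I p vs = (\<Sum>i | \<rho> i p \<noteq> 0. \<rho> i p * t (i # I) p vs)"

text \<open>Each weighted summand extends by zero from \<open>B i\<close> to all of
  \<open>BJ I\<close>, and near a point only finitely many summands are nonzero.\<close>

lemma frm_contr:
  assumes P: "open P" and t: "\<And>J. length J = Suc m \<Longrightarrow> frm P (BJ J) q (\<lambda>x. t x J)" and I: "length I = m"
  shows "frm P (BJ I) q (\<lambda>x. contr (t x) I)"
proof (rule frm_local[OF P BJ_open])
  fix p assume p: "p \<in> BJ I"
  then have "p \<in> topspace X" using BJ_sub by blast
  then obtain W where W: "openin X W" "p \<in> W" "finite {i. K i \<inter> W \<noteq> {}}" using K_locally_finite by blast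
  let ?V = "W \<inter> BJ I" and ?F = "{i. K i \<inter> W \<noteq> {}}"
  have o: "openin X ?V" using W(1) BJ_open by auto
  have "frm P ?V q (\<lambda>x p vs. \<Sum>i\<in>?F. \<rho> i p * t x (i # I) p vs)"
  proof (rule frm_sum[OF P o])
    fix i
    have "frm P (BJ (i # I)) q (\<lambda>x. t x (i # I))" by (rule t) (simp add: I)
    then have "frm P (B i \<inter> BJ I) q (\<lambda>x. t x (i # I))" by (simp only: BJ_Cons)
    then have "frm P (BJ I) q (\<lambda>x p vs. \<rho> i p * t x (i # I) p vs)"
      using \<rho>_K[of _ i] by (intro frm_extend_zero[where K="K i", OF P B_open BJ_open K_closed K_B \<rho>_SF])
    then show "frm P ?V q (\<lambda>x p vs. \<rho> i p * t x (i # I) p vs)" by (rule frm_subset) auto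
  qed
  moreover have "contr (t x) I p vs = (\<Sum>i\<in>?F. \<rho> i p * t x (i # I) p vs)" if "p \<in> ?V" for x p vs
    unfolding contr_def
  proof (rule sum.mono_neutral_left[OF W(3)])
    show "{i. \<rho> i p \<noteq> 0} \<subseteq> ?F" using that \<rho>_K by blast
  qed simp
  ultimately have "frm P ?V q (\<lambda>x. contr (t x) I)"
    using frm_cong[OF P o, where \<alpha>="\<lambda>x. contr (t x) I"] by simp
  then show "\<exists>V. openin X V \<and> p \<in> V \<and> frm P V q (\<lambda>x. contr (t x) I)" using o W p by blast
qed

text \<open>The cocycle condition on \<open>i # J\<close> expresses the value on \<open>J\<close>
  through the faces that keep \<open>i\<close>; averaging over \<open>i\<close> with the weights
  \<open>\<rho> i\<close> gives the claim.\<close>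

lemma cech_contr:
  assumes t: "\<And>J. length J = Suc (Suc m) \<Longrightarrow> p \<in> BJ J \<Longrightarrow> cech t J p vs = 0" and J: "length J = Suc m" and p: "p \<in> BJ J"
  shows "cech (contr t) J p vs = t J p vs"
proof -
  have pX: "p \<in> topspace X" using p BJ_sub by blast
  let ?F = "{i. \<rho> i p \<noteq> 0}"
  have "cech (contr t) J p vs = (\<Sum>j<length J. \<Sum>i\<in>?F. \<rho> i p * ((-1) ^ j * t (i # omit j J) p vs))"
    by (simp add: cech_def contr_def sum_distrib_left mult.left_commute)
  also have "\<dots> = (\<Sum>i\<in>?F. \<rho> i p * (\<Sum>j<length J. (-1) ^ j * t (i # omit j J) p vs))"
    by (subst sum.swap) (simp add: sum_distrib_left)
  also have "\<dots> = (\<Sum>i\<in>?F. \<rho> i p * t J p vs)"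
  proof (rule sum.cong[OF refl])
    fix i assume "i \<in> ?F"
    \<comment> \<open>A nonzero weight places \<open>p\<close> in \<open>B i\<close>, so the cocycle
      condition for \<open>i # J\<close> is available at \<open>p\<close>.\<close>
    then have "p \<in> B i" using \<rho>_K K_B by blast
    then have "cech t (i # J) p vs = 0" using p J by (intro t) (auto simp: BJ_Cons)
    then show "\<rho> i p * (\<Sum>j<length J. (-1) ^ j * t (i # omit j J) p vs) = \<rho> i p * t J p vs"
      by (simp add: cech_Cons)
  qed
  also have "\<dots> = t J p vs" using \<rho>_sum[OF pX] by (simp flip: sum_distrib_right)
  finally show ?thesis .
qed

text \<open>Local primitives \<open>\<alpha>\<close> of \<open>a\<close> need not form a cocycle, but \<open>cech \<alpha>\<close> is pointwise exact one Cech degree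
  higher and one form degree lower. A smooth primitive \<open>t\<close> of it, given by induction, equals
  \<open>cech (contr t)\<close>, and subtracting the derivative of \<open>contr t\<close> from \<open>\<alpha>\<close> makes it a cocycle.\<close>

theorem cech_descent:
  fixes P :: "'p::finite_dim_inner set" and a :: "'p \<Rightarrow> nat list \<Rightarrow> 'a form"
  assumes P: "open P" and a: "\<And>I. length I = Suc m \<Longrightarrow> frm P (BJ I) (Suc q) (\<lambda>x. a x I)"
    and ex: "\<And>x. x \<in> P \<Longrightarrow> \<exists>\<eta>. (\<forall>I. length I = Suc m \<longrightarrow> frm P (BJ I) q (\<lambda>_. \<eta> I) \<and> dfm (BJ I) q (\<eta> I) (a x I)) \<and>
      (\<forall>J p vs. length J = Suc (Suc m) \<longrightarrow> p \<in> BJ J \<longrightarrow> length vs = q \<longrightarrow> set vs \<subseteq> TS p \<longrightarrow> cech \<eta> J p vs = 0)"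
  shows "\<exists>\<tau>. (\<forall>I. length I = Suc m \<longrightarrow> frm P (BJ I) q (\<lambda>x. \<tau> x I) \<and> (\<forall>x\<in>P. dfm (BJ I) q (\<tau> x I) (a x I))) \<and>
      (\<forall>x\<in>P. \<forall>J p vs. length J = Suc (Suc m) \<longrightarrow> p \<in> BJ J \<longrightarrow> length vs = q \<longrightarrow> set vs \<subseteq> TS p \<longrightarrow> cech (\<tau> x) J p vs = 0)"
  using a ex
proof (induction q arbitrary: m a)
  case (0 m a)
  have "\<exists>\<alpha>. frm P (BJ I) 0 \<alpha> \<and> (\<forall>x\<in>P. dfm (BJ I) 0 (\<alpha> x) (a x I))" if I: "length I = Suc m" for I
  proof (rule local_primitive[OF P BJ_open good "0.prems"(1)[OF I]])
    show "I \<noteq> []" using I by auto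
    fix x assume x: "x \<in> P"
    then obtain \<eta> where "frm P (BJ I) 0 (\<lambda>_. \<eta> I)" "dfm (BJ I) 0 (\<eta> I) (a x I)" using "0.prems"(2) I by blast
    then show "dfm (BJ I) (Suc 0) (a x I) (\<lambda>p vs. 0)" using dfm_closed[OF BJ_open _ x] by blast
  qed
  then obtain \<alpha>' where \<alpha>': "\<And>I. length I = Suc m \<Longrightarrow> frm P (BJ I) 0 (\<alpha>' I)"
    "\<And>I x. length I = Suc m \<Longrightarrow> x \<in> P \<Longrightarrow> dfm (BJ I) 0 (\<alpha>' I x) (a x I)" by metis
  define \<alpha> where "\<alpha> x I = \<alpha>' I x" for x I
  have \<alpha>: "frm P (BJ I) 0 (\<lambda>x. \<alpha> x I)" "x \<in> P \<Longrightarrow> dfm (BJ I) 0 (\<alpha> x I) (a x I)" if "length I = Suc m" for I x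
    using \<alpha>'[OF that] by (simp_all add: \<alpha>_def)
  \<comment> \<open>The functions to be compared turn out to be constant on intersections, so a
    sample point records their values.\<close>
  define pt where "pt J = (SOME p. p \<in> BJ J)" for J
  have pt: "pt J \<in> BJ J" if "p \<in> BJ J" for p J unfolding pt_def using someI[of "\<lambda>p. p \<in> BJ J"] that by blast
  \<comment> \<open>Empty intersections impose no condition and have no sample point, so they
    contribute no equation.\<close>
  define N where "N = {J. length J = Suc (Suc m) \<and> BJ J \<noteq> {}}"
  define c where "c x J = cech (\<alpha> x) J (pt J) []" for x J
  \<comment> \<open>The difference of \<open>\<alpha> x\<close> and \<open>\<eta>\<close> is closed
    of degree 0, hence a constant \<open>b I\<close> on each convex intersection, and
    \<open>\<eta>\<close> is a cocycle. So \<open>cech (\<alpha> x)\<close> is a coboundary of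
    constants, for this \<open>x\<close> alone.\<close>
  have key: "\<exists>b. \<forall>J p. length J = Suc (Suc m) \<longrightarrow> p \<in> BJ J \<longrightarrow> cech (\<alpha> x) J p [] = (\<Sum>j<length J. (-1) ^ j * b (omit j J))"
    if x: "x \<in> P" for x
  proof -
    obtain \<eta> where \<eta>: "\<And>I. length I = Suc m \<Longrightarrow> frm P (BJ I) 0 (\<lambda>_. \<eta> I)"
      "\<And>I. length I = Suc m \<Longrightarrow> dfm (BJ I) 0 (\<eta> I) (a x I)"
      "\<And>J p. length J = Suc (Suc m) \<Longrightarrow> p \<in> BJ J \<Longrightarrow> cech \<eta> J p [] = 0"
      using "0.prems"(2)[OF x] by (metis empty_set empty_subsetI list.size(3))
    have const: "\<alpha> x I p [] - \<eta> I p [] = \<alpha> x I (pt I) [] - \<eta> I (pt I) []" if I: "length I = Suc m" and p: "p \<in> BJ I" for I p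
    proof -
      have \<alpha>c: "frm P (BJ I) 0 (\<lambda>_. \<alpha> x I)" by (rule frm_const[OF P BJ_open \<alpha>(1)[OF I] x])
      have f: "frm P (BJ I) 0 (\<lambda>_ p vs. \<alpha> x I p vs - \<eta> I p vs)" by (rule frm_diff[OF P BJ_open \<alpha>c \<eta>(1)[OF I]])
      have "dfm (BJ I) 0 (\<lambda>p vs. \<alpha> x I p vs - \<eta> I p vs) (\<lambda>p vs. a x I p vs - a x I p vs)"
        by (rule dfm_diff[OF BJ_open \<alpha>c \<eta>(1)[OF I] x \<alpha>(2)[OF I x] \<eta>(2)[OF I]])
      then have d: "dfm (BJ I) 0 (\<lambda>p vs. \<alpha> x I p vs - \<eta> I p vs) (\<lambda>p vs. 0)" by simp
      have "I \<noteq> []" using I by auto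
      then obtain c where c: "c \<in> A" "BJ I \<subseteq> fst c" "convex (snd c ` BJ I)" using good[of I] p by blast
      show ?thesis by (rule closed_0form_constant_on[OF BJ_open c f x d p pt[OF p]])
    qed
    define b where "b I = \<alpha> x I (pt I) [] - \<eta> I (pt I) []" for I
    have "cech (\<alpha> x) J p [] = (\<Sum>j<length J. (-1) ^ j * b (omit j J))" if J: "length J = Suc (Suc m)" and p: "p \<in> BJ J" for J p
    proof -
      have "cech (\<alpha> x) J p [] = cech (\<lambda>I p vs. \<alpha> x I p vs - \<eta> I p vs) J p []"
        using \<eta>(3)[OF J p] by (simp add: cech_diff)
      also have "\<dots> = (\<Sum>j<length J. (-1) ^ j * b (omit j J))"
        unfolding cech_def b_def
      proof (rule sum.cong[OF refl])
        fix j assume "j \<in> {..<length J}"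
        then have "length (omit j J) = Suc m" "p \<in> BJ (omit j J)" using J p BJ_omit by auto
        from const[OF this] show "(-1) ^ j * (\<alpha> x (omit j J) p [] - \<eta> (omit j J) p []) =
          (-1) ^ j * (\<alpha> x (omit j J) (pt (omit j J)) [] - \<eta> (omit j J) (pt (omit j J)) [])" by simp
      qed
      finally show ?thesis .
    qed
    then show ?thesis by blast
  qed
  have "\<exists>b. \<forall>J\<in>N. (\<Sum>j\<in>{..<length J}. (-1) ^ j * b (omit j J)) = c x J" if x: "x \<in> P" for x
  proof -
    obtain b where b: "\<And>J p. length J = Suc (Suc m) \<Longrightarrow> p \<in> BJ J \<Longrightarrow> cech (\<alpha> x) J p [] = (\<Sum>j<length J. (-1) ^ j * b (omit j J))"
      using key[OF x] by blast
    have "(\<Sum>j\<in>{..<length J}. (-1) ^ j * b (omit j J)) = c x J" if "J \<in> N" for J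
      using that b[of J "pt J"] pt by (auto simp: N_def c_def)
    then show ?thesis by blast
  qed
  \<comment> \<open>The unknowns are constants on index lists one shorter, and the row of
    \<open>J\<close> puts the coefficient (-1)^j at \<open>omit j J\<close>: rows are finite even
    for an infinite cover.\<close>
  then have "\<exists>Q S. (\<forall>t. finite (S t) \<and> S t \<subseteq> N) \<and>
    (\<forall>x\<in>P. \<forall>J\<in>N. (\<Sum>j\<in>{..<length J}. (-1) ^ j * (\<Sum>L\<in>S (omit j J). Q (omit j J) L * c x L)) = c x J)"
    by (intro finite_row_system_solution[where I="\<lambda>J. {..<length J}" and a="\<lambda>J j. (-1) ^ j" and \<tau>="\<lambda>J j. omit j J"]) auto
  then obtain Q S where QS: "\<And>t. finite (S t) \<and> S t \<subseteq> N"
    "\<And>x J. x \<in> P \<Longrightarrow> J \<in> N \<Longrightarrow> (\<Sum>j<length J. (-1) ^ j * (\<Sum>L\<in>S (omit j J). Q (omit j J) L * c x L)) = c x J"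
    by blast
  \<comment> \<open>A finite combination of the \<open>c x L\<close> with coefficients free of
    \<open>x\<close>; this makes the correction smooth.\<close>
  define \<beta> where "\<beta> x I = (\<Sum>L\<in>S I. Q I L * c x L)" for x I
  have cC: "Cinf_on P (\<lambda>x. c x J)" if J: "J \<in> N" for J
  proof -
    have "pt J \<in> BJ J" using J pt by (auto simp: N_def)
    then show ?thesis unfolding c_def
      using J by (intro frm_param_Cinf[OF P BJ_sub frm_cech[where m="Suc m", OF P \<alpha>(1)]]) (auto simp: N_def)
  qed
  have \<beta>C: "Cinf_on P (\<lambda>x. \<beta> x I)" for I
    unfolding \<beta>_def using QS(1)[of I] by (intro Cinf_on_sum Cinf_on_mult Cinf_on_const P cC) auto
  have \<beta>f: "frm P (BJ I) 0 (\<lambda>x p vs. \<beta> x I)" for I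
    unfolding frm_def sform_def
  proof (intro ballI conjI allI impI)
    fix c' z show "altm 0 (case z of (y, x) \<Rightarrow> rep c' (\<lambda>p vs. \<beta> x I) y)" by (simp add: altm_def)
  next
    fix c' and es :: "'e list" assume c': "c' \<in> A"
    have "open (snd c' ` (fst c' \<inter> BJ I))" by (rule chart_open_image_Int[OF c' BJ_open])
    then have "Cinf_on (snd c' ` (fst c' \<inter> BJ I) \<times> P) (\<lambda>z. \<beta> (snd z) I)"
      by (intro Cinf_on_compose[OF \<beta>C]) (use P in \<open>auto intro!: Cinf_intros open_Times\<close>)
    then show "Cinf_on (snd c' ` (fst c' \<inter> BJ I) \<times> P) (\<lambda>z. (case z of (y, x) \<Rightarrow> rep c' (\<lambda>p vs. \<beta> x I) y) es)"
      by (simp add: split_def rep_eq)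
  qed
  define \<tau> where "\<tau> x I = (\<lambda>p vs. \<alpha> x I p vs - \<beta> x I)" for x I
  show ?case
  proof (intro exI[of _ \<tau>] conjI allI impI ballI)
    fix I :: "nat list" assume I: "length I = Suc m"
    show "frm P (BJ I) 0 (\<lambda>x. \<tau> x I)" unfolding \<tau>_def by (rule frm_diff[OF P BJ_open \<alpha>(1)[OF I] \<beta>f])
    fix x assume x: "x \<in> P"
    have "dfm (BJ I) 0 (\<lambda>p vs. \<alpha> x I p vs - \<beta> x I) (\<lambda>p vs. a x I p vs - 0)"
      by (rule dfm_diff[OF BJ_open \<alpha>(1)[OF I] \<beta>f x \<alpha>(2)[OF I x] dfm_const0])
    then show "dfm (BJ I) 0 (\<tau> x I) (a x I)" by (simp add: \<tau>_def)
  next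
    fix x J p and vs :: "'a tvec list" assume x: "x \<in> P" and J: "length J = Suc (Suc m)" and p: "p \<in> BJ J" and "length vs = 0"
    obtain b where b: "\<And>J p. length J = Suc (Suc m) \<Longrightarrow> p \<in> BJ J \<Longrightarrow> cech (\<alpha> x) J p [] = (\<Sum>j<length J. (-1) ^ j * b (omit j J))"
      using key[OF x] by blast
    have "J \<in> N" using J p by (auto simp: N_def)
    have "cech (\<tau> x) J p [] = cech (\<alpha> x) J p [] - (\<Sum>j<length J. (-1) ^ j * \<beta> x (omit j J))"
      by (simp add: cech_def \<tau>_def right_diff_distrib sum_subtractf)
    also have "(\<Sum>j<length J. (-1) ^ j * \<beta> x (omit j J)) = c x J"
      unfolding \<beta>_def by (rule QS(2)[OF x \<open>J \<in> N\<close>])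
    also have "c x J = cech (\<alpha> x) J p []"
      unfolding c_def using b[OF J p] b[OF J pt[OF p]] by simp
    finally show "cech (\<tau> x) J p vs = 0" using \<open>length vs = 0\<close> by simp
  qed
next
  case (Suc q m a)
  have "\<exists>\<alpha>. frm P (BJ I) (Suc q) \<alpha> \<and> (\<forall>x\<in>P. dfm (BJ I) (Suc q) (\<alpha> x) (a x I))" if I: "length I = Suc m" for I
  proof (rule local_primitive[OF P BJ_open good Suc.prems(1)[OF I]])
    show "I \<noteq> []" using I by auto
    fix x assume x: "x \<in> P"
    then obtain \<eta> where "frm P (BJ I) (Suc q) (\<lambda>_. \<eta> I)" "dfm (BJ I) (Suc q) (\<eta> I) (a x I)" using Suc.prems(2) I by blast
    then show "dfm (BJ I) (Suc (Suc q)) (a x I) (\<lambda>p vs. 0)" using dfm_closed[OF BJ_open _ x] by blast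
  qed
  then obtain \<alpha>' where \<alpha>': "\<And>I. length I = Suc m \<Longrightarrow> frm P (BJ I) (Suc q) (\<alpha>' I)"
    "\<And>I x. length I = Suc m \<Longrightarrow> x \<in> P \<Longrightarrow> dfm (BJ I) (Suc q) (\<alpha>' I x) (a x I)" by metis
  define \<alpha> where "\<alpha> x I = \<alpha>' I x" for x I
  have \<alpha>: "frm P (BJ I) (Suc q) (\<lambda>x. \<alpha> x I)" "x \<in> P \<Longrightarrow> dfm (BJ I) (Suc q) (\<alpha> x I) (a x I)" if "length I = Suc m" for I x
    using \<alpha>'[OF that] by (simp_all add: \<alpha>_def)
  define a' where "a' x = cech (\<alpha> x)" for x
  have a': "frm P (BJ J) (Suc q) (\<lambda>x. a' x J)" if "length J = Suc (Suc m)" for J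
    unfolding a'_def by (rule frm_cech[OF P \<alpha>(1) that])
  \<comment> \<open>Local primitives \<open>\<gamma>\<close> of the closed difference of
    \<open>\<alpha> x\<close> and \<open>\<eta>\<close> give the cochain
    \<open>cech \<gamma>\<close>. Its derivative is \<open>a' x\<close> because
    \<open>\<eta>\<close> is a cocycle, and it is a cocycle because the Cech differential squares to
    zero.\<close>
  have ex': "\<exists>\<eta>'. (\<forall>J. length J = Suc (Suc m) \<longrightarrow> frm P (BJ J) q (\<lambda>_. \<eta>' J) \<and> dfm (BJ J) q (\<eta>' J) (a' x J)) \<and>
      (\<forall>L p vs. length L = Suc (Suc (Suc m)) \<longrightarrow> p \<in> BJ L \<longrightarrow> length vs = q \<longrightarrow> set vs \<subseteq> TS p \<longrightarrow> cech \<eta>' L p vs = 0)"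
    if x: "x \<in> P" for x
  proof -
    obtain \<eta> where \<eta>: "\<And>I. length I = Suc m \<Longrightarrow> frm P (BJ I) (Suc q) (\<lambda>_. \<eta> I)"
      "\<And>I. length I = Suc m \<Longrightarrow> dfm (BJ I) (Suc q) (\<eta> I) (a x I)"
      "\<And>J p vs. length J = Suc (Suc m) \<Longrightarrow> p \<in> BJ J \<Longrightarrow> length vs = Suc q \<Longrightarrow> set vs \<subseteq> TS p \<Longrightarrow> cech \<eta> J p vs = 0"
      using Suc.prems(2)[OF x] by blast
    let ?d = "\<lambda>I p vs. \<alpha> x I p vs - \<eta> I p vs"
    have "\<exists>\<gamma>. frm P (BJ I) q \<gamma> \<and> (\<forall>x'\<in>P. dfm (BJ I) q (\<gamma> x') (?d I))" if I: "length I = Suc m" for I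
    proof (rule local_primitive[OF P BJ_open good])
      show "I \<noteq> []" using I by auto
      have \<alpha>c: "frm P (BJ I) (Suc q) (\<lambda>_. \<alpha> x I)" by (rule frm_const[OF P BJ_open \<alpha>(1)[OF I] x])
      show "frm P (BJ I) (Suc q) (\<lambda>_. ?d I)" by (rule frm_diff[OF P BJ_open \<alpha>c \<eta>(1)[OF I]])
      have "dfm (BJ I) (Suc q) (?d I) (\<lambda>p vs. a x I p vs - a x I p vs)"
        by (rule dfm_diff[OF BJ_open \<alpha>c \<eta>(1)[OF I] x \<alpha>(2)[OF I x] \<eta>(2)[OF I]])
      then show "dfm (BJ I) (Suc q) (?d I) (\<lambda>p vs. 0)" by simp
    qed
    then have "\<forall>I. \<exists>\<gamma>. length I = Suc m \<longrightarrow> frm P (BJ I) q \<gamma> \<and> dfm (BJ I) q (\<gamma> x) (?d I)"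
      using x by blast
    from choice[OF this] obtain g where "\<forall>I. length I = Suc m \<longrightarrow> frm P (BJ I) q (g I) \<and> dfm (BJ I) q (g I x) (?d I)"
      by blast
    then have g: "frm P (BJ I) q (g I)" "dfm (BJ I) q (g I x) (?d I)" if "length I = Suc m" for I
      using that by blast+
    define \<gamma> where "\<gamma> I = g I x" for I
    have \<gamma>: "frm P (BJ I) q (\<lambda>_. \<gamma> I)" "dfm (BJ I) q (\<gamma> I) (?d I)" if "length I = Suc m" for I
      using frm_const[OF P BJ_open g(1)[OF that] x] g(2)[OF that] by (simp_all add: \<gamma>_def)
    show ?thesis
    proof (intro exI[of _ "cech \<gamma>"] conjI allI impI)
      fix J :: "nat list" assume J: "length J = Suc (Suc m)"
      show "frm P (BJ J) q (\<lambda>_. cech \<gamma> J)" by (rule frm_cech[OF P \<gamma>(1) J])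
      have "dfm (BJ J) q (cech \<gamma> J) (cech ?d J)"
        by (rule dfm_cech[where P=P and a="\<lambda>_. \<gamma>", OF \<gamma>(1) J x \<gamma>(2)])
      then show "dfm (BJ J) q (cech \<gamma> J) (a' x J)"
        by (rule dfm_cong[OF BJ_open refl, rotated]) (simp add: a'_def cech_diff \<eta>(3) J)
    next
      fix L :: "nat list" and p and vs :: "'a tvec list" assume "length L = Suc (Suc (Suc m))"
      then show "cech (cech \<gamma>) L p vs = 0" by (rule cech_cech)
    qed
  qed
  obtain t where t: "\<And>J. length J = Suc (Suc m) \<Longrightarrow> frm P (BJ J) q (\<lambda>x. t x J)"
    "\<And>J x. length J = Suc (Suc m) \<Longrightarrow> x \<in> P \<Longrightarrow> dfm (BJ J) q (t x J) (a' x J)"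
    "\<And>x L p vs. x \<in> P \<Longrightarrow> length L = Suc (Suc (Suc m)) \<Longrightarrow> p \<in> BJ L \<Longrightarrow> length vs = q \<Longrightarrow> set vs \<subseteq> TS p \<Longrightarrow> cech (t x) L p vs = 0"
    using Suc.IH[OF a' ex'] by blast
  have \<kappa>: "frm P (BJ I) q (\<lambda>x. contr (t x) I)" if "length I = Suc m" for I
    by (rule frm_contr[OF P t(1) that])
  have "\<exists>D. frm P (BJ I) (Suc q) D \<and> (\<forall>x\<in>P. dfm (BJ I) q (contr (t x) I) (D x))" if I: "length I = Suc m" for I
  proof (rule local_derivative[OF P BJ_open _ \<kappa>[OF I]])
    have "I \<noteq> []" using I by auto
    then show "BJ I = {} \<or> (\<exists>c\<in>A. BJ I \<subseteq> fst c)" using good by blast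
  qed
  then obtain D' where D': "\<And>I. length I = Suc m \<Longrightarrow> frm P (BJ I) (Suc q) (D' I)"
    "\<And>I x. length I = Suc m \<Longrightarrow> x \<in> P \<Longrightarrow> dfm (BJ I) q (contr (t x) I) (D' I x)" by metis
  define D where "D x I = D' I x" for x I
  have D: "frm P (BJ I) (Suc q) (\<lambda>x. D x I)" "x \<in> P \<Longrightarrow> dfm (BJ I) q (contr (t x) I) (D x I)" if "length I = Suc m" for I x
    using D'[OF that] by (simp_all add: D_def)
  define \<tau> where "\<tau> x I = (\<lambda>p vs. \<alpha> x I p vs - D x I p vs)" for x I
  show ?case
  proof (intro exI[of _ \<tau>] conjI allI impI ballI)
    fix I :: "nat list" assume I: "length I = Suc m"
    show "frm P (BJ I) (Suc q) (\<lambda>x. \<tau> x I)" unfolding \<tau>_def by (rule frm_diff[OF P BJ_open \<alpha>(1)[OF I] D(1)[OF I]])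
    fix x assume x: "x \<in> P"
    have "dfm (BJ I) (Suc q) (D x I) (\<lambda>p vs. 0)"
      by (rule dfm_closed[OF BJ_open \<kappa>[OF I] x D(2)[OF I x]])
    from dfm_diff[OF BJ_open \<alpha>(1)[OF I] D(1)[OF I] x \<alpha>(2)[OF I x] this]
    show "dfm (BJ I) (Suc q) (\<tau> x I) (a x I)" by (simp add: \<tau>_def)
  next
    fix x J p vs assume x: "x \<in> P" and J: "length J = Suc (Suc m)" and p: "p \<in> BJ J" and vs: "length vs = Suc q" "set vs \<subseteq> TS p"
    have d: "dfm (BJ J) q (cech (contr (t x)) J) (cech (D x) J)"
      by (rule dfm_cech[where P=P and a="\<lambda>x. contr (t x)", OF \<kappa> J x D(2)[OF _ x]])
    \<comment> \<open>\<open>cech (contr (t x))\<close> and \<open>t x\<close> agree on the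
      intersection, so their derivatives \<open>cech (D x)\<close> and \<open>a' x\<close> agree
      there too.\<close>
    have "cech (D x) J p vs = a' x J p vs"
    proof (rule dfm_unique[OF BJ_open d t(2)[OF J x] _ p vs])
      fix p' and ws :: "'a tvec list" assume p': "p' \<in> BJ J" and ws: "length ws = q" "set ws \<subseteq> TS p'"
      show "cech (contr (t x)) J p' ws = t x J p' ws"
        by (rule cech_contr[OF t(3)[OF x _ _ ws] J p'])
    qed
    moreover have "cech (\<tau> x) J p vs = cech (\<alpha> x) J p vs - cech (D x) J p vs"
      by (simp add: cech_def \<tau>_def right_diff_distrib sum_subtractf)
    ultimately show "cech (\<tau> x) J p vs = 0" by (simp add: a'_def)
  qed
qed

end

section \<open>From the descent in Cech degree zero to a global family\<close>

theorem (in good_cover) smooth_family_primitive: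
  fixes P :: "'p::finite_dim_inner set"
  assumes P: "open P" and ex: "\<forall>x\<in>P. exact_form X A k (\<omega> x)" and \<omega>: "smooth_family X A P (Suc k) \<omega>"
  shows "\<exists>\<tau>. smooth_family X A P k \<tau> \<and> (\<forall>x\<in>P. has_ext_deriv X A k (\<tau> x) (\<omega> x))"
proof -
  have \<omega>f: "frm P (topspace X) (Suc k) \<omega>" by (rule smooth_family_imp_frm[OF P \<omega>])
  have "\<exists>\<tau>. (\<forall>I. length I = Suc 0 \<longrightarrow> frm P (BJ I) k (\<lambda>x. \<tau> x I) \<and> (\<forall>x\<in>P. dfm (BJ I) k (\<tau> x I) (\<omega> x))) \<and>
      (\<forall>x\<in>P. \<forall>J p vs. length J = Suc (Suc 0) \<longrightarrow> p \<in> BJ J \<longrightarrow> length vs = k \<longrightarrow> set vs \<subseteq> TS p \<longrightarrow> cech (\<tau> x) J p vs = 0)"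
  proof (rule cech_descent[OF P])
    show "frm P (BJ I) (Suc k) (\<lambda>x. \<omega> x)" for I by (rule frm_subset[OF \<omega>f BJ_sub])
    fix x assume "x \<in> P"
    then obtain \<eta> where \<eta>: "\<eta> \<in> smooth_forms X A k" "has_ext_deriv X A k \<eta> (\<omega> x)"
      using ex by (auto simp: exact_form_def)
    show "\<exists>\<eta>. (\<forall>I. length I = Suc 0 \<longrightarrow> frm P (BJ I) k (\<lambda>_. \<eta> I) \<and> dfm (BJ I) k (\<eta> I) (\<omega> x)) \<and>
      (\<forall>J p vs. length J = Suc (Suc 0) \<longrightarrow> p \<in> BJ J \<longrightarrow> length vs = k \<longrightarrow> set vs \<subseteq> TS p \<longrightarrow> cech \<eta> J p vs = 0)"
    \<comment> \<open>The global primitive given for this \<open>x\<close>, taken on every member of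
      the cover, is a cocycle because its difference with itself vanishes on overlaps.\<close>
    proof (intro exI[of _ "\<lambda>_. \<eta>"] conjI allI impI)
      show "frm P (BJ I) k (\<lambda>_. \<eta>)" for I by (rule frm_subset[OF smooth_form_imp_frm[OF P \<eta>(1)] BJ_sub])
      show "dfm (BJ I) k \<eta> (\<omega> x)" for I using \<eta>(2) dfm_subset[OF _ BJ_sub] by (simp add: has_ext_deriv_iff)
      show "cech (\<lambda>_. \<eta>) J p vs = 0" if "length J = Suc (Suc 0)" for J p vs using that by (simp add: cech_def)
    qed
  qed
  then obtain t where t: "\<And>i. frm P (BJ [i]) k (\<lambda>x. t x [i])" "\<And>i x. x \<in> P \<Longrightarrow> dfm (BJ [i]) k (t x [i]) (\<omega> x)"
    "\<And>x i j p vs. x \<in> P \<Longrightarrow> p \<in> BJ [i, j] \<Longrightarrow> length vs = k \<Longrightarrow> set vs \<subseteq> TS p \<Longrightarrow> cech (t x) [i, j] p vs = 0"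
    by (metis length_Cons list.size(3))
  \<comment> \<open>An arbitrary member of the cover around each point; the cocycle condition makes
    the glued value independent of this choice.\<close>
  define idx where "idx p = (SOME i. p \<in> B i)" for p
  have cov: "\<exists>i. p \<in> B i" if p: "p \<in> topspace X" for p
  proof -
    have "\<exists>i. \<rho> i p \<noteq> 0"
    proof (rule ccontr)
      assume "\<nexists>i. \<rho> i p \<noteq> 0"
      then show False using \<rho>_sum[OF p] by simp
    qed
    then show ?thesis using \<rho>_K K_B by blast
  qed
  have idx: "p \<in> B (idx p)" if "p \<in> topspace X" for p unfolding idx_def using cov[OF that] by (rule someI_ex)
  define \<tau> where "\<tau> x p vs = t x [idx p] p vs" for x p vs
  have eq: "t x [i] p vs = \<tau> x p vs" if x: "x \<in> P" and p: "p \<in> BJ [i]" and vs: "length vs = k" "set vs \<subseteq> TS p" for x i p vs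
  proof -
    have "p \<in> BJ [i, idx p]" using p idx[of p] by (simp add: BI_def)
    from t(3)[OF x this vs] show ?thesis by (simp add: \<tau>_def cech_def omit_def)
  qed
  have "frm P (topspace X) k \<tau>"
  proof (rule frm_local[OF P openin_topspace])
    fix p assume p: "p \<in> topspace X"
    then obtain i where i: "p \<in> B i" using cov by blast
    have "frm P (BJ [i]) k \<tau>"
      using frm_cong[OF P BJ_open, where q=k and \<alpha>="\<lambda>x. t x [i]" and \<beta>=\<tau>] eq t(1) by blast
    then show "\<exists>V. openin X V \<and> p \<in> V \<and> frm P V k \<tau>"
      using p i BJ_open by (intro exI[of _ "BJ [i]"] conjI BJ_open) (auto simp: BI_def)
  qed
  then have "smooth_family X A P k \<tau>" by (rule frm_imp_smooth_family[OF P])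
  moreover have "has_ext_deriv X A k (\<tau> x) (\<omega> x)" if x: "x \<in> P" for x
    unfolding has_ext_deriv_iff
  proof (rule dfm_local)
    fix p assume p: "p \<in> topspace X"
    then obtain i where i: "p \<in> B i" using cov by blast
    have "dfm (BJ [i]) k (\<tau> x) (\<omega> x)"
      by (rule dfm_cong[OF BJ_open _ _ t(2)[OF x]]) (auto intro: eq[OF x])
    then show "\<exists>V. p \<in> V \<and> dfm V k (\<tau> x) (\<omega> x)"
      using p i by (intro exI[of _ "BJ [i]"]) (auto simp: BI_def)
  qed
  ultimately show ?thesis by blast
qed

theorem theorem1:
  fixes X :: "'a topology"
    and A :: "('a, 'e::finite_dim_inner) chart set"
    and k :: nat
    and P :: "'p::finite_dim_inner set"
    and \<omega> :: "'p \<Rightarrow> 'a form"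
  assumes "smooth_manifold X A"
    and "open P"
    and "\<forall>x\<in>P. exact_form X A k (\<omega> x)"
    and "smooth_family X A P (k + 1) \<omega>"
  shows "\<exists>\<tau>. smooth_family X A P k \<tau> \<and> (\<forall>x\<in>P. has_ext_deriv X A k (\<tau> x) (\<omega> x))"
proof -
  interpret smooth_mfd X A by unfold_locales (rule assms(1))
  show ?thesis
  \<comment> \<open>The empty manifold is separate because the partition of unity comes with a
    sequence of points of the space.\<close>
  proof (cases "topspace X = {}")
    case True
    have "frm P (topspace X) k (\<lambda>_ _ _. 0)" unfolding True by (rule frm_empty)
    then have "smooth_family X A P k (\<lambda>_ _ _. 0)" by (rule frm_imp_smooth_family[OF assms(2)])
    moreover have "has_ext_deriv X A k \<eta> \<omega>'" for \<eta> \<omega>'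
      unfolding has_ext_deriv_iff True by (rule dfm_empty)
    ultimately show ?thesis by blast
  next
    case False
    then obtain B \<rho> K where good:
      "(\<forall>i::nat. openin X (B i) \<and> \<rho> i \<in> SF \<and> closedin X (K i) \<and> K i \<subseteq> B i \<and> (\<forall>q. q \<notin> K i \<longrightarrow> \<rho> i q = 0)) \<and>
      (\<forall>p\<in>topspace X. \<exists>W. openin X W \<and> p \<in> W \<and> finite {i. K i \<inter> W \<noteq> {}}) \<and>
      (\<forall>p\<in>topspace X. (\<Sum>i | \<rho> i p \<noteq> 0. \<rho> i p) = 1) \<and>
      (\<forall>I. I \<noteq> [] \<longrightarrow> BI B I \<noteq> {} \<longrightarrow> (\<exists>c\<in>A. BI B I \<subseteq> dm c \<and> convex (ph c ` BI B I)))"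
      using good_cover_exists by blast
    interpret good_cover X A B \<rho> K
      by unfold_locales (use good in \<open>blast+\<close>)
    show ?thesis using smooth_family_primitive[OF assms(2,3)] assms(4) by simp
  qed
qed

end
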